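(* Let $G$ be a discrete group with the left-invariant calculus on $A=C(G)$ given by a subset $\mathcal C\subseteq G\setminus\{e\}$. If $\mathcal C=\mathcal C^{1,0}\sqcup\mathcal C^{0,1}$ is a disjoint union of two subsets bijective by group inversion, then $\Omega_L(G)$, $\Omega_{LL}(G)$ and, in the bicovariant case, $\Omega_{\mathrm{Wor}}(G)$ have quotients $\Omega(G)$ which form a Dolbeault complex. Moreover, the further relations $$e^a\wedge e^{b^{-1}}+\wedge\Psi(e^a\otimes e^{b^{-1}})=0$$ for all $a,b\in\mathcal C^{0,1}$ (if not already present) make $\Omega(G)$ factorisable in degree 2.
   Context: $A=C(G)$ is the algebra of complex functions on $G$ with pointwise conjugation as $*$, and $\mathcal C$ is finite. $\Omega^1$ is the free left $A$-module with basis $\{e^a\}_{a\in\mathcal C}$, bimodule relations $e^af=R_a(f)e^a$, where $R_a(f)(g)=f(ga)$, and $\mathrm{d}f=\sum_{a\in\mathcal C}(R_a(f)-f)e^a$. When $\mathcal C$ is closed under inverses there is a $*$-structure $(e^a)^*=-e^{a^{-1}}$. The calculus is bicovariant if $\mathcal C$ is a union of conjugacy classes. $\Omega_L(G)$ is the quotient of the tensor algebra of $\Omega^1$ over $A$ by the relations $\sum_{a,b\in\mathcal C,\,ab=z}e^a\wedge e^b=0$ for all $z\in G\setminus\{e\}$; $\Omega_{LL}(G)$ is the further quotient by the same relation for $z=e$. The map $\Psi$ is given by $\Psi(e^a\otimes e^b)=e^{aba^{-1}}\otimes e^a$, so that the further relations in the claim read $e^a\wedge e^{b^{-1}}+e^{ab^{-1}a^{-1}}\wedge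 e^a=0$. In the bicovariant case $\Psi$ is the Woronowicz braiding, and $\Omega_{\mathrm{Wor}}(G)$ is the Woronowicz exterior algebra, the quotient of the tensor algebra by the kernels of the antisymmetrisers $\sum_{\sigma\in S_n}\mathrm{sgn}(\sigma)\Psi_\sigma$ (in degree 2: by $\ker(\mathrm{id}-\Psi)$). In each case $\mathrm{d}$ is the graded commutator with $\theta=\sum_{a\in\mathcal C}e^a$. Give $e^a$ bidegree $(1,0)$ if $a\in\mathcal C^{1,0}$ and $(0,1)$ if $a\in\mathcal C^{0,1}$. The quotient $\Omega(G)$ of each of these exterior algebras is obtained by imposing each bihomogeneous component of each defining relation as a separate relation. On it, $\partial$ and $\bar\partial$ are the graded commutators with $\theta^{1,0}=\sum_{a\in\mathcal C^{1,0}}e^a$ and $\theta^{0,1}=\sum_{a\in\mathcal C^{0,1}}e^a$. Dolbeault complex: a $*$-DGA $(\Omega,\mathrm{d})$ with $\Omega^m=\oplus_{p+q=m}\Omega^{p,q}$ as $A$-bimodules, $\wedge$ respecting bidegree, $\mathrm{d}=\partial+\bar\partial$ with $\partial,\bar\partial$ anticommuting square-zero graded derivations of bidegrees $(1,0)$, $(0,1)$, and $(\Omega^{p,q})^*=\Omega^{q,p}$, $(\partial\xi)^*=\bar\partial(\xi^* )$. Here $(\xi\wedge\eta)^*=(-1)^{|\xi||\eta|}\eta^*\wedge\xi^*$. Factorisable in degree 2 means that $\wedge:\Omega^{1,0}\otimes_A\Omega^{0,1}\to\Omega^{1,1}$ and $\wedge:\Omega^{0,1}\otimes_A\Omega^{1,0}\to\Omega^{1,1}$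 are bimodule isomorphisms.
   Formalization: The "Moreover" part is proved assuming ab^{-1}a^{-1} ∈ C^{1,0} for all a,b ∈ C^{0,1}; otherwise the relation is undefined or factorisability fails, e.g. in Q8 with C^{1,0}={i,j}, a=-i, b=-j, where e^{-i}∧e^{j}=0 is forced. *)

theory Defs
  imports
    Complex_Main
    "HOL-Algebra.QuotRing"
    "HOL-Algebra.Free_Abelian_Groups"
    "HOL-Combinatorics.Permutations"
begin

text \<open>
  The group \<open>G\<close> is a type of class \<^class>\<open>group_add\<close>: it is written additively but is not assumed
  commutative, so \<open>e\<close> is \<open>0\<close>, the inverse of \<open>a\<close> is \<open>- a\<close>, and \<open>a b a\<^sup>-\<^sup>1\<close> is \<open>a + b - a\<close>.
  The algebra \<open>A = C(G)\<close> is the type \<open>'g \<Rightarrow> complex\<close> with pointwise operations.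
\<close>


section \<open>Differential graded algebras over \<open>C(G)\<close> and Dolbeault complexes\<close>

text \<open>Multiplication by \<open>(-1)\<^sup>n\<close>.\<close>

definition koszul :: "('w, 'm) ring_scheme \<Rightarrow> nat \<Rightarrow> 'w \<Rightarrow> 'w" where
  "koszul R n x = (if even n then x else \<ominus>\<^bsub>R\<^esub> x)"

definition internal_direct_sum ::
    "('w, 'm) ring_scheme \<Rightarrow> 'i set \<Rightarrow> ('i \<Rightarrow> 'w set) \<Rightarrow> 'w set \<Rightarrow> bool" where
  "internal_direct_sum R I H M \<longleftrightarrow>
     additive_subgroup M R \<and>
     (\<forall>i\<in>I. additive_subgroup (H i) R \<and> H i \<subseteq> M) \<and>
     (\<forall>x\<in>M. \<exists>!h. h \<in> (\<Pi>\<^sub>E i\<in>I. H i) \<and> finite {i \<in> I. h i \<noteq> \<zero>\<^bsub>R\<^esub>} \<and>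
        x = (\<Oplus>\<^bsub>R\<^esub>i\<in>{i \<in> I. h i \<noteq> \<zero>\<^bsub>R\<^esub>}. h i))"

text \<open>The complex scalar \<open>c\<close> acts on \<open>R\<close> as multiplication by the constant function \<open>\<iota> (\<lambda>_. c)\<close>.\<close>

definition graded_derivation ::
    "('w, 'm) ring_scheme \<Rightarrow> (('g \<Rightarrow> complex) \<Rightarrow> 'w) \<Rightarrow> (nat \<Rightarrow> 'w set) \<Rightarrow> ('w \<Rightarrow> 'w) \<Rightarrow> bool" where
  "graded_derivation R \<iota> gr D \<longleftrightarrow>
     D \<in> carrier R \<rightarrow> carrier R \<and>
     (\<forall>x\<in>carrier R. \<forall>y\<in>carrier R. D (x \<oplus>\<^bsub>R\<^esub> y) = D x \<oplus>\<^bsub>R\<^esub> D y) \<and>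
     (\<forall>c. \<forall>x\<in>carrier R. D (\<iota> (\<lambda>_. c) \<otimes>\<^bsub>R\<^esub> x) = \<iota> (\<lambda>_. c) \<otimes>\<^bsub>R\<^esub> D x) \<and>
     (\<forall>n. \<forall>x\<in>gr n. \<forall>y\<in>carrier R.
        D (x \<otimes>\<^bsub>R\<^esub> y) = D x \<otimes>\<^bsub>R\<^esub> y \<oplus>\<^bsub>R\<^esub> koszul R n (x \<otimes>\<^bsub>R\<^esub> D y))"

locale dga_over_functions = ring \<Omega> for \<Omega> (structure) +
  fixes \<iota> :: "('g \<Rightarrow> complex) \<Rightarrow> 'a"
    and gr :: "nat \<Rightarrow> 'a set"
    and d :: "'a \<Rightarrow> 'a"
  assumes fun_bij: "bij_betw \<iota> UNIV (gr 0)"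
    and fun_add: "\<iota> (\<lambda>x. f x + g x) = \<iota> f \<oplus> \<iota> g"
    and fun_mult: "\<iota> (\<lambda>x. f x * g x) = \<iota> f \<otimes> \<iota> g"
    and fun_one: "\<iota> (\<lambda>_. 1) = \<one>"
    and scalar_central: "\<xi> \<in> carrier \<Omega> \<Longrightarrow> \<iota> (\<lambda>_. c) \<otimes> \<xi> = \<xi> \<otimes> \<iota> (\<lambda>_. c)"
    and grading: "internal_direct_sum \<Omega> UNIV gr (carrier \<Omega>)"
    and gr_mult: "\<lbrakk>\<xi> \<in> gr m; \<eta> \<in> gr n\<rbrakk> \<Longrightarrow> \<xi> \<otimes> \<eta> \<in> gr (m + n)"
    and d_derivation: "graded_derivation \<Omega> \<iota> gr d"
    and d_degree: "\<xi> \<in> gr n \<Longrightarrow> d \<xi> \<in> gr (Suc n)"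
    and d_square: "\<xi> \<in> carrier \<Omega> \<Longrightarrow> d (d \<xi>) = \<zero>"

locale double_complex_over_functions = dga_over_functions +
  fixes bigr :: "nat \<Rightarrow> nat \<Rightarrow> 'a set"
    and del :: "'a \<Rightarrow> 'a"
    and delbar :: "'a \<Rightarrow> 'a"
  assumes bigrading: "internal_direct_sum \<Omega> {..m} (\<lambda>p. bigr p (m - p)) (gr m)"
    and bigr_left: "\<xi> \<in> bigr p q \<Longrightarrow> \<iota> f \<otimes> \<xi> \<in> bigr p q"
    and bigr_right: "\<xi> \<in> bigr p q \<Longrightarrow> \<xi> \<otimes> \<iota> f \<in> bigr p q"
    and bigr_mult: "\<lbrakk>\<xi> \<in> bigr p q; \<eta> \<in> bigr r s\<rbrakk> \<Longrightarrow> \<xi> \<otimes> \<eta> \<in> bigr (p + r) (q + s)"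
    and d_split: "\<xi> \<in> carrier \<Omega> \<Longrightarrow> d \<xi> = del \<xi> \<oplus> delbar \<xi>"
    and del_derivation: "graded_derivation \<Omega> \<iota> gr del"
    and delbar_derivation: "graded_derivation \<Omega> \<iota> gr delbar"
    and del_bidegree: "\<xi> \<in> bigr p q \<Longrightarrow> del \<xi> \<in> bigr (Suc p) q"
    and delbar_bidegree: "\<xi> \<in> bigr p q \<Longrightarrow> delbar \<xi> \<in> bigr p (Suc q)"
    and del_square: "\<xi> \<in> carrier \<Omega> \<Longrightarrow> del (del \<xi>) = \<zero>"
    and delbar_square: "\<xi> \<in> carrier \<Omega> \<Longrightarrow> delbar (delbar \<xi>) = \<zero>"
    and anticommute: "\<xi> \<in> carrier \<Omega> \<Longrightarrow> del (delbar \<xi>) \<oplus> delbar (del \<xi>) = \<zero>"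

text \<open>Antilinearity of the involution is the case of constant \<open>f\<close> in \<open>star_fun\<close>, together with
  \<open>star_mult\<close> and \<open>scalar_central\<close>.\<close>

locale dolbeault_complex_over_functions = double_complex_over_functions +
  fixes star :: "'a \<Rightarrow> 'a"
  assumes star_closed: "\<xi> \<in> carrier \<Omega> \<Longrightarrow> star \<xi> \<in> carrier \<Omega>"
    and star_star: "\<xi> \<in> carrier \<Omega> \<Longrightarrow> star (star \<xi>) = \<xi>"
    and star_add: "\<lbrakk>\<xi> \<in> carrier \<Omega>; \<eta> \<in> carrier \<Omega>\<rbrakk> \<Longrightarrow> star (\<xi> \<oplus> \<eta>) = star \<xi> \<oplus> star \<eta>"
    and star_fun: "star (\<iota> f) = \<iota> (\<lambda>x. cnj (f x))"
    and star_degree: "\<xi> \<in> gr n \<Longrightarrow> star \<xi> \<in> gr n"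
    and star_mult: "\<lbrakk>\<xi> \<in> gr m; \<eta> \<in> gr n\<rbrakk> \<Longrightarrow>
          star (\<xi> \<otimes> \<eta>) = koszul \<Omega> (m * n) (star \<eta> \<otimes> star \<xi>)"
    and star_d: "\<xi> \<in> carrier \<Omega> \<Longrightarrow> star (d \<xi>) = d (star \<xi>)"
    and star_bidegree: "star ` bigr p q = bigr q p"
    and star_del: "\<xi> \<in> carrier \<Omega> \<Longrightarrow> star (del \<xi>) = delbar (star \<xi>)"


section \<open>Tensor products over a subring and factorisability\<close>

text \<open>
  For a subring \<open>A\<close> of \<open>R\<close> and subsets \<open>M\<close>, \<open>N\<close> of \<open>R\<close> that are \<open>A\<close>-bimodules under multiplication
  in \<open>R\<close>, \<open>M \<otimes>\<^sub>A N\<close> is the free abelian group on \<open>M \<times> N\<close> modulo biadditivity and \<open>A\<close>-balancedness.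
\<close>

definition tensor_relations ::
    "('w, 'm) ring_scheme \<Rightarrow> 'w set \<Rightarrow> 'w set \<Rightarrow> 'w set \<Rightarrow> (('w \<times> 'w) \<Rightarrow>\<^sub>0 int) set" where
  "tensor_relations R A M N =
     {frag_of (x \<oplus>\<^bsub>R\<^esub> x', y) - frag_of (x, y) - frag_of (x', y) | x x' y.
        x \<in> M \<and> x' \<in> M \<and> y \<in> N} \<union>
     {frag_of (x, y \<oplus>\<^bsub>R\<^esub> y') - frag_of (x, y) - frag_of (x, y') | x y y'.
        x \<in> M \<and> y \<in> N \<and> y' \<in> N} \<union>
     {frag_of (x \<otimes>\<^bsub>R\<^esub> f, y) - frag_of (x, f \<otimes>\<^bsub>R\<^esub> y) | x f y.
        x \<in> M \<and> f \<in> A \<and> y \<in> N}"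

definition tensor_kernel ::
    "('w, 'm) ring_scheme \<Rightarrow> 'w set \<Rightarrow> 'w set \<Rightarrow> 'w set \<Rightarrow> (('w \<times> 'w) \<Rightarrow>\<^sub>0 int) set" where
  "tensor_kernel R A M N = generate (free_Abelian_group (M \<times> N)) (tensor_relations R A M N)"

definition tensor_product ::
    "('w, 'm) ring_scheme \<Rightarrow> 'w set \<Rightarrow> 'w set \<Rightarrow> 'w set \<Rightarrow> (('w \<times> 'w) \<Rightarrow>\<^sub>0 int) set monoid" where
  "tensor_product R A M N = free_Abelian_group (M \<times> N) Mod tensor_kernel R A M N"

definition pure_tensor ::
    "('w, 'm) ring_scheme \<Rightarrow> 'w set \<Rightarrow> 'w set \<Rightarrow> 'w set \<Rightarrow> 'w \<Rightarrow> 'w \<Rightarrow> (('w \<times> 'w) \<Rightarrow>\<^sub>0 int) set" where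
  "pure_tensor R A M N x y =
     tensor_kernel R A M N #>\<^bsub>free_Abelian_group (M \<times> N)\<^esub> frag_of (x, y)"

text \<open>
  The product \<open>x \<otimes> y \<mapsto> x y\<close> is an isomorphism of \<open>A\<close>-bimodules from \<open>M \<otimes>\<^sub>A N\<close> onto \<open>P\<close>.  Pure
  tensors generate \<open>M \<otimes>\<^sub>A N\<close>, so the values on them determine \<open>\<phi>\<close>, and bilinearity over \<open>A\<close> need
  only be required on them.
\<close>

definition product_bimodule_iso ::
    "('w, 'm) ring_scheme \<Rightarrow> 'w set \<Rightarrow> 'w set \<Rightarrow> 'w set \<Rightarrow> 'w set \<Rightarrow> bool" where
  "product_bimodule_iso R A M N P \<longleftrightarrow>
     (\<exists>\<phi> \<in> iso (tensor_product R A M N) ((add_monoid R)\<lparr>carrier := P\<rparr>).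
        \<forall>x\<in>M. \<forall>y\<in>N.
          \<phi> (pure_tensor R A M N x y) = x \<otimes>\<^bsub>R\<^esub> y \<and>
          (\<forall>f\<in>A.
            \<phi> (pure_tensor R A M N (f \<otimes>\<^bsub>R\<^esub> x) y) = f \<otimes>\<^bsub>R\<^esub> \<phi> (pure_tensor R A M N x y) \<and>
            \<phi> (pure_tensor R A M N x (y \<otimes>\<^bsub>R\<^esub> f)) = \<phi> (pure_tensor R A M N x y) \<otimes>\<^bsub>R\<^esub> f))"

definition factorisable_degree_2 ::
    "('w, 'm) ring_scheme \<Rightarrow> (nat \<Rightarrow> 'w set) \<Rightarrow> (nat \<Rightarrow> nat \<Rightarrow> 'w set) \<Rightarrow> bool" where
  "factorisable_degree_2 R gr bigr \<longleftrightarrow>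
     product_bimodule_iso R (gr 0) (bigr 1 0) (bigr 0 1) (bigr 1 1) \<and>
     product_bimodule_iso R (gr 0) (bigr 0 1) (bigr 1 0) (bigr 1 1)"


section \<open>The tensor algebra of \<open>\<Omega>\<^sup>1\<close>\<close>

text \<open>
  \<open>\<Omega>\<^sup>1 \<otimes>\<^sub>A \<dots> \<otimes>\<^sub>A \<Omega>\<^sup>1\<close> (\<open>n\<close> factors) is the free left \<open>A\<close>-module on the words
  \<open>e\<^sup>w = e\<^sup>a\<^sup>1 \<otimes> \<dots> \<otimes> e\<^sup>a\<^sup>n\<close> in \<open>C\<close>, functions being moved to the left with \<open>e\<^sup>a f = R\<^sub>a(f) e\<^sup>a\<close>.  The
  element \<open>\<Sum>\<^sub>w f\<^sub>w e\<^sup>w\<close> is the finitely supported function \<open>w \<mapsto> f\<^sub>w\<close>, and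
  \<open>(f e\<^sup>u)(g e\<^sup>v) = f R\<^sub>|\<^sub>u\<^sub>|(g) e\<^sup>u\<^sup>v\<close> with \<open>|u|\<close> the group product \<^term>\<open>sum_list u\<close>.
\<close>

type_synonym 'g tensor = "'g list \<Rightarrow> 'g \<Rightarrow> complex"

definition tensor_algebra :: "'g::group_add set \<Rightarrow> 'g tensor ring" where
  "tensor_algebra C =
     \<lparr>carrier = {t. finite {w. t w \<noteq> (\<lambda>_. 0)} \<and> (\<forall>w. t w \<noteq> (\<lambda>_. 0) \<longrightarrow> set w \<subseteq> C)},
      monoid.mult = (\<lambda>s t w x. \<Sum>k\<le>length w. s (take k w) x * t (drop k w) (x + sum_list (take k w))),
      monoid.one = (\<lambda>w x. if w = [] then 1 else 0),
      ring.zero = (\<lambda>w x. 0),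
      ring.add = (\<lambda>s t w x. s w x + t w x)\<rparr>"

definition fun_tensor :: "('g \<Rightarrow> complex) \<Rightarrow> 'g tensor" where
  "fun_tensor f = (\<lambda>w x. if w = [] then f x else 0)"

definition basis_form :: "'g \<Rightarrow> 'g tensor" where
  "basis_form a = (\<lambda>w x. if w = [a] then 1 else 0)"

definition theta_tensor :: "'g::group_add set \<Rightarrow> 'g set \<Rightarrow> 'g tensor" where
  "theta_tensor C B = (\<Oplus>\<^bsub>tensor_algebra C\<^esub>a\<in>B. basis_form a)"

definition tensor_deg :: "'g::group_add set \<Rightarrow> nat \<Rightarrow> 'g tensor set" where
  "tensor_deg C n =
     {t \<in> carrier (tensor_algebra C). \<forall>w. t w \<noteq> (\<lambda>_. 0) \<longrightarrow> length w = n}"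

definition word_bidegree :: "'g set \<Rightarrow> 'g set \<Rightarrow> 'g list \<Rightarrow> nat \<times> nat" where
  "word_bidegree C10 C01 w =
     (length (filter (\<lambda>a. a \<in> C10) w), length (filter (\<lambda>a. a \<in> C01) w))"

definition tensor_bideg ::
    "'g::group_add set \<Rightarrow> 'g set \<Rightarrow> 'g set \<Rightarrow> nat \<Rightarrow> nat \<Rightarrow> 'g tensor set" where
  "tensor_bideg C C10 C01 p q =
     {t \<in> carrier (tensor_algebra C).
        \<forall>w. t w \<noteq> (\<lambda>_. 0) \<longrightarrow> word_bidegree C10 C01 w = (p, q)}"

definition bihom_component :: "'g set \<Rightarrow> 'g set \<Rightarrow> nat \<Rightarrow> nat \<Rightarrow> 'g tensor \<Rightarrow> 'g tensor" where
  "bihom_component C10 C01 p q t =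
     (\<lambda>w. if word_bidegree C10 C01 w = (p, q) then t w else (\<lambda>_. 0))"

definition grading_involution :: "'g tensor \<Rightarrow> 'g tensor" where
  "grading_involution t = (\<lambda>w x. (-1) ^ length w * t w x)"

text \<open>
  The antilinear extension of \<open>(e\<^sup>a)\<^sup>* = - e\<^sup>-\<^sup>a\<close> and \<open>f\<^sup>* = cnj f\<close> by
  \<open>(\<xi> \<eta>)\<^sup>* = (-1)\<^sup>|\<^sup>\<xi>\<^sup>|\<^sup>|\<^sup>\<eta>\<^sup>| \<eta>\<^sup>* \<xi>\<^sup>*\<close>.  On \<open>f e\<^sup>u\<close> with \<open>u\<close> of length \<open>n\<close>, reversing the order contributes
  \<open>(-1)\<^bsup>n(n-1)/2\<^esup>\<close> and the signs of the \<open>(e\<^sup>a)\<^sup>*\<close> contribute \<open>(-1)\<^sup>n\<close>; then \<open>cnj f\<close> is moved back to the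
  left past \<open>e\<^sup>w\<close>, \<open>w\<close> being the reversed word of inverses.
\<close>

definition tensor_star :: "'g::group_add tensor \<Rightarrow> 'g tensor" where
  "tensor_star t =
     (\<lambda>w x. (-1) ^ (length w * (length w + 1) div 2) *
        cnj (t (rev (map uminus w)) (x + sum_list w)))"


section \<open>The braiding and its antisymmetrisers\<close>

text \<open>The braiding of the factors \<open>i\<close>, \<open>i + 1\<close> (counted from \<open>0\<close>), as a map of words.\<close>

definition braid_word :: "nat \<Rightarrow> 'g::group_add list \<Rightarrow> 'g list" where
  "braid_word i w =
     (if Suc i < length w then w[i := w ! i + w ! Suc i - w ! i, Suc i := w ! i] else w)"

text \<open>The left \<open>A\<close>-linear map \<open>e\<^sup>u \<mapsto> e\<^bsup>\<phi> u\<^esup>\<close>.\<close>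

definition word_linear :: "('g list \<Rightarrow> 'g list) \<Rightarrow> 'g tensor \<Rightarrow> 'g tensor" where
  "word_linear \<phi> t = (\<lambda>w x. \<Sum>u\<in>{u. t u \<noteq> (\<lambda>_. 0) \<and> \<phi> u = w}. t u x)"

definition braiding :: "nat \<Rightarrow> 'g::group_add tensor \<Rightarrow> 'g tensor" where
  "braiding i = word_linear (braid_word i)"

definition transposition_product :: "nat list \<Rightarrow> nat \<Rightarrow> nat" where
  "transposition_product ks = foldr (\<lambda>k \<sigma>. Transposition.transpose k (Suc k) \<circ> \<sigma>) ks id"

definition reduced_expression :: "nat \<Rightarrow> (nat \<Rightarrow> nat) \<Rightarrow> nat list \<Rightarrow> bool" where
  "reduced_expression n \<sigma> ks \<longleftrightarrow>
     (\<forall>k\<in>set ks. Suc k < n) \<and> transposition_product ks = \<sigma> \<and>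
     (\<forall>ks'. (\<forall>k\<in>set ks'. Suc k < n) \<and> transposition_product ks' = \<sigma> \<longrightarrow>
        length ks \<le> length ks')"

text \<open>\<open>\<Psi>\<^sub>\<sigma> = \<Psi>\<^sub>k\<^sub>1 \<circ> \<dots> \<circ> \<Psi>\<^sub>k\<^sub>r\<close> for a reduced expression \<open>\<sigma> = s\<^sub>k\<^sub>1 \<dots> s\<^sub>k\<^sub>r\<close>; by the braid relations the
  choice of the expression is immaterial.\<close>

definition braiding_perm :: "nat \<Rightarrow> (nat \<Rightarrow> nat) \<Rightarrow> 'g::group_add tensor \<Rightarrow> 'g tensor" where
  "braiding_perm n \<sigma> = foldr (\<lambda>k F. braiding k \<circ> F) (SOME ks. reduced_expression n \<sigma> ks) id"

definition antisymmetriser :: "nat \<Rightarrow> 'g::group_add tensor \<Rightarrow> 'g tensor" where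
  "antisymmetriser n t =
     (\<lambda>w x. \<Sum>\<sigma> | \<sigma> permutes {..<n}. of_int (sign \<sigma>) * braiding_perm n \<sigma> t w x)"


section \<open>Defining relations\<close>

definition product_relation :: "'g::group_add set \<Rightarrow> 'g \<Rightarrow> 'g tensor" where
  "product_relation C z =
     (\<Oplus>\<^bsub>tensor_algebra C\<^esub>p\<in>{(a, b). a \<in> C \<and> b \<in> C \<and> a + b = z}.
        basis_form (fst p) \<otimes>\<^bsub>tensor_algebra C\<^esub> basis_form (snd p))"

definition relations_L :: "'g::group_add set \<Rightarrow> 'g tensor set" where
  "relations_L C = {product_relation C z | z. z \<noteq> 0}"

definition relations_LL :: "'g::group_add set \<Rightarrow> 'g tensor set" where
  "relations_LL C = {product_relation C z | z. True}"

definition bicovariant :: "'g::group_add set \<Rightarrow> bool" where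
  "bicovariant C \<longleftrightarrow> (\<forall>g. \<forall>a\<in>C. g + a - g \<in> C)"

definition relations_Wor :: "'g::group_add set \<Rightarrow> 'g tensor set" where
  "relations_Wor C =
     (\<Union>n. {t \<in> tensor_deg C n. antisymmetriser n t = \<zero>\<^bsub>tensor_algebra C\<^esub>})"

definition bihomogenise :: "'g set \<Rightarrow> 'g set \<Rightarrow> 'g tensor set \<Rightarrow> 'g tensor set" where
  "bihomogenise C10 C01 S = {bihom_component C10 C01 p q t | p q t. t \<in> S}"

definition exchange_relations :: "'g::group_add set \<Rightarrow> 'g set \<Rightarrow> 'g tensor set" where
  "exchange_relations C C01 =
     {(basis_form a \<otimes>\<^bsub>tensor_algebra C\<^esub> basis_form (- b)) \<oplus>\<^bsub>tensor_algebra C\<^esub>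
        braiding 0 (basis_form a \<otimes>\<^bsub>tensor_algebra C\<^esub> basis_form (- b)) | a b.
        a \<in> C01 \<and> b \<in> C01}"


section \<open>Quotients of the tensor algebra\<close>

text \<open>Throughout, \<open>S\<close> is the set of defining relations of the quotient.\<close>

definition rel_ideal :: "'g::group_add set \<Rightarrow> 'g tensor set \<Rightarrow> 'g tensor set" where
  "rel_ideal C S = Idl\<^bsub>tensor_algebra C\<^esub> S"

definition ext_algebra :: "'g::group_add set \<Rightarrow> 'g tensor set \<Rightarrow> 'g tensor set ring" where
  "ext_algebra C S = tensor_algebra C Quot rel_ideal C S"

definition ext_class :: "'g::group_add set \<Rightarrow> 'g tensor set \<Rightarrow> 'g tensor \<Rightarrow> 'g tensor set" where
  "ext_class C S t = rel_ideal C S +>\<^bsub>tensor_algebra C\<^esub> t"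

text \<open>The map induced by \<open>F\<close> with values in the quotient by \<open>S\<close>.  Its value at a coset \<open>X\<close> is an
  element of the quotient if and only if \<open>F t\<close> has the same class for all \<open>t \<in> X\<close>.\<close>

definition ext_induced ::
    "'g::group_add set \<Rightarrow> 'g tensor set \<Rightarrow> ('g tensor \<Rightarrow> 'g tensor) \<Rightarrow> 'g tensor set \<Rightarrow> 'g tensor set"
  where
  "ext_induced C S F X = (\<Union>t\<in>X. ext_class C S (F t))"

definition ext_fun ::
    "'g::group_add set \<Rightarrow> 'g tensor set \<Rightarrow> ('g \<Rightarrow> complex) \<Rightarrow> 'g tensor set" where
  "ext_fun C S f = ext_class C S (fun_tensor f)"

definition ext_deg :: "'g::group_add set \<Rightarrow> 'g tensor set \<Rightarrow> nat \<Rightarrow> 'g tensor set set" where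
  "ext_deg C S n = ext_class C S ` tensor_deg C n"

definition ext_bideg ::
    "'g::group_add set \<Rightarrow> 'g set \<Rightarrow> 'g set \<Rightarrow> 'g tensor set \<Rightarrow> nat \<Rightarrow> nat \<Rightarrow> 'g tensor set set" where
  "ext_bideg C C10 C01 S p q = ext_class C S ` tensor_bideg C C10 C01 p q"

definition ext_star :: "'g::group_add set \<Rightarrow> 'g tensor set \<Rightarrow> 'g tensor set \<Rightarrow> 'g tensor set" where
  "ext_star C S = ext_induced C S tensor_star"

text \<open>The graded commutator \<open>\<xi> \<mapsto> \<theta> \<xi> - (-1)\<^sup>|\<^sup>\<xi>\<^sup>| \<xi> \<theta>\<close> with \<open>\<theta> = \<Sum>\<^sub>a\<^sub>\<in>\<^sub>B e\<^sup>a\<close>.\<close>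

definition ext_commutator ::
    "'g::group_add set \<Rightarrow> 'g tensor set \<Rightarrow> 'g set \<Rightarrow> 'g tensor set \<Rightarrow> 'g tensor set" where
  "ext_commutator C S B \<xi> =
     (ext_class C S (theta_tensor C B) \<otimes>\<^bsub>ext_algebra C S\<^esub> \<xi>) \<ominus>\<^bsub>ext_algebra C S\<^esub>
     (ext_induced C S grading_involution \<xi> \<otimes>\<^bsub>ext_algebra C S\<^esub> ext_class C S (theta_tensor C B))"

text \<open>The quotient by \<open>S'\<close> is a quotient of the one by \<open>S\<close>, through a map compatible with \<open>d\<close>.\<close>

definition is_further_quotient ::
    "'g::group_add set \<Rightarrow> 'g tensor set \<Rightarrow> 'g tensor set \<Rightarrow> bool" where
  "is_further_quotient C S S' \<longleftrightarrow>
     (\<exists>\<pi> \<in> ring_hom (ext_algebra C S) (ext_algebra C S').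
        \<pi> ` carrier (ext_algebra C S) = carrier (ext_algebra C S') \<and>
        (\<forall>t \<in> carrier (tensor_algebra C). \<pi> (ext_class C S t) = ext_class C S' t) \<and>
        (\<forall>\<xi> \<in> carrier (ext_algebra C S).
           \<pi> (ext_commutator C S C \<xi>) = ext_commutator C S' C (\<pi> \<xi>)))"

abbreviation is_double_complex ::
    "'g::group_add set \<Rightarrow> 'g set \<Rightarrow> 'g set \<Rightarrow> 'g tensor set \<Rightarrow> bool" where
  "is_double_complex C C10 C01 S \<equiv>
     double_complex_over_functions (ext_algebra C S) (ext_fun C S) (ext_deg C S)
       (ext_commutator C S C) (ext_bideg C C10 C01 S)
       (ext_commutator C S C10) (ext_commutator C S C01)"

abbreviation is_dolbeault_complex ::
    "'g::group_add set \<Rightarrow> 'g set \<Rightarrow> 'g set \<Rightarrow> 'g tensor set \<Rightarrow> bool" where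
  "is_dolbeault_complex C C10 C01 S \<equiv>
     dolbeault_complex_over_functions (ext_algebra C S) (ext_fun C S) (ext_deg C S)
       (ext_commutator C S C) (ext_bideg C C10 C01 S)
       (ext_commutator C S C10) (ext_commutator C S C01) (ext_star C S)"


section \<open>Consistency of the encoding\<close>

lemma tensor_algebra_ring: "ring (tensor_algebra (C :: 'a::group_add set))"
proof -
  let ?T = "tensor_algebra C"
  note d = tensor_algebra_def
  have addc: "s \<oplus>\<^bsub>?T\<^esub> t \<in> carrier ?T" if "s \<in> carrier ?T" "t \<in> carrier ?T" for s t
  proof -
    have "{w. (\<lambda>x. s w x + t w x) \<noteq> (\<lambda>_. 0)} \<subseteq> {w. s w \<noteq> (\<lambda>_. 0)} \<union> {w. t w \<noteq> (\<lambda>_. 0)}"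
      by (auto simp: fun_eq_iff)
    then have "finite {w. (\<lambda>x. s w x + t w x) \<noteq> (\<lambda>_. 0)}"
      by (rule finite_subset) (use that in \<open>auto simp: d\<close>)
    moreover have "set w \<subseteq> C" if n: "(\<lambda>x. s w x + t w x) \<noteq> (\<lambda>_. 0)" for w
    proof -
      have "s w \<noteq> (\<lambda>_. 0) \<or> t w \<noteq> (\<lambda>_. 0)" using n by (auto simp: fun_eq_iff)
      then show ?thesis using \<open>s \<in> carrier ?T\<close> \<open>t \<in> carrier ?T\<close> by (auto simp: d)
    qed
    ultimately show ?thesis by (simp add: d)
  qed
  have neg: "\<exists>s\<in>carrier ?T. s \<oplus>\<^bsub>?T\<^esub> t = \<zero>\<^bsub>?T\<^esub>" if "t \<in> carrier ?T" for t
  proof (rule bexI[where x = "\<lambda>w x. - t w x"])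
    have "((\<lambda>x. - t w x) \<noteq> (\<lambda>_. 0)) = (t w \<noteq> (\<lambda>_. 0))" for w by (auto simp: fun_eq_iff)
    then show "(\<lambda>w x. - t w x) \<in> carrier ?T" using that by (simp add: d)
  qed (simp add: d)
  have multc: "s \<otimes>\<^bsub>?T\<^esub> t \<in> carrier ?T" if S: "s \<in> carrier ?T" and T: "t \<in> carrier ?T" for s t
  proof -
    have *: "\<exists>u v. w = u @ v \<and> s u \<noteq> (\<lambda>_. 0) \<and> t v \<noteq> (\<lambda>_. 0)"
      if "(s \<otimes>\<^bsub>?T\<^esub> t) w \<noteq> (\<lambda>_. 0)" for w
    proof -
      obtain x where "(s \<otimes>\<^bsub>?T\<^esub> t) w x \<noteq> 0" using \<open>_ \<noteq> _\<close> by (auto simp: fun_eq_iff)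
      then obtain k where "s (take k w) x * t (drop k w) (x + sum_list (take k w)) \<noteq> 0"
        using sum.neutral[of "{..length w}" "\<lambda>k. s (take k w) x * t (drop k w) (x + sum_list (take k w))"]
        by (simp add: d) blast
      then show ?thesis
        by (intro exI[of _ "take k w"] exI[of _ "drop k w"]) (auto simp: fun_eq_iff)
    qed
    then have "{w. (s \<otimes>\<^bsub>?T\<^esub> t) w \<noteq> (\<lambda>_. 0)}
        \<subseteq> (\<lambda>(u, v). u @ v) ` ({w. s w \<noteq> (\<lambda>_. 0)} \<times> {w. t w \<noteq> (\<lambda>_. 0)})" by force
    then have "finite {w. (s \<otimes>\<^bsub>?T\<^esub> t) w \<noteq> (\<lambda>_. 0)}"
      by (rule finite_subset) (use S T in \<open>auto simp: d\<close>)
    moreover have "set w \<subseteq> C" if "(s \<otimes>\<^bsub>?T\<^esub> t) w \<noteq> (\<lambda>_. 0)" for w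
    proof -
      from *[OF that] obtain u v where w: "w = u @ v" and "s u \<noteq> (\<lambda>_. 0)" "t v \<noteq> (\<lambda>_. 0)" by blast
      then have "set u \<subseteq> C" "set v \<subseteq> C" using S T by (auto simp: d)
      then show ?thesis using w by simp
    qed
    moreover have "x \<in> carrier ?T \<longleftrightarrow> finite {w. x w \<noteq> (\<lambda>_. 0)} \<and> (\<forall>w. x w \<noteq> (\<lambda>_. 0) \<longrightarrow> set w \<subseteq> C)" for x
      by (simp add: d)
    ultimately show ?thesis by simp
  qed
  have assoc: "(s \<otimes>\<^bsub>?T\<^esub> t) \<otimes>\<^bsub>?T\<^esub> u = s \<otimes>\<^bsub>?T\<^esub> (t \<otimes>\<^bsub>?T\<^esub> u)" for s t u :: "'a tensor"
  proof (intro ext)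
    fix w :: "'a list" and x :: 'a
    let ?n = "length w"
    let ?h = "\<lambda>j k. s (take j w) x * t (take (k - j) (drop j w)) (x + sum_list (take j w))
        * u (drop k w) (x + sum_list (take k w))"
    have "((s \<otimes>\<^bsub>?T\<^esub> t) \<otimes>\<^bsub>?T\<^esub> u) w x = (\<Sum>k\<le>?n. \<Sum>j\<le>k. ?h j k)"
      by (auto simp: d sum_distrib_right min.absorb1 min.absorb2 drop_take intro!: sum.cong)
    also have "\<dots> = (\<Sum>(k, j)\<in>Sigma {..?n} (\<lambda>k. {..k}). ?h j k)"
      by (simp add: sum.Sigma)
    also have "\<dots> = (\<Sum>(j, i)\<in>Sigma {..?n} (\<lambda>j. {..?n - j}). ?h j (i + j))"
      by (rule sum.reindex_bij_witness[of _ "\<lambda>(j, i). (i + j, j)" "\<lambda>(k, j). (j, k - j)"]) auto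
    also have "\<dots> = (\<Sum>j\<le>?n. \<Sum>i\<le>?n - j. ?h j (i + j))"
      by (simp add: sum.Sigma)
    also have "\<dots> = (s \<otimes>\<^bsub>?T\<^esub> (t \<otimes>\<^bsub>?T\<^esub> u)) w x"
    proof -
      have "sum_list (take j w) + sum_list (take i (drop j w)) = sum_list (take (i + j) w)" for i j
        by (metis add.commute sum_list.append take_add)
      then show ?thesis
        by (auto simp: d sum_distrib_left mult.assoc add.assoc intro!: sum.cong)
    qed
    finally show "((s \<otimes>\<^bsub>?T\<^esub> t) \<otimes>\<^bsub>?T\<^esub> u) w x = (s \<otimes>\<^bsub>?T\<^esub> (t \<otimes>\<^bsub>?T\<^esub> u)) w x" .
  qed
  have onel: "\<one>\<^bsub>?T\<^esub> \<otimes>\<^bsub>?T\<^esub> t = t" for t :: "'a tensor"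
  proof (intro ext)
    fix w :: "'a list" and x :: 'a
    have "(\<Sum>k\<le>length w. (if take k w = [] then 1 else 0) * t (drop k w) (x + sum_list (take k w)))
      = (\<Sum>k\<le>length w. if k = 0 then t w x else 0)"
      by (rule sum.cong) auto
    then show "(\<one>\<^bsub>?T\<^esub> \<otimes>\<^bsub>?T\<^esub> t) w x = t w x" by (simp add: d)
  qed
  have oner: "t \<otimes>\<^bsub>?T\<^esub> \<one>\<^bsub>?T\<^esub> = t" for t :: "'a tensor"
  proof (intro ext)
    fix w :: "'a list" and x :: 'a
    have "(\<Sum>k\<le>length w. t (take k w) x * (if drop k w = [] then 1 else 0))
      = (\<Sum>k\<le>length w. if k = length w then t w x else 0)"
      by (rule sum.cong) auto
    then show "(t \<otimes>\<^bsub>?T\<^esub> \<one>\<^bsub>?T\<^esub>) w x = t w x" by (simp add: d)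
  qed
  show ?thesis
  proof (rule ringI)
    show "abelian_group ?T"
    proof (rule abelian_groupI)
      show "\<zero>\<^bsub>?T\<^esub> \<in> carrier ?T" by (simp add: d)
      show "(x \<oplus>\<^bsub>?T\<^esub> y) \<oplus>\<^bsub>?T\<^esub> z = x \<oplus>\<^bsub>?T\<^esub> (y \<oplus>\<^bsub>?T\<^esub> z)" for x y z by (simp add: d add.assoc)
      show "x \<oplus>\<^bsub>?T\<^esub> y = y \<oplus>\<^bsub>?T\<^esub> x" for x y by (simp add: d add.commute)
      show "\<zero>\<^bsub>?T\<^esub> \<oplus>\<^bsub>?T\<^esub> x = x" for x by (simp add: d)
    qed (fact addc neg)+
    show "Group.monoid ?T"
    proof (rule monoidI)
      have "{w. (\<lambda>x::'a. if w = [] then 1 else 0 :: complex) \<noteq> (\<lambda>_. 0)} \<subseteq> {[]}" by auto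
      then show "\<one>\<^bsub>?T\<^esub> \<in> carrier ?T" by (auto simp: d dest: finite_subset)
    qed (simp_all only: multc assoc onel oner)
    show "(x \<oplus>\<^bsub>?T\<^esub> y) \<otimes>\<^bsub>?T\<^esub> z = x \<otimes>\<^bsub>?T\<^esub> z \<oplus>\<^bsub>?T\<^esub> y \<otimes>\<^bsub>?T\<^esub> z" for x y z
      by (simp add: d distrib_right sum.distrib)
    show "z \<otimes>\<^bsub>?T\<^esub> (x \<oplus>\<^bsub>?T\<^esub> y) = z \<otimes>\<^bsub>?T\<^esub> x \<oplus>\<^bsub>?T\<^esub> z \<otimes>\<^bsub>?T\<^esub> y" for x y z
      by (simp add: d distrib_left sum.distrib)
  qed
qed

lemma basis_form_commutation:
  "basis_form a \<otimes>\<^bsub>tensor_algebra C\<^esub> fun_tensor f =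
   fun_tensor (\<lambda>x. f (x + a)) \<otimes>\<^bsub>tensor_algebra C\<^esub> basis_form a"
proof (intro ext)
  fix w x
  have 1: "(\<Sum>k\<le>length w. (if take k w = [a] then 1 else 0) *
      (if drop k w = [] then f (x + sum_list (take k w)) else 0)) 
     = (\<Sum>k\<le>length w. if k = length w then (if w = [a] then f (x + a) else 0) else 0)"
    by (rule sum.cong) auto
  have 2: "(\<Sum>k\<le>length w. (if take k w = [] then f (x + a) else 0) *
      (if drop k w = [a] then 1 else 0)) 
     = (\<Sum>k\<le>length w. if k = 0 then (if w = [a] then f (x + a) else 0) else 0)"
    by (rule sum.cong) auto
  show "(basis_form a \<otimes>\<^bsub>tensor_algebra C\<^esub> fun_tensor f) w x =
   (fun_tensor (\<lambda>x. f (x + a)) \<otimes>\<^bsub>tensor_algebra C\<^esub> basis_form a) w x"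
    using 1 2 by (simp add: tensor_algebra_def basis_form_def fun_tensor_def)
qed

lemma tensor_star_basis_form: "tensor_star (basis_form a) = (\<lambda>w x. - basis_form (- a) w x)"
proof -
  have "(rev (map uminus w) = [a]) = (w = [- a])" for w :: "'a list"
    by (cases w rule: rev_cases) (auto simp: minus_equation_iff)
  then show ?thesis by (auto simp: tensor_star_def basis_form_def fun_eq_iff)
qed

lemma tensor_star_fun: "tensor_star (fun_tensor f) = fun_tensor (\<lambda>x. cnj (f x))"
  by (auto simp: tensor_star_def fun_tensor_def fun_eq_iff)

lemma braiding_basis_form:
  "braiding 0 (basis_form a \<otimes>\<^bsub>tensor_algebra C\<^esub> basis_form b) =
   basis_form (a + b - a) \<otimes>\<^bsub>tensor_algebra C\<^esub> basis_form a"
proof -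
  have p: "basis_form a \<otimes>\<^bsub>tensor_algebra C\<^esub> basis_form b = (\<lambda>w x. if w = [a, b] then 1 else 0)"
    for a b :: 'a
  proof (intro ext)
    fix w :: "'a list" and x :: 'a
    have "(\<Sum>k\<le>length w. (if take k w = [a] then 1 else 0) * (if drop k w = [b] then 1 else 0::complex))
      = (\<Sum>k\<le>length w. if k = 1 then (if w = [a, b] then 1 else 0) else 0)"
    proof (rule sum.cong)
      fix k assume "k \<in> {..length w}"
      have "take k w = [a] \<and> drop k w = [b] \<longleftrightarrow> k = 1 \<and> w = [a, b]"
      proof
        assume *: "take k w = [a] \<and> drop k w = [b]"
        then have "w = [a] @ [b]" by (metis append_take_drop_id)
        moreover have "length (take k w) = 1" using * by simp
        ultimately show "k = 1 \<and> w = [a, b]" by (auto simp: min_def split: if_splits)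
      qed auto
      then show "(if take k w = [a] then 1 else 0) * (if drop k w = [b] then 1 else 0::complex) =
        (if k = 1 then (if w = [a, b] then 1 else 0) else 0)" by auto
    qed simp
    then show "(basis_form a \<otimes>\<^bsub>tensor_algebra C\<^esub> basis_form b) w x = (if w = [a, b] then 1 else 0)"
      by (auto simp: tensor_algebra_def basis_form_def)
  qed
  have "{u. (\<lambda>x::'a. if u = [a, b] then 1 else 0::complex) \<noteq> (\<lambda>_. 0) \<and> braid_word 0 u = w}
     = (if w = [a + b - a, a] then {[a, b]} else {})" for w
    by (auto simp: fun_eq_iff braid_word_def)
  then show ?thesis
    unfolding p braiding_def word_linear_def by (auto simp: fun_eq_iff)
qed

end

theory Submission
  imports Defs "HOL-Library.Function_Algebras"
begin

text \<open>
  Taking bihomogeneous components of the relations enlarges the ideal they generate and makes it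
  bigraded, so the quotient inherits the bidegree, and the graded commutators with \<open>\<theta>\<^bsup>1,0\<^esup>\<close> and
  \<open>\<theta>\<^bsup>0,1\<^esup>\<close> are derivations of the right bidegrees.  Only the equations between their squares need
  the relations: the anticommutator of two such graded commutators is the ordinary commutator with
  \<open>\<theta>\<theta>' + \<theta>'\<theta>\<close>, and the square of one is the ordinary commutator with \<open>\<theta>\<^sup>2\<close>.  Modulo the relations indexed by \<open>z \<noteq> e\<close>, the square of
  \<open>\<theta> = \<theta>\<^bsup>1,0\<^esup> + \<theta>\<^bsup>0,1\<^esup>\<close> is \<open>\<Theta> = \<Sum> e\<^sup>a e\<^bsup>a\<inverse>\<^esup>\<close>.  Inversion exchanges the two halves of the
  alphabet, so \<open>\<Theta>\<close> has bidegree \<open>(1,1)\<close>, and comparing bidegrees shows that \<open>\<theta>\<^bsup>1,0\<^esup>\<close> and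
  \<open>\<theta>\<^bsup>0,1\<^esup>\<close> have square zero and anticommutator \<open>\<Theta>\<close> (\<open>theta_products\<close>).  Finally \<open>\<Theta>\<close> is central,
  by expanding \<open>\<Sum>\<^bsub>abc = d\<^esub> e\<^sup>a e\<^sup>b e\<^sup>c\<close> in two ways (\<open>product_relation_central\<close>).  This
  gives a double complex for every set of bihomogeneous relations of degree at least 2 whose ideal
  contains the relations for \<open>z \<noteq> e\<close>; the Woronowicz ideal contains them because in the
  bicovariant case \<open>\<Psi>\<close> permutes the words \<open>ab\<close> with \<open>ab = z\<close>.

  The star is antimultiplicative up to signs that depend only on degrees and exchanges the two
  bidegrees, so it descends once it preserves the relations.  It maps the relation of \<open>z\<close> to that of
  \<open>z\<inverse>\<close>.  For the Woronowicz relations one has to know how it acts on the antisymmetrisers.  On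
  words, \<open>\<Psi>\<^sub>\<sigma>\<close> has the closed form \<open>permutation_braid\<close>, which follows from the fact that in a reduced
  expression any two strands cross at most once.  From the closed form one reads off that
  \<open>\<Psi>\<^bsub>w\<^sub>0\<^esub> \<circ> * \<circ> \<Psi>\<^sub>\<sigma> = \<Psi>\<^bsub>\<sigma>w\<^sub>0\<^esub> \<circ> *\<close> for the half twist \<open>w\<^sub>0\<close>, and summing over \<open>\<sigma>\<close> shows that
  the star preserves the kernel (\<open>antisymmetriser_dagger\<close>).

  For factorisability, the exchange relations identify \<open>e\<^sup>a e\<^sup>b\<close>, for \<open>a\<close> in \<open>\<C>\<^bsup>0,1\<^esup>\<close> and
  \<open>b\<close> in \<open>\<C>\<^bsup>1,0\<^esup>\<close>, with \<open>- \<Psi>(e\<^sup>a e\<^sup>b)\<close>.  Since \<open>\<C>\<^bsup>1,0\<^esup>\<close> is finite and mapped into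
  itself by the conjugations in question, \<open>\<Psi>\<close> is a bijection between the two kinds of mixed words;
  hence products in either order span bidegree \<open>(1,1)\<close>.  They stay independent because every
  relation of degree 2 has the same coefficient at \<open>e\<^sup>a e\<^sup>b\<close> and at \<open>\<Psi>(e\<^sup>a e\<^sup>b)\<close>, so in bidegree
  \<open>(1,1)\<close> the other relations are consequences of the exchange relations
  (\<open>ideal_exchange_symmetric\<close>).  The passage to tensor products over the function algebra
  is \<open>product_bimodule_iso_of_basis\<close>.
\<close>

section \<open>Tensors as functions on words\<close>

text \<open>The product of the tensor algebra does not depend on \<open>C\<close>.  Together with the pointwise
  additive structure on functions, it allows identities between tensors to be checked on words
  or with the simplification rules for abelian groups, without closure conditions.\<close>

definition tensor_mult :: "'g::group_add tensor \<Rightarrow> 'g tensor \<Rightarrow> 'g tensor" (infixl \<open>\<star>\<close> 70) where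
  "s \<star> t = (\<lambda>w x. \<Sum>k\<le>length w. s (take k w) x * t (drop k w) (x + sum_list (take k w)))"

abbreviation tensors :: "'g::group_add set \<Rightarrow> 'g tensor set" where
  "tensors C \<equiv> carrier (tensor_algebra C)"

lemma tensor_algebra_simps:
  "monoid.mult (tensor_algebra C) s t = s \<star> t"
  "ring.add (tensor_algebra C) s t = s + t"
  "ring.zero (tensor_algebra C) = 0"
  "monoid.one (tensor_algebra C) = fun_tensor (\<lambda>_. 1)"
  by (auto simp: tensor_algebra_def tensor_mult_def fun_tensor_def fun_eq_iff)

lemma tensors_iff:
  "t \<in> tensors C \<longleftrightarrow> finite {w. t w \<noteq> (\<lambda>_. 0)} \<and> (\<forall>w x. t w x \<noteq> 0 \<longrightarrow> set w \<subseteq> C)"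
  by (auto simp: tensor_algebra_def fun_eq_iff)

lemma tensors_support_mono:
  assumes "t \<in> tensors C" and "\<And>w x. s w x \<noteq> 0 \<Longrightarrow> \<exists>y. t w y \<noteq> 0"
  shows "s \<in> tensors C"
proof -
  have "{w. s w \<noteq> (\<lambda>_. 0)} \<subseteq> {w. t w \<noteq> (\<lambda>_. 0)}"
    using assms(2) by (fastforce simp: fun_eq_iff)
  then show ?thesis
    using assms unfolding tensors_iff by (metis (no_types, lifting) finite_subset)
qed

lemma tensors_closed [simp, intro]:
  "s \<in> tensors C \<Longrightarrow> t \<in> tensors C \<Longrightarrow> s \<star> t \<in> tensors C"
  "s \<in> tensors C \<Longrightarrow> t \<in> tensors C \<Longrightarrow> s + t \<in> tensors C"
  "0 \<in> tensors C"
  "t \<in> tensors C \<Longrightarrow> - t \<in> tensors C"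
  "s \<in> tensors C \<Longrightarrow> t \<in> tensors C \<Longrightarrow> s - t \<in> tensors C"
proof -
  interpret T: ring "tensor_algebra C" by (rule tensor_algebra_ring)
  show mult: "s \<star> t \<in> tensors C" if "s \<in> tensors C" "t \<in> tensors C" for s t
    using T.m_closed[OF that] by (simp add: tensor_algebra_simps)
  show add: "s + t \<in> tensors C" if "s \<in> tensors C" "t \<in> tensors C" for s t
    using T.a_closed[OF that] by (simp add: tensor_algebra_simps)
  show "0 \<in> tensors C"
    using T.zero_closed by (simp add: tensor_algebra_simps)
  show neg: "- t \<in> tensors C" if "t \<in> tensors C" for t
    by (rule tensors_support_mono[OF that]) auto
  show "s - t \<in> tensors C" if "s \<in> tensors C" "t \<in> tensors C" for s t
    using add[OF that(1) neg[OF that(2)]] by simp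
qed

lemma tensors_sum [simp, intro]: "(\<And>i. i \<in> A \<Longrightarrow> F i \<in> tensors C) \<Longrightarrow> sum F A \<in> tensors C"
  by (induction A rule: infinite_finite_induct) auto

lemma tensor_algebra_uminus: "t \<in> tensors C \<Longrightarrow> a_inv (tensor_algebra C) t = - t"
proof -
  assume t: "t \<in> tensors C"
  interpret T: ring "tensor_algebra C" by (rule tensor_algebra_ring)
  show ?thesis
    by (rule T.minus_equality) (use t in \<open>auto simp: tensor_algebra_simps\<close>)
qed

lemma tensor_algebra_finsum:
  "finite A \<Longrightarrow> (\<And>i. i \<in> A \<Longrightarrow> F i \<in> tensors C) \<Longrightarrow> finsum (tensor_algebra C) F A = sum F A"
proof (induction A rule: finite_induct)
  case (insert i A)
  interpret T: ring "tensor_algebra C" by (rule tensor_algebra_ring)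
  show ?case
    using insert by (subst T.finsum_insert) (auto simp: tensor_algebra_simps)
qed (simp add: tensor_algebra_simps abelian_monoid.finsum_empty[OF abelian_group.axioms(1)]
       ring.is_abelian_group[OF tensor_algebra_ring])

lemma tensor_mult_assoc:
  "s \<in> tensors C \<Longrightarrow> t \<in> tensors C \<Longrightarrow> u \<in> tensors C \<Longrightarrow> s \<star> t \<star> u = s \<star> (t \<star> u)"
  using monoid.m_assoc[OF ring.is_monoid[OF tensor_algebra_ring], of s C t u]
  by (simp add: tensor_algebra_simps)

lemma tensor_mult_distrib:
  "s \<star> (t + u) = s \<star> t + s \<star> u" "(s + t) \<star> u = s \<star> u + t \<star> u"
  "s \<star> (t - u) = s \<star> t - s \<star> u" "(s - t) \<star> u = s \<star> u - t \<star> u"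
  "s \<star> (- u) = - (s \<star> u)" "(- s) \<star> u = - (s \<star> u)"
  "s \<star> 0 = 0" "0 \<star> u = 0"
  by (auto simp: tensor_mult_def fun_eq_iff algebra_simps sum.distrib sum_subtractf sum_negf)

lemma sum_tensor_apply: "(sum F A :: 'g tensor) w x = (\<Sum>i\<in>A. F i w x)"
  by (induction A rule: infinite_finite_induct) auto

lemma tensor_mult_sum:
  "s \<star> sum F A = (\<Sum>i\<in>A. s \<star> F i)" "sum F A \<star> s = (\<Sum>i\<in>A. F i \<star> s)"
  by (induction A rule: infinite_finite_induct) (auto simp: tensor_mult_distrib)

lemma fun_tensor_mult_apply: "(fun_tensor f \<star> t) w x = f x * t w x"
proof -
  have "(fun_tensor f \<star> t) w x = (\<Sum>k\<le>length w. if k = 0 then f x * t w x else 0)"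
    unfolding tensor_mult_def by (rule sum.cong) (auto simp: fun_tensor_def)
  then show ?thesis by simp
qed

lemma mult_fun_tensor_apply: "(t \<star> fun_tensor f) w x = t w x * f (x + sum_list w)"
proof -
  have "(t \<star> fun_tensor f) w x
      = (\<Sum>k\<le>length w. if k = length w then t w x * f (x + sum_list w) else 0)"
    unfolding tensor_mult_def by (rule sum.cong) (auto simp: fun_tensor_def)
  then show ?thesis by simp
qed

lemma basis_form_mult_apply:
  "(basis_form a \<star> t) w x = (if w \<noteq> [] \<and> hd w = a then t (tl w) (x + a) else 0)"
proof (cases w)
  case (Cons c v)
  have "(basis_form a \<star> t) w x
      = (\<Sum>k\<le>length w. if k = 1 then (if c = a then t v (x + a) else 0) else 0)"
    unfolding tensor_mult_def
  proof (rule sum.cong)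
    fix k assume "k \<in> {..length w}"
    have "take k w = [a] \<longleftrightarrow> k = 1 \<and> c = a"
      using Cons \<open>k \<in> _\<close> by (cases k) (auto simp: take_eq_Nil)
    then show "basis_form a (take k w) x * t (drop k w) (x + sum_list (take k w))
      = (if k = 1 then if c = a then t v (x + a) else 0 else 0)"
      using Cons by (auto simp: basis_form_def)
  qed simp
  also have "\<dots> = (if c = a then t v (x + a) else 0)"
    using Cons by (subst sum.delta) auto
  finally show ?thesis using Cons by simp
qed (simp add: tensor_mult_def basis_form_def)

lemma mult_basis_form_apply:
  "(t \<star> basis_form a) w x = (if w \<noteq> [] \<and> last w = a then t (butlast w) x else 0)"
proof (cases w rule: rev_cases)
  case (snoc v c)
  have "(t \<star> basis_form a) w x
      = (\<Sum>k\<le>length w. if k = length v then (if c = a then t v x else 0) else 0)"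
    unfolding tensor_mult_def
  proof (rule sum.cong)
    fix k assume "k \<in> {..length w}"
    have "drop k w = [a] \<longleftrightarrow> k = length v \<and> c = a"
    proof
      assume d: "drop k w = [a]"
      then have "length w - k = 1" by (metis length_drop One_nat_def length_Cons list.size(3))
      then show "k = length v \<and> c = a" using snoc d by auto
    qed (use snoc in auto)
    then show "t (take k w) x * basis_form a (drop k w) (x + sum_list (take k w))
      = (if k = length v then if c = a then t v x else 0 else 0)"
      using snoc by (auto simp: basis_form_def)
  qed simp
  then show ?thesis using snoc by simp
qed (simp add: tensor_mult_def basis_form_def)

lemma fun_tensor_closed [simp, intro]: "fun_tensor f \<in> tensors C"
proof -
  have "{w. fun_tensor f w \<noteq> (\<lambda>_. 0)} \<subseteq> {[]}" by (auto simp: fun_tensor_def)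
  then show ?thesis unfolding tensors_iff
    by (auto simp: fun_tensor_def dest: finite_subset split: if_splits)
qed

lemma basis_form_closed [simp, intro]: "a \<in> C \<Longrightarrow> basis_form a \<in> tensors C"
proof -
  assume "a \<in> C"
  moreover have "{w. basis_form a w \<noteq> (\<lambda>_. 0)} \<subseteq> {[a]}" by (auto simp: basis_form_def)
  ultimately show ?thesis unfolding tensors_iff
    by (auto simp: basis_form_def dest: finite_subset split: if_splits)
qed



lemma basis_form_mult_basis_form: "basis_form a \<star> basis_form b = (\<lambda>w x. if w = [a, b] then 1 else 0)"
proof (intro ext)
  fix w and x :: 'a
  show "(basis_form a \<star> basis_form b) w x = (if w = [a, b] then 1 else 0)"
    by (cases w) (auto simp: basis_form_mult_apply basis_form_def[of b])
qed

lemma theta_tensor_apply: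
  assumes "finite C" "B \<subseteq> C"
  shows "theta_tensor C B w x = (if \<exists>b\<in>B. w = [b] then 1 else 0)"
proof -
  have fin: "finite B" using assms finite_subset by blast
  have "theta_tensor C B = sum basis_form B"
    unfolding theta_tensor_def using assms fin by (intro tensor_algebra_finsum) auto
  then have "theta_tensor C B w x = (\<Sum>b\<in>B. if w = [b] then 1 else 0)"
    by (simp add: sum_tensor_apply basis_form_def)
  also have "\<dots> = (if \<exists>b\<in>B. w = [b] then 1 else 0)"
  proof (cases "\<exists>b\<in>B. w = [b]")
    case True
    then obtain c where "c \<in> B" "w = [c]" by blast
    then show ?thesis using fin by auto
  qed (auto intro: sum.neutral)
  finally show ?thesis .
qed

lemma theta_tensor_eq_sum: "finite C \<Longrightarrow> B \<subseteq> C \<Longrightarrow> theta_tensor C B = sum basis_form B"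
  unfolding theta_tensor_def by (intro tensor_algebra_finsum) (auto intro: finite_subset)

lemma theta_tensor_closed [simp, intro]: "finite C \<Longrightarrow> B \<subseteq> C \<Longrightarrow> theta_tensor C B \<in> tensors C"
  by (auto simp: theta_tensor_eq_sum)

text \<open>Functions and the forms \<open>e\<^sup>a\<close> generate the tensor algebra as a ring.\<close>

lemma tensor_algebra_induct [consumes 1, case_names func basis add mult]:
  assumes t: "t \<in> tensors C"
    and func: "\<And>f. P (fun_tensor f)"
    and basis: "\<And>a. a \<in> C \<Longrightarrow> P (basis_form a)"
    and add: "\<And>s t. s \<in> tensors C \<Longrightarrow> t \<in> tensors C \<Longrightarrow> P s \<Longrightarrow> P t \<Longrightarrow> P (s + t)"
    and mult: "\<And>s t. s \<in> tensors C \<Longrightarrow> t \<in> tensors C \<Longrightarrow> P s \<Longrightarrow> P t \<Longrightarrow> P (s \<star> t)"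
  shows "P t"
proof -
  define mono :: "('a \<Rightarrow> complex) \<Rightarrow> 'a list \<Rightarrow> 'a tensor" where
    "mono f u = (\<lambda>w x. if w = u then f x else 0)" for f u
  define word :: "'a list \<Rightarrow> 'a tensor" where "word = mono (\<lambda>_. 1)"
  have word: "set u \<subseteq> C \<Longrightarrow> word u \<in> tensors C \<and> P (word u)" for u
  proof (induction u)
    case Nil
    have "word [] = fun_tensor (\<lambda>_. 1)"
      by (simp add: word_def mono_def fun_tensor_def fun_eq_iff)
    then show ?case using func by simp
  next
    case (Cons a u)
    have "word (a # u) w x = (basis_form a \<star> word u) w x" for w x
      by (cases w) (auto simp: word_def mono_def basis_form_mult_apply)
    then have "word (a # u) = basis_form a \<star> word u" by (intro ext)
    then show ?case using Cons basis mult by auto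
  qed
  have mono: "mono f u \<in> tensors C \<and> P (mono f u)" if "set u \<subseteq> C" for f u
  proof -
    have "mono f u = fun_tensor f \<star> word u"
      by (auto simp: fun_eq_iff fun_tensor_mult_apply mono_def word_def)
    then show ?thesis using func mult word[OF that] by auto
  qed
  have sum: "sum F A \<in> tensors C \<and> P (sum F A)"
    if "finite A" "\<And>i. i \<in> A \<Longrightarrow> F i \<in> tensors C \<and> P (F i)" for F :: "'a list \<Rightarrow> _" and A
    using that
  proof (induction A rule: finite_induct)
    case empty
    have "(0 :: 'a tensor) = fun_tensor (\<lambda>_. 0)" by (simp add: fun_tensor_def fun_eq_iff)
    then show ?case using func[of "\<lambda>_. 0"] unfolding sum.empty by (metis tensors_closed(3))
  qed (auto intro: add)
  let ?W = "{w. t w \<noteq> (\<lambda>_. 0)}"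
  have fin: "finite ?W" and W: "\<And>w. w \<in> ?W \<Longrightarrow> set w \<subseteq> C"
    using t by (auto simp: tensors_iff fun_eq_iff)
  have "(\<Sum>w\<in>?W. mono (t w) w) v x = t v x" for v x
  proof -
    have "(\<Sum>w\<in>?W. mono (t w) w) v x = (\<Sum>w\<in>?W. if v = w then t w x else 0)"
      by (simp add: sum_tensor_apply mono_def)
    also have "\<dots> = t v x" using fin by (auto simp: fun_eq_iff)
    finally show ?thesis .
  qed
  then have "t = (\<Sum>w\<in>?W. mono (t w) w)" by (intro ext) metis
  moreover have "P (\<Sum>w\<in>?W. mono (t w) w)"
    using sum[OF fin, of "\<lambda>w. mono (t w) w"] mono W by blast
  ultimately show ?thesis by simp
qed


section \<open>Degrees, bidegrees and signs\<close>

lemma tensor_deg_iff: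
  "t \<in> tensor_deg C n \<longleftrightarrow> t \<in> tensors C \<and> (\<forall>w x. t w x \<noteq> 0 \<longrightarrow> length w = n)"
  by (auto simp: tensor_deg_def fun_eq_iff)

lemma tensor_bideg_iff:
  "t \<in> tensor_bideg C C10 C01 p q \<longleftrightarrow>
     t \<in> tensors C \<and> (\<forall>w x. t w x \<noteq> 0 \<longrightarrow> word_bidegree C10 C01 w = (p, q))"
  by (auto simp: tensor_bideg_def fun_eq_iff)

lemma tensor_mult_nonzeroE:
  assumes "(s \<star> t) w x \<noteq> 0"
  obtains u v y where "w = u @ v" "s u x \<noteq> 0" "t v y \<noteq> 0"
proof -
  obtain k where "s (take k w) x * t (drop k w) (x + sum_list (take k w)) \<noteq> 0"
    using assms sum.not_neutral_contains_not_neutral unfolding tensor_mult_def by force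
  then show ?thesis using that[of "take k w" "drop k w"] by auto
qed

lemma tensor_deg_mult: "s \<in> tensor_deg C m \<Longrightarrow> t \<in> tensor_deg C n \<Longrightarrow> s \<star> t \<in> tensor_deg C (m + n)"
  unfolding tensor_deg_iff by (auto elim!: tensor_mult_nonzeroE) metis

lemma word_bidegree_append:
  "word_bidegree C10 C01 (u @ v) =
     (fst (word_bidegree C10 C01 u) + fst (word_bidegree C10 C01 v),
      snd (word_bidegree C10 C01 u) + snd (word_bidegree C10 C01 v))"
  by (simp add: word_bidegree_def)

lemma tensor_bideg_mult:
  "s \<in> tensor_bideg C C10 C01 p q \<Longrightarrow> t \<in> tensor_bideg C C10 C01 p' q' \<Longrightarrow>
   s \<star> t \<in> tensor_bideg C C10 C01 (p + p') (q + q')"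
  unfolding tensor_bideg_iff
  by (auto simp: word_bidegree_append elim!: tensor_mult_nonzeroE)
     (metis fst_conv snd_conv prod.collapse)+

lemma tensor_deg_closed:
  "0 \<in> tensor_deg C n" "s \<in> tensor_deg C n \<Longrightarrow> t \<in> tensor_deg C n \<Longrightarrow> s + t \<in> tensor_deg C n"
  "t \<in> tensor_deg C n \<Longrightarrow> - t \<in> tensor_deg C n"
  unfolding tensor_deg_iff by auto (metis add_0)

lemma tensor_bideg_closed:
  "0 \<in> tensor_bideg C C10 C01 p q"
  "s \<in> tensor_bideg C C10 C01 p q \<Longrightarrow> t \<in> tensor_bideg C C10 C01 p q \<Longrightarrow>
     s + t \<in> tensor_bideg C C10 C01 p q"
  "t \<in> tensor_bideg C C10 C01 p q \<Longrightarrow> - t \<in> tensor_bideg C C10 C01 p q"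
  unfolding tensor_bideg_iff by auto (metis add_0)+

lemma grading_involution_closed [simp, intro]:
  "t \<in> tensors C \<Longrightarrow> grading_involution t \<in> tensors C"
  by (rule tensors_support_mono) (auto simp: grading_involution_def)

lemma grading_involution_simps [simp]:
  "grading_involution (grading_involution t) = t"
  "grading_involution (s + t) = grading_involution s + grading_involution t"
  "grading_involution (s - t) = grading_involution s - grading_involution t"
  "grading_involution (- t) = - grading_involution t"
  "grading_involution 0 = 0"
  by (auto simp: grading_involution_def fun_eq_iff algebra_simps simp flip: power_add mult_2)

lemma grading_involution_mult [simp]:
  fixes s t :: "'g::group_add tensor"
  shows "grading_involution (s \<star> t) = grading_involution s \<star> grading_involution t"
proof (intro ext)
  fix w :: "'g list" and x
  have "(-1 :: complex) ^ length w = (-1) ^ k * (-1) ^ (length w - k)" if "k \<le> length w" for k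
    using that by (simp flip: power_add)
  then show "grading_involution (s \<star> t) w x = (grading_involution s \<star> grading_involution t) w x"
    unfolding grading_involution_def tensor_mult_def
    by (auto simp: sum_distrib_left mult.assoc min.absorb2 intro!: sum.cong)
qed

lemma grading_involution_deg:
  assumes t: "t \<in> tensor_deg C n"
  shows "grading_involution t = (if even n then t else - t)"
proof (intro ext)
  fix w x
  have "t w x = 0 \<or> length w = n" using t unfolding tensor_deg_iff by blast
  then show "grading_involution t w x = (if even n then t else - t) w x"
    by (auto simp: grading_involution_def)
qed

lemma theta_tensor_deg: "finite C \<Longrightarrow> B \<subseteq> C \<Longrightarrow> theta_tensor C B \<in> tensor_deg C 1"
  by (auto simp: tensor_deg_iff theta_tensor_apply)

lemma bihom_component_closed [simp, intro]:
  "t \<in> tensors C \<Longrightarrow> bihom_component C10 C01 p q t \<in> tensors C"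
  by (rule tensors_support_mono) (auto simp: bihom_component_def split: if_splits)

lemma bihom_component_apply:
  "bihom_component C10 C01 p q t w x = (if word_bidegree C10 C01 w = (p, q) then t w x else 0)"
  by (simp add: bihom_component_def)

lemma bihom_component_bideg:
  "t \<in> tensors C \<Longrightarrow> bihom_component C10 C01 p q t \<in> tensor_bideg C C10 C01 p q"
  by (auto simp: tensor_bideg_iff bihom_component_apply split: if_splits)

lemma bihom_component_simps:
  "bihom_component C10 C01 p q (s + t) = bihom_component C10 C01 p q s + bihom_component C10 C01 p q t"
  "bihom_component C10 C01 p q (s - t) = bihom_component C10 C01 p q s - bihom_component C10 C01 p q t"
  "bihom_component C10 C01 p q (- t) = - bihom_component C10 C01 p q t"
  "bihom_component C10 C01 p q 0 = 0"
  by (auto simp: bihom_component_def fun_eq_iff)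

lemma bihom_component_of_bideg:
  "t \<in> tensor_bideg C C10 C01 p q \<Longrightarrow>
   bihom_component C10 C01 p' q' t = (if (p', q') = (p, q) then t else 0)"
  unfolding tensor_bideg_iff by (auto simp: bihom_component_def fun_eq_iff)

lemma bihom_component_mult:
  "bihom_component C10 C01 p q (s \<star> t) =
     (\<Sum>i\<le>p. \<Sum>j\<le>q. bihom_component C10 C01 i j s \<star> bihom_component C10 C01 (p - i) (q - j) t)"
proof (intro ext)
  fix w x
  let ?b = "word_bidegree C10 C01"
  let ?h = "\<lambda>k. s (take k w) x * t (drop k w) (x + sum_list (take k w))"
  have split: "?b w = (fst (?b (take k w)) + fst (?b (drop k w)), snd (?b (take k w)) + snd (?b (drop k w)))" for k
    by (metis append_take_drop_id word_bidegree_append)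
  \<comment> \<open>A cut of \<open>w\<close> contributes to exactly one pair \<open>(i, j)\<close>, the bidegree of its first part.\<close>
  have key: "(\<Sum>i\<le>p. \<Sum>j\<le>q. if ?b (take k w) = (i, j) \<and> ?b (drop k w) = (p - i, q - j) then ?h k else 0)
      = (if ?b w = (p, q) then ?h k else 0)" for k
  proof -
    obtain a b c d where ab: "?b (take k w) = (a, b)" "?b (drop k w) = (c, d)" by fastforce
    have "(\<Sum>i\<le>p. \<Sum>j\<le>q. if ?b (take k w) = (i, j) \<and> ?b (drop k w) = (p - i, q - j) then ?h k else 0)
      = (\<Sum>i\<le>p. \<Sum>j\<le>q. if j = b then (if i = a then (if c = p - a \<and> d = q - b then ?h k else 0) else 0) else 0)"
      by (intro sum.cong refl) (auto simp: ab)
    also have "\<dots> = (if a \<le> p \<and> b \<le> q \<and> c = p - a \<and> d = q - b then ?h k else 0)"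
      by (cases "b \<le> q"; cases "a \<le> p") (simp_all add: sum.delta)
    also have "\<dots> = (if ?b w = (p, q) then ?h k else 0)"
      using split[of k] by (auto simp: ab)
    finally show ?thesis .
  qed
  have "(\<Sum>i\<le>p. \<Sum>j\<le>q. bihom_component C10 C01 i j s \<star> bihom_component C10 C01 (p - i) (q - j) t) w x
    = (\<Sum>i\<le>p. \<Sum>j\<le>q. \<Sum>k\<le>length w.
         if ?b (take k w) = (i, j) \<and> ?b (drop k w) = (p - i, q - j) then ?h k else 0)"
    unfolding sum_tensor_apply tensor_mult_def bihom_component_apply by (intro sum.cong) auto
  also have "\<dots> = (\<Sum>k\<le>length w. \<Sum>i\<le>p. \<Sum>j\<le>q.
         if ?b (take k w) = (i, j) \<and> ?b (drop k w) = (p - i, q - j) then ?h k else 0)"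
    by (subst (2) sum.swap, subst sum.swap) simp
  also have "\<dots> = bihom_component C10 C01 p q (s \<star> t) w x"
    unfolding key by (simp add: bihom_component_apply tensor_mult_def)
  finally show "bihom_component C10 C01 p q (s \<star> t) w x = (\<Sum>i\<le>p. \<Sum>j\<le>q.
      bihom_component C10 C01 i j s \<star> bihom_component C10 C01 (p - i) (q - j) t) w x" by simp
qed


section \<open>Quotients by homogeneous relations\<close>

locale homogeneous_relations =
  fixes C :: "'g::group_add set" and S :: "'g tensor set"
  assumes finite_C: "finite C"
    and relations_closed: "S \<subseteq> tensors C"
    and relations_homogeneous: "t \<in> S \<Longrightarrow> \<exists>n. t \<in> tensor_deg C n"
begin

abbreviation I where "I \<equiv> rel_ideal C S"
abbreviation Q where "Q \<equiv> ext_algebra C S"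
abbreviation cls where "cls \<equiv> ext_class C S"
abbreviation D where "D \<equiv> ext_commutator C S"

lemma ideal_I: "ideal I (tensor_algebra C)"
  unfolding rel_ideal_def
  using ring.genideal_ideal[OF tensor_algebra_ring relations_closed] .

sublocale ideal I "tensor_algebra C" by (rule ideal_I)

sublocale quotient: ring Q
  unfolding ext_algebra_def by (rule quotient_is_ring)

lemma relations_in_ideal: "S \<subseteq> I"
  unfolding rel_ideal_def by (rule genideal_self[OF relations_closed])

lemma ideal_subset: "t \<in> I \<Longrightarrow> t \<in> tensors C"
  using a_Hcarr .

lemma ideal_closed [simp, intro]:
  "0 \<in> I" "s \<in> I \<Longrightarrow> t \<in> I \<Longrightarrow> s + t \<in> I" "t \<in> I \<Longrightarrow> - t \<in> I"
  "s \<in> I \<Longrightarrow> t \<in> I \<Longrightarrow> s - t \<in> I"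
  "t \<in> I \<Longrightarrow> s \<in> tensors C \<Longrightarrow> s \<star> t \<in> I" "t \<in> I \<Longrightarrow> s \<in> tensors C \<Longrightarrow> t \<star> s \<in> I"
proof -
  show "0 \<in> I"
    using additive_subgroup.zero_closed[OF is_additive_subgroup] by (simp add: tensor_algebra_simps)
  show add: "s + t \<in> I" if "s \<in> I" "t \<in> I" for s t
    using additive_subgroup.a_closed[OF is_additive_subgroup that] by (simp add: tensor_algebra_simps)
  show neg: "- t \<in> I" if "t \<in> I" for t
    using additive_subgroup.a_inv_closed[OF is_additive_subgroup that] tensor_algebra_uminus[OF ideal_subset[OF that]] by simp
  show "s - t \<in> I" if "s \<in> I" "t \<in> I" for s t
    using add[OF that(1) neg[OF that(2)]] by simp
  show "s \<star> t \<in> I" "t \<star> s \<in> I" if "t \<in> I" "s \<in> tensors C"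
    using I_l_closed[OF that] I_r_closed[OF that] by (simp_all add: tensor_algebra_simps)
qed

lemma ideal_sum [simp, intro]: "(\<And>i. i \<in> A \<Longrightarrow> F i \<in> I) \<Longrightarrow> sum F A \<in> I"
  by (induction A rule: infinite_finite_induct) auto

lemma ideal_induct [consumes 1, case_names relation zero add uminus mult]:
  assumes t: "t \<in> I"
    and relation: "\<And>t. t \<in> S \<Longrightarrow> P t"
    and zero: "P 0"
    and add: "\<And>s t. s \<in> tensors C \<Longrightarrow> t \<in> tensors C \<Longrightarrow> P s \<Longrightarrow> P t \<Longrightarrow> P (s + t)"
    and uminus: "\<And>t. t \<in> tensors C \<Longrightarrow> P t \<Longrightarrow> P (- t)"
    and mult: "\<And>s t. s \<in> tensors C \<Longrightarrow> t \<in> tensors C \<Longrightarrow> P t \<Longrightarrow> P (s \<star> t) \<and> P (t \<star> s)"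
  shows "P t"
proof -
  have "subgroup {t \<in> tensors C. P t} (add_monoid (tensor_algebra C))"
    by (rule add.subgroupI)
      (auto simp: tensor_algebra_simps zero add uminus tensor_algebra_uminus simp flip: a_inv_def
        intro: exI[of _ 0])
  then have "ideal {t \<in> tensors C. P t} (tensor_algebra C)"
    by (rule idealI[OF ring_axioms]) (auto simp: tensor_algebra_simps mult)
  then have "I \<subseteq> {t \<in> tensors C. P t}"
    unfolding rel_ideal_def using relations_closed
    by (intro genideal_minimal) (auto intro: relation)
  then show ?thesis using t by blast
qed

lemma grading_involution_ideal [intro]: "t \<in> I \<Longrightarrow> grading_involution t \<in> I"
proof (rule ideal_induct[where P = "\<lambda>t. grading_involution t \<in> I"])
  fix t assume t: "t \<in> S"
  then have "t \<in> I" using relations_in_ideal by blast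
  then show "grading_involution t \<in> I"
    using relations_homogeneous[OF t] grading_involution_deg by (metis ideal_closed(3))
qed auto

lemma cls_iff: "t \<in> tensors C \<Longrightarrow> u \<in> cls t \<longleftrightarrow> u \<in> tensors C \<and> u - t \<in> I"
proof
  assume t: "t \<in> tensors C"
  show "u \<in> tensors C \<and> u - t \<in> I" if u: "u \<in> cls t"
  proof -
    obtain h where "h \<in> I" "u = h + t"
      using u unfolding ext_class_def by (auto simp: a_r_coset_def' tensor_algebra_simps)
    then show ?thesis using t ideal_subset by auto
  qed
  show "u \<in> cls t" if u: "u \<in> tensors C \<and> u - t \<in> I"
  proof -
    have "u = (u - t) + t" by simp
    then show ?thesis unfolding ext_class_def a_r_coset_def' tensor_algebra_simps using u by blast
  qed
qed

lemma cls_self: "t \<in> tensors C \<Longrightarrow> t \<in> cls t"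
  by (simp add: cls_iff)

lemma cls_eq_iff: "s \<in> tensors C \<Longrightarrow> t \<in> tensors C \<Longrightarrow> cls s = cls t \<longleftrightarrow> s - t \<in> I"
proof
  assume s: "s \<in> tensors C" and t: "t \<in> tensors C"
  show "s - t \<in> I" if "cls s = cls t"
    using cls_iff[OF t, of s] cls_self[OF s] that by simp
  show "cls s = cls t" if st: "s - t \<in> I"
  proof -
    have "u - s \<in> I \<longleftrightarrow> u - t \<in> I" for u
      using ideal_closed(2)[OF _ st, of "u - s"] ideal_closed(4)[OF _ st, of "u - t"]
      by (auto simp: algebra_simps)
    then show ?thesis using cls_iff[OF s] cls_iff[OF t] by blast
  qed
qed

lemma cls_eq_zero_iff: "t \<in> tensors C \<Longrightarrow> cls t = cls 0 \<longleftrightarrow> t \<in> I"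
  using cls_eq_iff[of t 0] by simp

lemma carrier_Q: "carrier Q = cls ` tensors C"
  by (auto simp: ext_algebra_def FactRing_def A_RCOSETS_def' ext_class_def)

lemma cls_closed [simp, intro]: "t \<in> tensors C \<Longrightarrow> cls t \<in> carrier Q"
  by (simp add: carrier_Q)

lemma cls_hom:
  "s \<in> tensors C \<Longrightarrow> t \<in> tensors C \<Longrightarrow> cls s \<otimes>\<^bsub>Q\<^esub> cls t = cls (s \<star> t)"
  "s \<in> tensors C \<Longrightarrow> t \<in> tensors C \<Longrightarrow> cls s \<oplus>\<^bsub>Q\<^esub> cls t = cls (s + t)"
  "\<one>\<^bsub>Q\<^esub> = cls (fun_tensor (\<lambda>_. 1))"
  using ring_hom_mult[OF rcos_ring_hom] ring_hom_add[OF rcos_ring_hom] ring_hom_one[OF rcos_ring_hom]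
  by (simp_all add: ext_algebra_def ext_class_def tensor_algebra_simps)

lemma cls_zero: "\<zero>\<^bsub>Q\<^esub> = cls 0"
proof -
  have "cls 0 \<oplus>\<^bsub>Q\<^esub> cls 0 = cls 0" using cls_hom(2)[of 0 0] by (simp only: tensors_closed add_0)
  then show ?thesis
    using quotient.add.l_cancel_one[of "cls 0" "cls 0"] cls_closed[of 0] by (simp only: tensors_closed)
qed

lemma cls_uminus: "t \<in> tensors C \<Longrightarrow> \<ominus>\<^bsub>Q\<^esub> cls t = cls (- t)"
  by (rule quotient.minus_equality) (auto simp: cls_hom cls_zero)

lemma cls_minus: "s \<in> tensors C \<Longrightarrow> t \<in> tensors C \<Longrightarrow> cls s \<ominus>\<^bsub>Q\<^esub> cls t = cls (s - t)"
  by (simp add: a_minus_def cls_uminus cls_hom)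

lemma cls_sum:
  "finite A \<Longrightarrow> (\<And>i. i \<in> A \<Longrightarrow> F i \<in> tensors C) \<Longrightarrow>
   finsum Q (\<lambda>i. cls (F i)) A = cls (sum F A)"
  by (induction A rule: finite_induct) (auto simp: cls_zero cls_hom quotient.finsum_insert)

lemma koszul_cls: "t \<in> tensors C \<Longrightarrow> koszul Q n (cls t) = cls (if even n then t else - t)"
  by (simp add: koszul_def cls_uminus)

lemma ext_induced_cls:
  assumes "\<And>t. t \<in> tensors C \<Longrightarrow> F t \<in> tensors C"
    and "\<And>s t. s \<in> tensors C \<Longrightarrow> t \<in> tensors C \<Longrightarrow> F (s - t) = F s - F t"
    and "\<And>t. t \<in> I \<Longrightarrow> F t \<in> I"
    and t: "t \<in> tensors C"
  shows "ext_induced C S F (cls t) = cls (F t)"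
proof -
  have "cls (F u) = cls (F t)" if "u \<in> cls t" for u
  proof -
    have u: "u \<in> tensors C" "u - t \<in> I" using that by (auto simp: cls_iff[OF t])
    then have "F u - F t \<in> I" using assms by metis
    then show ?thesis using u t assms(1) by (simp add: cls_eq_iff)
  qed
  then show ?thesis unfolding ext_induced_def using cls_self[OF t] by blast
qed

abbreviation commutator :: "'g set \<Rightarrow> 'g tensor \<Rightarrow> 'g tensor" where
  "commutator B t \<equiv> theta_tensor C B \<star> t - grading_involution t \<star> theta_tensor C B"

lemma commutator_closed [simp, intro]: "B \<subseteq> C \<Longrightarrow> t \<in> tensors C \<Longrightarrow> commutator B t \<in> tensors C"
  using finite_C by auto

lemma ext_commutator_cls:
  assumes "B \<subseteq> C" "t \<in> tensors C"
  shows "D B (cls t) = cls (commutator B t)"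
proof -
  have "ext_induced C S grading_involution (cls t) = cls (grading_involution t)"
    by (rule ext_induced_cls) (use assms in auto)
  then show ?thesis
    using assms finite_C by (simp add: ext_commutator_def cls_hom cls_minus)
qed

text \<open>Projections of the tensor algebra that preserve the ideal grade the quotient: applied to a
  congruence \<open>t \<equiv> \<Sum> r\<^sub>i\<close> with \<open>r\<^sub>i\<close> in the \<open>i\<close>-th summand, the \<open>j\<close>-th projection determines the
  class of \<open>r\<^sub>j\<close>, which gives uniqueness.\<close>

lemma internal_direct_sum_cls:
  fixes pr :: "'i \<Rightarrow> 'g tensor \<Rightarrow> 'g tensor"
  assumes M: "M \<subseteq> tensors C" "0 \<in> M" "\<And>s t. s \<in> M \<Longrightarrow> t \<in> M \<Longrightarrow> s + t \<in> M" "\<And>t. t \<in> M \<Longrightarrow> - t \<in> M"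
    and H: "\<And>i. i \<in> J \<Longrightarrow> H i \<subseteq> M" "\<And>i. i \<in> J \<Longrightarrow> 0 \<in> H i"
      "\<And>i s t. i \<in> J \<Longrightarrow> s \<in> H i \<Longrightarrow> t \<in> H i \<Longrightarrow> s + t \<in> H i"
      "\<And>i t. i \<in> J \<Longrightarrow> t \<in> H i \<Longrightarrow> - t \<in> H i"
    and pr_diff: "\<And>i s t. i \<in> J \<Longrightarrow> pr i (s - t) = pr i s - pr i t"
    and pr_ideal: "\<And>i t. i \<in> J \<Longrightarrow> t \<in> I \<Longrightarrow> pr i t \<in> I"
    and pr_H: "\<And>i j t. i \<in> J \<Longrightarrow> j \<in> J \<Longrightarrow> t \<in> H i \<Longrightarrow> pr j t = (if j = i then t else 0)"
    and pr_in: "\<And>i t. i \<in> J \<Longrightarrow> t \<in> M \<Longrightarrow> pr i t \<in> H i"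
    and pr_fin: "\<And>t. t \<in> M \<Longrightarrow> finite {i \<in> J. pr i t \<noteq> 0}"
    and pr_sum: "\<And>t. t \<in> M \<Longrightarrow> t = (\<Sum>i\<in>{i \<in> J. pr i t \<noteq> 0}. pr i t)"
  shows "internal_direct_sum Q J (\<lambda>i. cls ` H i) (cls ` M)"
proof -
  have sub: "additive_subgroup (cls ` N) Q"
    if N: "N \<subseteq> tensors C" "0 \<in> N" "\<And>s t. s \<in> N \<Longrightarrow> t \<in> N \<Longrightarrow> s + t \<in> N" "\<And>t. t \<in> N \<Longrightarrow> - t \<in> N" for N
  proof (rule additive_subgroup.intro, rule quotient.add.subgroupI)
    show "cls ` N \<subseteq> carrier Q" "cls ` N \<noteq> {}" using N by auto
    show "\<ominus>\<^bsub>Q\<^esub> x \<in> cls ` N" if "x \<in> cls ` N" for x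
      using that N by (auto simp: cls_uminus subset_iff)
    show "x \<oplus>\<^bsub>Q\<^esub> y \<in> cls ` N" if "x \<in> cls ` N" "y \<in> cls ` N" for x y
      using that N by (auto simp: cls_hom subset_iff)
  qed
  have HT: "H i \<subseteq> tensors C" if "i \<in> J" for i using H(1)[OF that] M by blast
  have uniq: "\<exists>!h. h \<in> (\<Pi>\<^sub>E i\<in>J. cls ` H i) \<and> finite {i \<in> J. h i \<noteq> \<zero>\<^bsub>Q\<^esub>} \<and>
        cls t = (\<Oplus>\<^bsub>Q\<^esub>i\<in>{i \<in> J. h i \<noteq> \<zero>\<^bsub>Q\<^esub>}. h i)" if t: "t \<in> M" for t
  proof (rule ex1I)
    have tT: "t \<in> tensors C" using t M by blast
    have prT: "pr i t \<in> tensors C" if "i \<in> J" for i using pr_in[OF that t] HT[OF that] by blast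
    let ?h = "\<lambda>i\<in>J. cls (pr i t)"
    let ?F = "{i \<in> J. pr i t \<noteq> 0}"
    have F: "finite ?F" by (rule pr_fin[OF t])
    have hF: "{i \<in> J. ?h i \<noteq> \<zero>\<^bsub>Q\<^esub>} \<subseteq> ?F" by (auto simp: cls_zero)
    have "cls t = cls (\<Sum>i\<in>?F. pr i t)" using pr_sum[OF t] by simp
    also have "\<dots> = (\<Oplus>\<^bsub>Q\<^esub>i\<in>?F. cls (pr i t))" using F prT by (subst cls_sum) auto
    also have "\<dots> = (\<Oplus>\<^bsub>Q\<^esub>i\<in>{i \<in> J. ?h i \<noteq> \<zero>\<^bsub>Q\<^esub>}. ?h i)"
      by (rule quotient.add.finprod_mono_neutral_cong_right[OF F hF]) (use prT in auto)
    finally show "?h \<in> (\<Pi>\<^sub>E i\<in>J. cls ` H i) \<and> finite {i \<in> J. ?h i \<noteq> \<zero>\<^bsub>Q\<^esub>} \<and>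
        cls t = (\<Oplus>\<^bsub>Q\<^esub>i\<in>{i \<in> J. ?h i \<noteq> \<zero>\<^bsub>Q\<^esub>}. ?h i)"
      using pr_in t finite_subset[OF hF F] by auto
    fix h assume h: "h \<in> (\<Pi>\<^sub>E i\<in>J. cls ` H i) \<and> finite {i \<in> J. h i \<noteq> \<zero>\<^bsub>Q\<^esub>} \<and>
        cls t = (\<Oplus>\<^bsub>Q\<^esub>i\<in>{i \<in> J. h i \<noteq> \<zero>\<^bsub>Q\<^esub>}. h i)"
    let ?G = "{i \<in> J. h i \<noteq> \<zero>\<^bsub>Q\<^esub>}"
    have "\<forall>i\<in>J. \<exists>r. r \<in> H i \<and> h i = cls r" using h by (auto simp: PiE_iff)
    then obtain r where r: "\<And>i. i \<in> J \<Longrightarrow> r i \<in> H i" "\<And>i. i \<in> J \<Longrightarrow> h i = cls (r i)" by metis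
    have rT: "r i \<in> tensors C" if "i \<in> J" for i using r(1)[OF that] HT[OF that] by blast
    have "(\<Oplus>\<^bsub>Q\<^esub>i\<in>?G. h i) = (\<Oplus>\<^bsub>Q\<^esub>i\<in>?G. cls (r i))"
      by (rule quotient.finsum_cong'[OF refl]) (use r(2) rT in auto)
    then have "cls t = (\<Oplus>\<^bsub>Q\<^esub>i\<in>?G. cls (r i))" using h by simp
    also have "\<dots> = cls (\<Sum>i\<in>?G. r i)" using h rT by (subst cls_sum) auto
    finally have diff: "t - (\<Sum>i\<in>?G. r i) \<in> I" using tT rT by (subst (asm) cls_eq_iff) auto
    have "h j = cls (pr j t)" if j: "j \<in> J" for j
    proof -
      have pr0: "pr j 0 = 0" using pr_diff[OF j, of 0 0] by simp
      have pr_add: "pr j (a + b) = pr j a + pr j b" for a b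
        using pr_diff[OF j, of "a + b" b] by (simp add: algebra_simps)
      have "pr j (sum r A) = (\<Sum>i\<in>A. pr j (r i))" for A
        using sum_comp_morphism[of "pr j" r A, OF pr0 pr_add] by (simp add: o_def)
      then have "pr j (\<Sum>i\<in>?G. r i) = (\<Sum>i\<in>?G. if i = j then r j else 0)"
        using pr_H[OF _ j] r by (auto intro!: sum.cong)
      also have "\<dots> = (if j \<in> ?G then r j else 0)" using h by (simp add: sum.delta)
      finally have "pr j t - (if j \<in> ?G then r j else 0) \<in> I"
        using pr_ideal[OF j diff] pr_diff[OF j] by simp
      then have "cls (pr j t) = cls (if j \<in> ?G then r j else 0)"
        using prT[OF j] rT[OF j] by (subst cls_eq_iff) auto
      then show ?thesis using r(2)[OF j] j by (auto simp: cls_zero)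
    qed
    then show "h = ?h" using h by (auto simp: fun_eq_iff PiE_iff extensional_def)
  qed
  show ?thesis
    unfolding internal_direct_sum_def
    using sub[of M] sub[of "H _"] M H HT uniq by (auto simp: image_mono)
qed

end

text \<open>The canonical map between the quotients by two sets of relations exists as soon as the
  second ideal contains the first relations.\<close>

lemma is_further_quotientI:
  assumes "homogeneous_relations C S" "homogeneous_relations C S'" and "S \<subseteq> rel_ideal C S'"
  shows "is_further_quotient C S S'"
proof -
  interpret A: homogeneous_relations C S by fact
  interpret B: homogeneous_relations C S' by fact
  have sub: "A.I \<subseteq> B.I"
    using ring.genideal_minimal[OF tensor_algebra_ring B.ideal_I assms(3)]
    by (simp add: rel_ideal_def)
  define \<pi> where "\<pi> = ext_induced C S' (\<lambda>t. t)"
  have \<pi>: "\<pi> (A.cls t) = B.cls t" if t: "t \<in> tensors C" for t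
  proof -
    have "B.cls u = B.cls t" if "u \<in> A.cls t" for u
      using that t sub B.cls_eq_iff[of u t] A.cls_iff[OF t] by blast
    then show ?thesis unfolding \<pi>_def ext_induced_def using A.cls_self[OF t] by blast
  qed
  show ?thesis
    unfolding is_further_quotient_def
  proof (intro bexI[of _ \<pi>] conjI ballI)
    show "\<pi> \<in> ring_hom A.Q B.Q"
      by (rule ring_hom_memI) (auto simp: A.carrier_Q A.cls_hom B.cls_hom \<pi>)
    show "\<pi> ` carrier A.Q = carrier B.Q"
      unfolding A.carrier_Q B.carrier_Q image_image using \<pi> by (auto intro: image_cong)
    show "\<pi> (ext_commutator C S C \<xi>) = ext_commutator C S' C (\<pi> \<xi>)" if \<xi>: "\<xi> \<in> carrier A.Q" for \<xi>
    proof -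
      obtain t where t: "t \<in> tensors C" "\<xi> = A.cls t"
        using \<xi> unfolding A.carrier_Q by blast
      then show ?thesis
        using \<pi>[OF A.commutator_closed[OF subset_refl t(1)]]
        by (simp add: \<pi> A.ext_commutator_cls B.ext_commutator_cls)
    qed
  qed (rule \<pi>)
qed


section \<open>Graded commutators as differentials\<close>

context homogeneous_relations
begin

lemma commutator_mult:
  assumes "B \<subseteq> C" "s \<in> tensors C" "t \<in> tensors C"
  shows "commutator B (s \<star> t) = commutator B s \<star> t + grading_involution s \<star> commutator B t"
proof -
  have "theta_tensor C B \<in> tensors C" using assms finite_C by auto
  then show ?thesis
    using assms by (simp add: tensor_mult_distrib tensor_mult_assoc[of _ C])
qed

lemma commutator_fun_const:
  assumes "B \<subseteq> C" "t \<in> tensors C"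
  shows "commutator B (fun_tensor (\<lambda>_. c) \<star> t) = fun_tensor (\<lambda>_. c) \<star> commutator B t"
proof -
  have \<theta>: "theta_tensor C B \<in> tensors C" using assms finite_C by auto
  have c: "u \<star> fun_tensor (\<lambda>_. c) = fun_tensor (\<lambda>_. c) \<star> u" for u :: "'g tensor"
    by (auto simp: fun_eq_iff fun_tensor_mult_apply mult_fun_tensor_apply)
  have "fun_tensor (\<lambda>_. c) \<in> tensor_deg C 0"
    by (auto simp: tensor_deg_iff) (auto simp: fun_tensor_def split: if_splits)
  then have g: "grading_involution (fun_tensor (\<lambda>_. c)) = (fun_tensor (\<lambda>_. c) :: 'g tensor)"
    using grading_involution_deg by (metis even_zero)
  have "theta_tensor C B \<star> (fun_tensor (\<lambda>_. c) \<star> t) = fun_tensor (\<lambda>_. c) \<star> (theta_tensor C B \<star> t)"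
    using \<theta> assms by (simp add: c flip: tensor_mult_assoc[of _ C])
  then show ?thesis
    using \<theta> assms by (simp add: g tensor_mult_distrib tensor_mult_assoc[of _ C])
qed

lemma graded_derivation_commutator:
  assumes B: "B \<subseteq> C"
  shows "graded_derivation Q (ext_fun C S) (ext_deg C S) (D B)"
proof -
  have mult: "D B (x \<otimes>\<^bsub>Q\<^esub> y)
      = D B x \<otimes>\<^bsub>Q\<^esub> y \<oplus>\<^bsub>Q\<^esub> koszul Q n (x \<otimes>\<^bsub>Q\<^esub> D B y)"
    if x: "x \<in> ext_deg C S n" and y: "y \<in> carrier Q" for n x y
  proof -
    obtain s t where s: "s \<in> tensor_deg C n" "x = cls s" and t: "t \<in> tensors C" "y = cls t"
      using x y unfolding ext_deg_def carrier_Q by blast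
    have sC: "s \<in> tensors C" using s by (simp add: tensor_deg_iff)
    have "grading_involution s \<star> commutator B t
        = (if even n then s \<star> commutator B t else - (s \<star> commutator B t))"
      using grading_involution_deg[OF s(1)] by (simp add: tensor_mult_distrib)
    then show ?thesis
      using sC s(2) t B commutator_mult[OF B sC t(1)]
        commutator_closed[OF B sC] commutator_closed[OF B t(1)]
      by (simp add: cls_hom ext_commutator_cls koszul_cls)
  qed
  have closed: "D B x \<in> carrier Q" if "x \<in> carrier Q" for x
    using that B by (auto simp: carrier_Q ext_commutator_cls)
  have add: "D B (x \<oplus>\<^bsub>Q\<^esub> y) = D B x \<oplus>\<^bsub>Q\<^esub> D B y"
    if xy: "x \<in> carrier Q" "y \<in> carrier Q" for x y
  proof -
    obtain s t where s: "s \<in> tensors C" "x = cls s" and t: "t \<in> tensors C" "y = cls t"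
      using xy unfolding carrier_Q by blast
    have "commutator B (s + t) = commutator B s + commutator B t"
      by (simp add: tensor_mult_distrib)
    then show ?thesis
      using s t B commutator_closed[OF B s(1)] commutator_closed[OF B t(1)]
      by (simp add: cls_hom ext_commutator_cls)
  qed
  have const: "D B (ext_fun C S (\<lambda>_. c) \<otimes>\<^bsub>Q\<^esub> x)
      = ext_fun C S (\<lambda>_. c) \<otimes>\<^bsub>Q\<^esub> D B x" if x: "x \<in> carrier Q" for c x
  proof -
    obtain t where t: "t \<in> tensors C" "x = cls t" using x unfolding carrier_Q by blast
    show ?thesis
      using t B commutator_fun_const[OF B t(1)] commutator_closed[OF B t(1)]
      by (simp add: cls_hom ext_commutator_cls ext_fun_def)
  qed
  show ?thesis
    unfolding graded_derivation_def
    by (intro conjI ballI allI funcsetI) (rule closed add const mult; assumption)+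
qed

text \<open>The grading involution changes the sign of \<open>\<theta>\<close>; therefore the mixed terms
  \<open>\<theta> \<gamma>(t) \<theta>'\<close> of the two compositions cancel.\<close>

lemma commutator_anticommutator:
  assumes "B \<subseteq> C" "B' \<subseteq> C" "t \<in> tensors C"
  defines "\<Theta> \<equiv> theta_tensor C B \<star> theta_tensor C B' + theta_tensor C B' \<star> theta_tensor C B"
  shows "commutator B (commutator B' t) + commutator B' (commutator B t) = \<Theta> \<star> t - t \<star> \<Theta>"
proof -
  have \<theta>: "theta_tensor C B \<in> tensors C" "theta_tensor C B' \<in> tensors C"
    using assms finite_C by auto
  have g: "grading_involution (theta_tensor C B) = - theta_tensor C B"
    "grading_involution (theta_tensor C B') = - theta_tensor C B'"
    using assms finite_C by (auto simp: grading_involution_deg[OF theta_tensor_deg])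
  show ?thesis
    unfolding \<Theta>_def using \<theta> assms(3)
    by (simp add: g tensor_mult_distrib tensor_mult_assoc[of _ C])
qed

lemma commutator_square:
  assumes "B \<subseteq> C" "t \<in> tensors C"
  defines "\<Theta> \<equiv> theta_tensor C B \<star> theta_tensor C B"
  shows "commutator B (commutator B t) = \<Theta> \<star> t - t \<star> \<Theta>"
proof -
  have \<theta>: "theta_tensor C B \<in> tensors C"
    using assms finite_C by auto
  have g: "grading_involution (theta_tensor C B) = - theta_tensor C B"
    using assms finite_C by (auto simp: grading_involution_deg[OF theta_tensor_deg])
  show ?thesis
    unfolding \<Theta>_def using \<theta> assms(2)
    by (simp add: g tensor_mult_distrib tensor_mult_assoc[of _ C])
qed

end

lemma product_relation_closed_sum:
  assumes "finite C"
  shows "product_relation C z =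
    (\<Sum>p\<in>{(a, b). a \<in> C \<and> b \<in> C \<and> a + b = z}. basis_form (fst p) \<star> basis_form (snd p))"
proof -
  have "finite {(a, b). a \<in> C \<and> b \<in> C \<and> a + b = z}"
    by (rule finite_subset[of _ "C \<times> C"]) (use assms in auto)
  then show ?thesis
    unfolding product_relation_def tensor_algebra_simps by (intro tensor_algebra_finsum) auto
qed

lemma product_relation_closed [simp, intro]: "finite C \<Longrightarrow> product_relation C z \<in> tensors C"
  by (auto simp: product_relation_closed_sum)

lemma product_relation_apply:
  assumes "finite C"
  shows "product_relation C z w x = (if \<exists>a\<in>C. \<exists>b\<in>C. w = [a, b] \<and> a + b = z then 1 else 0)"
proof -
  let ?P = "{(a, b). a \<in> C \<and> b \<in> C \<and> a + b = z}"
  have fin: "finite ?P" by (rule finite_subset[of _ "C \<times> C"]) (use assms in auto)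
  have "product_relation C z w x = (\<Sum>p\<in>?P. if w = [fst p, snd p] then 1 else 0)"
    by (simp add: product_relation_closed_sum[OF assms] sum_tensor_apply basis_form_mult_basis_form)
  also have "\<dots> = (if \<exists>a\<in>C. \<exists>b\<in>C. w = [a, b] \<and> a + b = z then 1 else 0)"
  proof (cases "\<exists>a\<in>C. \<exists>b\<in>C. w = [a, b] \<and> a + b = z")
    case True
    then obtain a b where ab: "a \<in> C" "b \<in> C" "w = [a, b]" "a + b = z" by blast
    have "(\<Sum>p\<in>?P. if w = [fst p, snd p] then 1 else 0) = (\<Sum>p\<in>?P. if p = (a, b) then 1 else (0::complex))"
      by (rule sum.cong) (auto simp: ab)
    then show ?thesis using True ab fin by (simp add: sum.delta)
  next
    case False
    then have "\<And>p. p \<in> ?P \<Longrightarrow> w \<noteq> [fst p, snd p]" by auto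
    then show ?thesis using False by (simp add: sum.neutral)
  qed
  finally show ?thesis .
qed

lemma theta_mult_theta_apply:
  assumes "finite C" "B \<subseteq> C" "B' \<subseteq> C"
  shows "(theta_tensor C B \<star> theta_tensor C B') w x = (if \<exists>a\<in>B. \<exists>b\<in>B'. w = [a, b] then 1 else 0)"
proof -
  have fin: "finite B" using assms finite_subset by blast
  have "(theta_tensor C B \<star> theta_tensor C B') w x
      = (\<Sum>a\<in>B. if w \<noteq> [] \<and> hd w = a then theta_tensor C B' (tl w) (x + a) else 0)"
    using assms by (simp add: theta_tensor_eq_sum[of C B] tensor_mult_sum sum_tensor_apply basis_form_mult_apply)
  also have "\<dots> = (\<Sum>a\<in>B. if a = hd w then (if w \<noteq> [] \<and> (\<exists>b\<in>B'. tl w = [b]) then 1 else 0) else 0)"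
    using assms by (intro sum.cong) (auto simp: theta_tensor_apply)
  also have "\<dots> = (if \<exists>a\<in>B. \<exists>b\<in>B'. w = [a, b] then 1 else 0)"
    using fin by (cases w) (auto simp: sum.delta)
  finally show ?thesis .
qed

lemma word_bidegree_length:
  assumes "C = C10 \<union> C01" "C10 \<inter> C01 = {}" "set w \<subseteq> C"
  shows "fst (word_bidegree C10 C01 w) + snd (word_bidegree C10 C01 w) = length w"
  using assms(3) by (induction w) (use assms(1,2) in \<open>auto simp: word_bidegree_def\<close>)


lemma sum_bihom_components:
  assumes "C = C10 \<union> C01" "C10 \<inter> C01 = {}" and t: "t \<in> tensors C"
  shows "(\<Sum>p\<le>n. bihom_component C10 C01 p (n - p) t) w x = (if length w = n then t w x else 0)"
proof (cases "t w x = 0")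
  case False
  then have "set w \<subseteq> C" using t unfolding tensors_iff by blast
  then have len: "length w = fst (word_bidegree C10 C01 w) + snd (word_bidegree C10 C01 w)"
    using word_bidegree_length[OF assms(1,2)] by metis
  have "(\<Sum>p\<le>n. bihom_component C10 C01 p (n - p) t) w x
      = (\<Sum>p\<le>n. if word_bidegree C10 C01 w = (p, n - p) then t w x else 0)"
    unfolding sum_tensor_apply bihom_component_apply ..
  also have "\<dots> = (\<Sum>p\<le>n. if p = fst (word_bidegree C10 C01 w) then (if length w = n then t w x else 0) else 0)"
    using len by (intro sum.cong) (auto simp: prod_eq_iff)
  also have "\<dots> = (if length w = n then t w x else 0)" using len by (auto simp: sum.delta)
  finally show ?thesis .
qed (auto simp: sum_tensor_apply bihom_component_apply intro!: sum.neutral)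


section \<open>The double complex\<close>

text \<open>The relations enter the double complex only through their bihomogeneity and through the
  product relations with \<open>z \<noteq> 0\<close> in the ideal, so adding further bihomogeneous relations
  of degree at least 2 preserves these assumptions.\<close>

locale bihomogeneous_relations =
  fixes C C10 C01 :: "'g::group_add set" and S :: "'g tensor set"
  assumes finite_alphabet: "finite C"
    and splitting: "C = C10 \<union> C01" "C10 \<inter> C01 = {}"
    and inverse: "a \<in> C10 \<Longrightarrow> - a \<in> C01" "a \<in> C01 \<Longrightarrow> - a \<in> C10"
    and bihomogeneous: "t \<in> S \<Longrightarrow> \<exists>p q. t \<in> tensor_bideg C C10 C01 p q \<and> p + q \<ge> 2"
    and product_relations: "z \<noteq> 0 \<Longrightarrow> product_relation C z \<in> rel_ideal C S"
begin

lemma subsets [simp, intro]: "C10 \<subseteq> C" "C01 \<subseteq> C" "C \<subseteq> C"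
  using splitting by auto

lemma bideg_subset_deg: "tensor_bideg C C10 C01 p q \<subseteq> tensor_deg C (p + q)"
proof
  fix t assume t: "t \<in> tensor_bideg C C10 C01 p q"
  have "length w = p + q" if "t w x \<noteq> 0" for w x
  proof -
    have "set w \<subseteq> C" "word_bidegree C10 C01 w = (p, q)"
      using that t unfolding tensor_bideg_iff tensors_iff by blast+
    then show ?thesis using word_bidegree_length[OF splitting] by fastforce
  qed
  then show "t \<in> tensor_deg C (p + q)"
    using t unfolding tensor_deg_iff tensor_bideg_iff by blast
qed

sublocale homogeneous_relations C S
proof
  show "S \<subseteq> tensors C" using bihomogeneous unfolding tensor_bideg_iff by blast
  show "\<exists>n. t \<in> tensor_deg C n" if "t \<in> S" for t
    using bihomogeneous[OF that] bideg_subset_deg by blast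
qed (rule finite_alphabet)

text \<open>As relations start in degree 2, functions and one-forms embed in the quotient.\<close>

lemma ideal_low_degree:
  assumes "t \<in> I" "length w < 2"
  shows "t w x = 0"
proof -
  have "\<forall>w x. length w < 2 \<longrightarrow> t w x = 0"
    using assms(1)
  proof (rule ideal_induct[where P = "\<lambda>t. \<forall>w x. length w < 2 \<longrightarrow> t w x = 0"])
    fix t assume "t \<in> S"
    then obtain n where "t \<in> tensor_deg C n" "n \<ge> 2"
      using bihomogeneous bideg_subset_deg by blast
    then show "\<forall>w x. length w < 2 \<longrightarrow> t w x = 0"
      unfolding tensor_deg_iff by (metis not_le)
  next
    fix s t :: "'g tensor"
    assume t: "\<forall>w x. length w < 2 \<longrightarrow> t w x = 0"
    show "(\<forall>w x. length w < 2 \<longrightarrow> (s \<star> t) w x = 0) \<and> (\<forall>w x. length w < 2 \<longrightarrow> (t \<star> s) w x = 0)"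
      unfolding tensor_mult_def using t by (auto intro!: sum.neutral)
  qed auto
  then show ?thesis using assms(2) by blast
qed

lemma bihom_component_ideal: "t \<in> I \<Longrightarrow> bihom_component C10 C01 p q t \<in> I"
proof -
  assume "t \<in> I"
  then have "\<forall>p q. bihom_component C10 C01 p q t \<in> I"
  proof (rule ideal_induct[where P = "\<lambda>t. \<forall>p q. bihom_component C10 C01 p q t \<in> I"])
    fix t assume t: "t \<in> S"
    then show "\<forall>p q. bihom_component C10 C01 p q t \<in> I"
      using bihomogeneous[OF t] relations_in_ideal bihom_component_of_bideg by fastforce
  qed (auto simp: bihom_component_simps bihom_component_mult)
  then show ?thesis by blast
qed

definition deg_component :: "nat \<Rightarrow> 'g tensor \<Rightarrow> 'g tensor" where
  "deg_component n t = (\<Sum>p\<le>n. bihom_component C10 C01 p (n - p) t)"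

lemma deg_component_apply:
  "t \<in> tensors C \<Longrightarrow> deg_component n t w x = (if length w = n then t w x else 0)"
  unfolding deg_component_def by (rule sum_bihom_components[OF splitting])

lemma deg_component_deg:
  assumes "t \<in> tensors C"
  shows "deg_component n t \<in> tensor_deg C n"
proof -
  have "deg_component n t \<in> tensors C" unfolding deg_component_def using assms by auto
  then show ?thesis
    using deg_component_apply[OF assms] unfolding tensor_deg_iff by metis
qed

lemma deg_component_ideal: "t \<in> I \<Longrightarrow> deg_component n t \<in> I"
  unfolding deg_component_def by (auto intro: bihom_component_ideal)

lemma sum_deg_components:
  assumes t: "t \<in> tensors C"
  shows "finite {n. deg_component n t \<noteq> 0}" "t = (\<Sum>n\<in>{n. deg_component n t \<noteq> 0}. deg_component n t)"
proof -
  have fw: "finite {w. t w \<noteq> (\<lambda>_. 0)}" using t unfolding tensors_iff by blast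
  have "\<exists>w. length w = n \<and> t w \<noteq> (\<lambda>_. 0)" if n: "deg_component n t \<noteq> 0" for n
  proof -
    obtain w x where "deg_component n t w x \<noteq> 0" using n by (auto simp: fun_eq_iff)
    then show ?thesis using deg_component_apply[OF t, of n w x] by (auto split: if_splits)
  qed
  then have "{n. deg_component n t \<noteq> 0} \<subseteq> length ` {w. t w \<noteq> (\<lambda>_. 0)}" by blast
  then show fin: "finite {n. deg_component n t \<noteq> 0}" using fw finite_surj by blast
  have "(\<Sum>n\<in>{n. deg_component n t \<noteq> 0}. deg_component n t) w x = t w x" for w x
  proof -
    let ?N = "{n. deg_component n t \<noteq> 0}"
    have "(\<Sum>n\<in>?N. deg_component n t) w x = (\<Sum>n\<in>?N. if n = length w then t w x else 0)"
      unfolding sum_tensor_apply deg_component_apply[OF t] by (intro sum.cong) auto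
    also have "\<dots> = (if length w \<in> ?N then t w x else 0)" using fin by (simp add: sum.delta)
    also have "\<dots> = t w x"
    proof -
      have "deg_component (length w) t w x = t w x" by (simp add: deg_component_apply[OF t])
      then show ?thesis by auto
    qed
    finally show ?thesis .
  qed
  then show "t = (\<Sum>n\<in>{n. deg_component n t \<noteq> 0}. deg_component n t)" by (simp add: fun_eq_iff)
qed

lemma grading_Q: "internal_direct_sum Q UNIV (ext_deg C S) (carrier Q)"
proof -
  have "internal_direct_sum Q UNIV (\<lambda>n. cls ` tensor_deg C n) (cls ` tensors C)"
  proof (rule internal_direct_sum_cls[where pr = deg_component])
    show "deg_component n (s - t) = deg_component n s - deg_component n t" for n s t
      by (simp add: deg_component_def bihom_component_simps sum_subtractf)
    show "deg_component j t = (if j = i then t else 0)" if "t \<in> tensor_deg C i" for i j t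
      using that unfolding tensor_deg_iff by (auto simp: fun_eq_iff deg_component_apply)
    show "deg_component i t \<in> tensor_deg C i" if "t \<in> tensors C" for i t
      by (rule deg_component_deg[OF that])
    show "finite {i \<in> UNIV. deg_component i t \<noteq> 0}"
      "t = (\<Sum>i\<in>{i \<in> UNIV. deg_component i t \<noteq> 0}. deg_component i t)" if "t \<in> tensors C" for t
      using sum_deg_components[OF that] by auto
  qed (auto simp: tensor_deg_closed deg_component_ideal, auto simp: tensor_deg_iff)
  then show ?thesis by (simp add: ext_deg_def[abs_def] carrier_Q)
qed

lemma bigrading_Q:
  "internal_direct_sum Q {..m} (\<lambda>p. ext_bideg C C10 C01 S p (m - p)) (ext_deg C S m)"
  unfolding ext_bideg_def ext_deg_def
proof (rule internal_direct_sum_cls[where pr = "\<lambda>p. bihom_component C10 C01 p (m - p)"])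
  show "tensor_bideg C C10 C01 p (m - p) \<subseteq> tensor_deg C m" if "p \<in> {..m}" for p
    using bideg_subset_deg[of p "m - p"] that by simp
  show "bihom_component C10 C01 j (m - j) t = (if j = i then t else 0)"
    if "t \<in> tensor_bideg C C10 C01 i (m - i)" for i j t
    using bihom_component_of_bideg[OF that] by simp
  show "t = (\<Sum>p\<in>{p \<in> {..m}. bihom_component C10 C01 p (m - p) t \<noteq> 0}. bihom_component C10 C01 p (m - p) t)"
    if t: "t \<in> tensor_deg C m" for t
  proof -
    have "t = deg_component m t"
      using t unfolding tensor_deg_iff by (auto simp: fun_eq_iff deg_component_apply)
    also have "\<dots> = (\<Sum>p\<in>{p \<in> {..m}. bihom_component C10 C01 p (m - p) t \<noteq> 0}. bihom_component C10 C01 p (m - p) t)"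
      unfolding deg_component_def by (rule sum.mono_neutral_right) auto
    finally show ?thesis .
  qed
  show "bihom_component C10 C01 i (m - i) t \<in> tensor_bideg C C10 C01 i (m - i)"
    if "t \<in> tensor_deg C m" for i t
    using that by (auto simp: tensor_deg_iff intro: bihom_component_bideg)
qed (auto simp: tensor_deg_closed tensor_bideg_closed bihom_component_simps bihom_component_ideal,
      auto simp: tensor_deg_iff)

text \<open>Modulo the relations \<open>\<theta>\<^sup>2\<close> is \<open>\<Sum> e\<^sup>a e\<^bsup>a\<inverse>\<^esup>\<close>, which is of bidegree \<open>(1,1)\<close> because inversion
  exchanges \<open>C10\<close> and \<open>C01\<close>.  The bidegree components of this congruence give the next lemma.\<close>

lemma theta_products:
  "theta_tensor C C10 \<star> theta_tensor C C10 \<in> I"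
  "theta_tensor C C01 \<star> theta_tensor C C01 \<in> I"
  "theta_tensor C C10 \<star> theta_tensor C C01 + theta_tensor C C01 \<star> theta_tensor C C10
     - product_relation C 0 \<in> I"
proof -
  let ?Z = "(\<lambda>(a, b). a + b) ` (C \<times> C) - {0}"
  have finZ: "finite ?Z" using finite_C by auto
  define R where "R = (\<Sum>z\<in>?Z. product_relation C z)"
  have "R \<in> I" unfolding R_def using product_relations by auto
  then have RI: "bihom_component C10 C01 p q R \<in> I" for p q by (rule bihom_component_ideal)
  have R: "R w x = (if \<exists>a\<in>C. \<exists>b\<in>C. w = [a, b] \<and> a + b \<noteq> 0 then 1 else 0)" for w x
  proof (cases "\<exists>a\<in>C. \<exists>b\<in>C. w = [a, b] \<and> a + b \<noteq> 0")
    case True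
    then obtain a b where ab: "a \<in> C" "b \<in> C" "w = [a, b]" "a + b \<noteq> 0" by blast
    then have Z: "a + b \<in> ?Z" by force
    have "R w x = (\<Sum>z\<in>?Z. if z = a + b then 1 else 0)"
      unfolding R_def sum_tensor_apply product_relation_apply[OF finite_C]
      using ab by (intro sum.cong) auto
    then show ?thesis using True Z finZ by (simp add: sum.delta)
  next
    case False
    then have "product_relation C z w x = 0" if "z \<in> ?Z" for z
      using that unfolding product_relation_apply[OF finite_C] by auto
    then show ?thesis
      using False unfolding R_def sum_tensor_apply by (simp add: sum.neutral)
  qed
  have zero: "a + b \<noteq> 0" if "a \<in> C10 \<and> b \<in> C10 \<or> a \<in> C01 \<and> b \<in> C01" for a b
    using that inverse splitting by (metis disjoint_iff eq_neg_iff_add_eq_0)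
  have "bihom_component C10 C01 2 0 R = theta_tensor C C10 \<star> theta_tensor C C10"
    unfolding fun_eq_iff bihom_component_apply R theta_mult_theta_apply[OF finite_C subsets(1) subsets(1)]
    using splitting zero by (auto simp: word_bidegree_def split: if_splits)
  then show "theta_tensor C C10 \<star> theta_tensor C C10 \<in> I" using RI by metis
  have "bihom_component C10 C01 0 2 R = theta_tensor C C01 \<star> theta_tensor C C01"
    unfolding fun_eq_iff bihom_component_apply R theta_mult_theta_apply[OF finite_C subsets(2) subsets(2)]
    using splitting zero by (auto simp: word_bidegree_def split: if_splits)
  then show "theta_tensor C C01 \<star> theta_tensor C C01 \<in> I" using RI by metis
  have "bihom_component C10 C01 1 1 R = theta_tensor C C10 \<star> theta_tensor C C01 +
      theta_tensor C C01 \<star> theta_tensor C C10 - product_relation C 0"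
    unfolding fun_eq_iff bihom_component_apply R plus_fun_apply minus_apply
      theta_mult_theta_apply[OF finite_C subsets(1) subsets(2)]
      theta_mult_theta_apply[OF finite_C subsets(2) subsets(1)] product_relation_apply[OF finite_C]
    using splitting zero by (auto simp: word_bidegree_def split: if_splits)
  then show "theta_tensor C C10 \<star> theta_tensor C C01 + theta_tensor C C01 \<star> theta_tensor C C10
     - product_relation C 0 \<in> I" using RI by metis
qed

text \<open>Expanding \<open>\<Sum>\<^bsub>abc = d\<^esub> e\<^sup>a e\<^sup>b e\<^sup>c\<close> by its first or by its last factor, every term except one
  contains a defining relation; the remaining terms are \<open>e\<^sup>d \<Theta>\<close> and \<open>\<Theta> e\<^sup>d\<close>,
  for \<open>\<Theta> = \<Sum> e\<^sup>a e\<^bsup>a\<inverse>\<^esup>\<close>.\<close>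

lemma product_relation_central:
  assumes "t \<in> tensors C"
  shows "product_relation C 0 \<star> t - t \<star> product_relation C 0 \<in> I"
  using assms
proof (rule tensor_algebra_induct[where P = "\<lambda>t. product_relation C 0 \<star> t - t \<star> product_relation C 0 \<in> I"])
  fix f :: "'g \<Rightarrow> complex"
  have "product_relation C 0 \<star> fun_tensor f = fun_tensor f \<star> product_relation C 0"
    by (auto simp: fun_eq_iff fun_tensor_mult_apply mult_fun_tensor_apply
        product_relation_apply[OF finite_C])
  then show "product_relation C 0 \<star> fun_tensor f - fun_tensor f \<star> product_relation C 0 \<in> I" by simp
next
  fix d assume d: "d \<in> C"
  have first: "(\<Sum>a\<in>C. basis_form a \<star> product_relation C (- a + d)) w x
      = (if \<exists>a\<in>C. \<exists>b\<in>C. \<exists>c\<in>C. w = [a, b, c] \<and> a + b + c = d then 1 else 0)" for w x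
  proof -
    have "(\<Sum>a\<in>C. basis_form a \<star> product_relation C (- a + d)) w x
      = (\<Sum>a\<in>C. if a = hd w then (if w \<noteq> [] then product_relation C (- a + d) (tl w) (x + a) else 0) else 0)"
      unfolding sum_tensor_apply basis_form_mult_apply by (intro sum.cong) auto
    also have "\<dots> = (if hd w \<in> C \<and> w \<noteq> [] then product_relation C (- hd w + d) (tl w) (x + hd w) else 0)"
      using finite_C by (simp add: sum.delta)
    also have "\<dots> = (if \<exists>a\<in>C. \<exists>b\<in>C. \<exists>c\<in>C. w = [a, b, c] \<and> a + b + c = d then 1 else 0)"
    proof -
      have "b + c = - a + d \<longleftrightarrow> a + b + c = d" for a b c :: 'g
        by (metis add.assoc add_minus_cancel minus_add_cancel)
      then show ?thesis
        unfolding product_relation_apply[OF finite_C] by (cases w) auto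
    qed
    finally show ?thesis .
  qed
  have last: "(\<Sum>c\<in>C. product_relation C (d - c) \<star> basis_form c) w x
      = (if \<exists>a\<in>C. \<exists>b\<in>C. \<exists>c\<in>C. w = [a, b, c] \<and> a + b + c = d then 1 else 0)" for w x
  proof -
    have "(\<Sum>c\<in>C. product_relation C (d - c) \<star> basis_form c) w x
      = (\<Sum>c\<in>C. if c = last w then (if w \<noteq> [] then product_relation C (d - c) (butlast w) x else 0) else 0)"
      unfolding sum_tensor_apply mult_basis_form_apply by (intro sum.cong) auto
    also have "\<dots> = (if last w \<in> C \<and> w \<noteq> [] then product_relation C (d - last w) (butlast w) x else 0)"
      using finite_C by (simp add: sum.delta)
    also have "\<dots> = (if \<exists>a\<in>C. \<exists>b\<in>C. \<exists>c\<in>C. w = [a, b, c] \<and> a + b + c = d then 1 else 0)"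
    proof (cases w rule: rev_cases)
      case (snoc v c)
      then show ?thesis
        unfolding product_relation_apply[OF finite_C] eq_diff_eq by auto
    qed auto
    finally show ?thesis .
  qed
  have eq: "(\<Sum>a\<in>C. basis_form a \<star> product_relation C (- a + d))
      = (\<Sum>c\<in>C. product_relation C (d - c) \<star> basis_form c)"
    by (intro ext) (simp only: first last)
  have nz: "- a + d \<noteq> 0" "d - a \<noteq> 0" if "a \<in> C - {d}" for a
    using that by (auto simp: add_eq_0_iff)
  have "product_relation C 0 \<star> basis_form d - basis_form d \<star> product_relation C 0
      = (\<Sum>a\<in>C - {d}. basis_form a \<star> product_relation C (- a + d))
        - (\<Sum>c\<in>C - {d}. product_relation C (d - c) \<star> basis_form c)"
    using eq d finite_C by (simp add: sum.remove[of C d] algebra_simps)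
  moreover have "\<dots> \<in> I"
    using nz product_relations by (auto intro!: ideal_closed(4) ideal_sum)
  ultimately show "product_relation C 0 \<star> basis_form d - basis_form d \<star> product_relation C 0 \<in> I"
    by metis
next
  fix s t let ?P = "product_relation C 0"
  assume st: "s \<in> tensors C" "t \<in> tensors C" "?P \<star> s - s \<star> ?P \<in> I" "?P \<star> t - t \<star> ?P \<in> I"
  have "?P \<star> (s + t) - (s + t) \<star> ?P = (?P \<star> s - s \<star> ?P) + (?P \<star> t - t \<star> ?P)"
    by (simp add: tensor_mult_distrib)
  then show "?P \<star> (s + t) - (s + t) \<star> ?P \<in> I" using st ideal_closed(2) by metis
  have "?P \<star> (s \<star> t) - (s \<star> t) \<star> ?P = (?P \<star> s - s \<star> ?P) \<star> t + s \<star> (?P \<star> t - t \<star> ?P)"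
    using st(1,2) finite_C by (simp add: tensor_mult_distrib tensor_mult_assoc[of _ C])
  moreover have "(?P \<star> s - s \<star> ?P) \<star> t + s \<star> (?P \<star> t - t \<star> ?P) \<in> I"
    using st by blast
  ultimately show "?P \<star> (s \<star> t) - (s \<star> t) \<star> ?P \<in> I" by metis
qed

lemma central_congruent:
  assumes "u \<in> tensors C" "v \<in> tensors C" "u - v \<in> I" "v \<star> t - t \<star> v \<in> I" "t \<in> tensors C"
  shows "u \<star> t - t \<star> u \<in> I"
proof -
  have "u \<star> t - t \<star> u = (u - v) \<star> t - t \<star> (u - v) + (v \<star> t - t \<star> v)"
    by (simp add: tensor_mult_distrib)
  moreover have "\<dots> \<in> I" using assms by blast
  ultimately show ?thesis by metis
qed

lemma commutators_ideal:
  assumes t: "t \<in> tensors C"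
  shows "commutator C10 (commutator C10 t) \<in> I" "commutator C01 (commutator C01 t) \<in> I"
    "commutator C10 (commutator C01 t) + commutator C01 (commutator C10 t) \<in> I"
proof -
  show "commutator C10 (commutator C10 t) \<in> I" "commutator C01 (commutator C01 t) \<in> I"
    unfolding commutator_square[OF subsets(1) t] commutator_square[OF subsets(2) t]
    using theta_products(1,2) t by blast+
  have "theta_tensor C C10 \<in> tensors C" "theta_tensor C C01 \<in> tensors C" using finite_C by auto
  then show "commutator C10 (commutator C01 t) + commutator C01 (commutator C10 t) \<in> I"
    unfolding commutator_anticommutator[OF subsets(1,2) t]
    by (intro central_congruent[OF _ _ theta_products(3) product_relation_central[OF t] t])
      (use finite_C in auto)
qed

lemma theta_split: "theta_tensor C C = theta_tensor C C10 + theta_tensor C C01"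
  using splitting finite_C by (auto simp: fun_eq_iff theta_tensor_apply)

lemma commutator_split: "commutator C t = commutator C10 t + commutator C01 t"
  by (simp add: theta_split tensor_mult_distrib)

lemma commutator_bideg:
  assumes t: "t \<in> tensor_bideg C C10 C01 p q"
  shows "commutator C10 t \<in> tensor_bideg C C10 C01 (Suc p) q"
    "commutator C01 t \<in> tensor_bideg C C10 C01 p (Suc q)"
proof -
  have \<theta>: "theta_tensor C C10 \<in> tensor_bideg C C10 C01 1 0"
    "theta_tensor C C01 \<in> tensor_bideg C C10 C01 0 1"
    using splitting finite_C
    by (auto simp: tensor_bideg_iff theta_tensor_apply word_bidegree_def split: if_splits)
  have g: "grading_involution t \<in> tensor_bideg C C10 C01 p q"
    using t grading_involution_closed[of t C] unfolding tensor_bideg_iff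
    by (auto simp: grading_involution_def)
  show "commutator C10 t \<in> tensor_bideg C C10 C01 (Suc p) q"
    using tensor_bideg_mult[OF \<theta>(1) t] tensor_bideg_mult[OF g \<theta>(1)]
      tensor_bideg_closed(2)[OF _ tensor_bideg_closed(3)] by fastforce
  show "commutator C01 t \<in> tensor_bideg C C10 C01 p (Suc q)"
    using tensor_bideg_mult[OF \<theta>(2) t] tensor_bideg_mult[OF g \<theta>(2)]
      tensor_bideg_closed(2)[OF _ tensor_bideg_closed(3)] by fastforce
qed

lemma commutator_deg:
  assumes B: "B \<subseteq> C" and t: "t \<in> tensor_deg C n"
  shows "commutator B t \<in> tensor_deg C (Suc n)"
proof -
  have g: "grading_involution t \<in> tensor_deg C n"
    using t tensor_deg_closed(3) by (auto simp: grading_involution_deg[OF t])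
  show ?thesis
    using tensor_deg_mult[OF theta_tensor_deg[OF finite_C B] t]
      tensor_deg_mult[OF g theta_tensor_deg[OF finite_C B]]
      tensor_deg_closed(2)[OF _ tensor_deg_closed(3)] by fastforce
qed

lemma fun_tensor_simps:
  "fun_tensor (\<lambda>x. f x + g x) = (fun_tensor f + fun_tensor g :: 'g tensor)"
  "fun_tensor (\<lambda>x. f x * g x) = (fun_tensor f \<star> fun_tensor g :: 'g tensor)"
  by (auto simp: fun_eq_iff fun_tensor_mult_apply) (auto simp: fun_tensor_def)

lemma fun_tensor_bideg: "fun_tensor f \<in> tensor_bideg C C10 C01 0 0"
  by (auto simp: tensor_bideg_iff) (auto simp: fun_tensor_def word_bidegree_def split: if_splits)

lemma tensor_deg_0: "tensor_deg C 0 = range fun_tensor"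
proof
  show "range fun_tensor \<subseteq> tensor_deg C 0"
    using fun_tensor_bideg bideg_subset_deg by fastforce
  show "tensor_deg C 0 \<subseteq> range fun_tensor"
  proof
    fix t assume "t \<in> tensor_deg C 0"
    then have "t = fun_tensor (t [])"
      unfolding tensor_deg_iff fun_tensor_def by (auto simp: fun_eq_iff)
    then show "t \<in> range fun_tensor" by (metis rangeI)
  qed
qed

lemma fun_bij_Q: "bij_betw (ext_fun C S) UNIV (ext_deg C S 0)"
proof -
  have "f = g" if "cls (fun_tensor f) = cls (fun_tensor g)" for f g
  proof -
    have "fun_tensor f - fun_tensor g \<in> I" using that by (simp add: cls_eq_iff)
    from ideal_low_degree[OF this, of "[]"] show ?thesis
      by (auto simp: fun_eq_iff fun_tensor_def)
  qed
  then show ?thesis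
    unfolding bij_betw_def ext_deg_def tensor_deg_0 image_image
    by (auto simp: inj_on_def ext_fun_def)
qed

theorem double_complex: "is_double_complex C C10 C01 S"
proof -
  have rep: "\<exists>t \<in> tensors C. \<xi> = cls t" if "\<xi> \<in> carrier Q" for \<xi>
    using that unfolding carrier_Q by blast
  have deg_sub: "tensor_deg C n \<subseteq> tensors C" "tensor_bideg C C10 C01 p q \<subseteq> tensors C" for n p q
    by (auto simp: tensor_deg_iff tensor_bideg_iff)
  have comm: "D B (cls t) = cls (commutator B t)"
    "commutator B t \<in> tensors C" if "B \<subseteq> C" "t \<in> tensors C" for B t
    using ext_commutator_cls[OF that] commutator_closed[OF that] by auto
  have split: "D C \<xi> = D C10 \<xi> \<oplus>\<^bsub>Q\<^esub> D C01 \<xi>"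
    if "\<xi> \<in> carrier Q" for \<xi>
    using rep[OF that] by (auto simp: comm cls_hom commutator_split[symmetric])
  have squares: "D C10 (D C10 \<xi>) = \<zero>\<^bsub>Q\<^esub>"
      "D C01 (D C01 \<xi>) = \<zero>\<^bsub>Q\<^esub>"
      "D C10 (D C01 \<xi>)
        \<oplus>\<^bsub>Q\<^esub> D C01 (D C10 \<xi>) = \<zero>\<^bsub>Q\<^esub>"
      "D C (D C \<xi>) = \<zero>\<^bsub>Q\<^esub>"
    if \<xi>: "\<xi> \<in> carrier Q" for \<xi>
  proof -
    obtain t where t: "t \<in> tensors C" "\<xi> = cls t" using rep[OF \<xi>] by blast
    note c = commutators_ideal[OF t(1)]
    have e: "D B (D B' \<xi>) = cls (commutator B (commutator B' t))"
      "commutator B (commutator B' t) \<in> tensors C" if B: "B \<subseteq> C" "B' \<subseteq> C" for B B'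
      using comm(1)[OF B(1) comm(2)[OF B(2) t(1)]] comm(2)[OF B(1) comm(2)[OF B(2) t(1)]]
        comm(1)[OF B(2) t(1)] t(2) by simp_all
    show "D C10 (D C10 \<xi>) = \<zero>\<^bsub>Q\<^esub>"
      "D C01 (D C01 \<xi>) = \<zero>\<^bsub>Q\<^esub>"
      using c(1,2) e(2) by (simp_all only: e(1) subsets cls_zero cls_eq_zero_iff)
    show "D C10 (D C01 \<xi>)
        \<oplus>\<^bsub>Q\<^esub> D C01 (D C10 \<xi>) = \<zero>\<^bsub>Q\<^esub>"
      using c(3) by (simp only: e subsets cls_hom cls_zero cls_eq_zero_iff tensors_closed)
    have "commutator C (commutator C t) = commutator C10 (commutator C10 t)
        + (commutator C10 (commutator C01 t) + commutator C01 (commutator C10 t))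
        + commutator C01 (commutator C01 t)"
      by (simp add: theta_split tensor_mult_distrib)
    moreover have "\<dots> \<in> I" using c by blast
    ultimately show "D C (D C \<xi>) = \<zero>\<^bsub>Q\<^esub>"
      using e[OF subsets(3) subsets(3)] by (metis cls_zero cls_eq_zero_iff)
  qed
  have const: "fun_tensor (\<lambda>_. c) \<star> t = t \<star> fun_tensor (\<lambda>_. c)" for c and t :: "'g tensor"
    by (auto simp: fun_eq_iff fun_tensor_mult_apply mult_fun_tensor_apply)
  have bideg_mult: "\<xi> \<otimes>\<^bsub>Q\<^esub> \<eta> \<in> ext_bideg C C10 C01 S (p + r) (q + s)"
    if "\<xi> \<in> ext_bideg C C10 C01 S p q" "\<eta> \<in> ext_bideg C C10 C01 S r s" for \<xi> \<eta> p q r s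
    using that deg_sub tensor_bideg_mult unfolding ext_bideg_def
    by (fastforce simp: cls_hom subset_iff)
  have fun_bideg: "ext_fun C S f \<in> ext_bideg C C10 C01 S 0 0" for f
    unfolding ext_fun_def ext_bideg_def using fun_tensor_bideg by blast
  show ?thesis
  proof (intro double_complex_over_functions.intro dga_over_functions.intro quotient.ring_axioms)
    show "dga_over_functions_axioms Q (ext_fun C S) (ext_deg C S) (D C)"
    proof
      show "ext_fun C S (\<lambda>x. f x + g x) = ext_fun C S f \<oplus>\<^bsub>Q\<^esub> ext_fun C S g" for f g
        by (simp add: ext_fun_def cls_hom fun_tensor_simps)
      show "ext_fun C S (\<lambda>x. f x * g x) = ext_fun C S f \<otimes>\<^bsub>Q\<^esub> ext_fun C S g" for f g
        by (simp add: ext_fun_def cls_hom fun_tensor_simps)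
      show "ext_fun C S (\<lambda>_. 1) = \<one>\<^bsub>Q\<^esub>" by (simp add: ext_fun_def cls_hom)
      show "ext_fun C S (\<lambda>_. c) \<otimes>\<^bsub>Q\<^esub> \<xi> = \<xi> \<otimes>\<^bsub>Q\<^esub> ext_fun C S (\<lambda>_. c)" if "\<xi> \<in> carrier Q" for \<xi> c
        using rep[OF that] by (auto simp: ext_fun_def cls_hom const)
      show "\<xi> \<otimes>\<^bsub>Q\<^esub> \<eta> \<in> ext_deg C S (m + n)" if "\<xi> \<in> ext_deg C S m" "\<eta> \<in> ext_deg C S n" for \<xi> \<eta> m n
        using that deg_sub tensor_deg_mult unfolding ext_deg_def
        by (fastforce simp: cls_hom subset_iff)
      show "D C \<xi> \<in> ext_deg C S (Suc n)" if "\<xi> \<in> ext_deg C S n" for \<xi> n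
        using that deg_sub commutator_deg[OF subsets(3)] unfolding ext_deg_def
        by (fastforce simp: comm subset_iff)
    qed (auto simp: fun_bij_Q grading_Q graded_derivation_commutator squares)
    show "double_complex_over_functions_axioms Q (ext_fun C S) (ext_deg C S) (D C)
       (ext_bideg C C10 C01 S) (D C10) (D C01)"
    proof
      show "ext_fun C S f \<otimes>\<^bsub>Q\<^esub> \<xi> \<in> ext_bideg C C10 C01 S p q"
        "\<xi> \<otimes>\<^bsub>Q\<^esub> ext_fun C S f \<in> ext_bideg C C10 C01 S p q"
        if "\<xi> \<in> ext_bideg C C10 C01 S p q" for f \<xi> p q
        using bideg_mult[OF fun_bideg that] bideg_mult[OF that fun_bideg] by simp_all
      show "\<xi> \<otimes>\<^bsub>Q\<^esub> \<eta> \<in> ext_bideg C C10 C01 S (p + r) (q + s)"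
        if "\<xi> \<in> ext_bideg C C10 C01 S p q" "\<eta> \<in> ext_bideg C C10 C01 S r s" for \<xi> \<eta> p q r s
        by (rule bideg_mult[OF that])
      show "D C10 \<xi> \<in> ext_bideg C C10 C01 S (Suc p) q"
        "D C01 \<xi> \<in> ext_bideg C C10 C01 S p (Suc q)"
        if \<xi>: "\<xi> \<in> ext_bideg C C10 C01 S p q" for \<xi> p q
      proof -
        obtain t where t: "t \<in> tensor_bideg C C10 C01 p q" "\<xi> = cls t"
          using \<xi> unfolding ext_bideg_def by blast
        then have "t \<in> tensors C" using deg_sub by blast
        then show "D C10 \<xi> \<in> ext_bideg C C10 C01 S (Suc p) q"
          "D C01 \<xi> \<in> ext_bideg C C10 C01 S p (Suc q)"
          using commutator_bideg[OF t(1)] t(2) unfolding ext_bideg_def by (simp_all add: comm)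
      qed
    qed (auto simp: bigrading_Q graded_derivation_commutator split squares)
  qed
qed

end


section \<open>The star structure\<close>

abbreviation star_word :: "'g::group_add list \<Rightarrow> 'g list" where
  "star_word w \<equiv> rev (map uminus w)"

text \<open>The involution without the Koszul signs is antimultiplicative on all of the tensor algebra,
  not only on homogeneous elements.\<close>

definition dagger :: "'g::group_add tensor \<Rightarrow> 'g tensor" where
  "dagger t = (\<lambda>w x. cnj (t (star_word w) (x + sum_list w)))"

definition star_sign :: "nat \<Rightarrow> complex" where
  "star_sign n = (-1) ^ (n * (n + 1) div 2)"

lemma tensor_star_dagger: "tensor_star t w x = star_sign (length w) * dagger t w x"
  by (simp add: tensor_star_def star_sign_def dagger_def)

lemma sum_list_star_word: "sum_list (star_word w) = - sum_list (w :: 'g::group_add list)"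
  by (induction w) (simp_all add: minus_add)

lemma star_sign_add: "star_sign (m + n) = star_sign m * star_sign n * (-1) ^ (m * n)"
proof -
  have "(m + n) * (m + n + 1) = m * (m + 1) + n * (n + 1) + 2 * (m * n)"
    by (simp add: algebra_simps)
  moreover have "even (m * (m + 1))" "even (n * (n + 1))" by auto
  ultimately have "(m + n) * (m + n + 1) div 2 = m * (m + 1) div 2 + n * (n + 1) div 2 + m * n"
    by (metis div_plus_div_distrib_dvd_left dvd_add nonzero_mult_div_cancel_left dvd_triv_left zero_neq_numeral)
  then show ?thesis by (simp add: star_sign_def power_add)
qed

lemma star_sign_square [simp]: "star_sign n * star_sign n = 1" "star_sign n * (star_sign n * z) = z"
  "cnj (star_sign n) = star_sign n"
  by (auto simp: star_sign_def simp flip: power_add mult_2 mult.assoc)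

lemma dagger_mult:
  fixes s t :: "'g::group_add tensor"
  shows "dagger (s \<star> t) = dagger t \<star> dagger s"
proof (intro ext)
  fix w :: "'g list" and x
  let ?n = "length w" and ?y = "x + sum_list w"
  have "dagger (s \<star> t) w x = (\<Sum>k\<le>?n. cnj (s (take k (star_word w)) ?y)
      * cnj (t (drop k (star_word w)) (?y + sum_list (take k (star_word w)))))"
    by (simp add: dagger_def tensor_mult_def)
  also have "\<dots> = (\<Sum>k\<le>?n. cnj (s (take (?n - k) (star_word w)) ?y)
      * cnj (t (drop (?n - k) (star_word w)) (?y + sum_list (take (?n - k) (star_word w)))))"
    by (rule sum.reindex_bij_witness[of _ "\<lambda>k. ?n - k" "\<lambda>k. ?n - k"]) auto
  also have "\<dots> = (\<Sum>k\<le>?n. dagger t (take k w) x * dagger s (drop k w) (x + sum_list (take k w)))"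
  proof (rule sum.cong)
    fix k assume k: "k \<in> {..?n}"
    have tk: "take (?n - k) (star_word w) = star_word (drop k w)"
      "drop (?n - k) (star_word w) = star_word (take k w)"
      using k by (simp_all add: take_rev drop_rev drop_map take_map)
    have sw: "sum_list w = sum_list (take k w) + sum_list (drop k w)"
      by (metis append_take_drop_id sum_list_append)
    show "cnj (s (take (?n - k) (star_word w)) ?y)
        * cnj (t (drop (?n - k) (star_word w)) (?y + sum_list (take (?n - k) (star_word w))))
      = dagger t (take k w) x * dagger s (drop k w) (x + sum_list (take k w))"
      unfolding tk sum_list_star_word dagger_def sw by (simp flip: add.assoc)
  qed simp
  finally show "dagger (s \<star> t) w x = (dagger t \<star> dagger s) w x" by (simp add: tensor_mult_def)
qed

lemma dagger_simps:
  "dagger (s + t) = dagger s + dagger t" "dagger (- t) = - dagger t" "dagger 0 = 0"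
  by (auto simp: dagger_def fun_eq_iff)

lemma tensor_star_simps:
  "tensor_star (s + t) = tensor_star s + tensor_star t"
  "tensor_star (s - t) = tensor_star s - tensor_star t"
  "tensor_star (- t) = - tensor_star t" "tensor_star 0 = 0"
  by (auto simp: tensor_star_def fun_eq_iff algebra_simps)

lemma tensor_star_star: "tensor_star (tensor_star t) = (t :: 'g::group_add tensor)"
proof (intro ext)
  fix w :: "'g list" and x
  have "star_word (star_word w) = w" by (simp add: rev_map)
  then show "tensor_star (tensor_star t) w x = t w x"
    by (simp add: tensor_star_dagger dagger_def sum_list_star_word add.assoc)
qed

lemma tensor_star_grading_involution:
  "tensor_star (grading_involution t) = grading_involution (tensor_star t)"
  by (simp add: fun_eq_iff tensor_star_def grading_involution_def)

text \<open>Moving a homogeneous factor past the other one produces the Koszul sign.\<close>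

lemma star_sign_split:
  assumes "k \<le> n"
  shows "star_sign n = star_sign k * star_sign (n - k) * (-1) ^ (k * (n - k))"
  using star_sign_add[of k "n - k"] assms by simp

lemma tensor_star_mult:
  fixes s t :: "'g::group_add tensor"
  assumes s: "s \<in> tensor_deg C m"
  shows "tensor_star (s \<star> t) = tensor_star (if even m then t else grading_involution t) \<star> tensor_star s"
    and "tensor_star (t \<star> s) = tensor_star s \<star> tensor_star (if even m then t else grading_involution t)"
proof -
  have deg: "dagger s v y = 0 \<or> length v = m" for v y
    using s unfolding dagger_def tensor_deg_iff by (metis length_map length_rev complex_cnj_zero)
  have twist: "dagger (if even m then t else grading_involution t) v y = (-1) ^ (m * length v) * dagger t v y" for v y
    by (auto simp: dagger_def grading_involution_def power_mult uminus_power_if)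
  show "tensor_star (s \<star> t) = tensor_star (if even m then t else grading_involution t) \<star> tensor_star s"
  proof (intro ext)
    fix w :: "'g list" and x
    show "tensor_star (s \<star> t) w x = (tensor_star (if even m then t else grading_involution t) \<star> tensor_star s) w x"
      unfolding tensor_star_dagger dagger_mult twist unfolding tensor_mult_def sum_distrib_left
    proof (rule sum.cong)
      fix k assume "k \<in> {..length w}"
      then have k: "k \<le> length w" by simp
      show "star_sign (length w) * (dagger t (take k w) x * dagger s (drop k w) (x + sum_list (take k w)))
        = star_sign (length (take k w)) * ((- 1) ^ (m * length (take k w)) * dagger t (take k w) x)
          * (star_sign (length (drop k w)) * dagger s (drop k w) (x + sum_list (take k w)))"
        using deg[of "drop k w" "x + sum_list (take k w)"] k
        by (auto simp: star_sign_split[OF k] min.absorb2 mult.commute[of m])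
    qed simp
  qed
  show "tensor_star (t \<star> s) = tensor_star s \<star> tensor_star (if even m then t else grading_involution t)"
  proof (intro ext)
    fix w :: "'g list" and x
    show "tensor_star (t \<star> s) w x = (tensor_star s \<star> tensor_star (if even m then t else grading_involution t)) w x"
      unfolding tensor_star_dagger dagger_mult twist unfolding tensor_mult_def sum_distrib_left
    proof (rule sum.cong)
      fix k assume "k \<in> {..length w}"
      then have k: "k \<le> length w" by simp
      show "star_sign (length w) * (dagger s (take k w) x * dagger t (drop k w) (x + sum_list (take k w)))
        = star_sign (length (take k w)) * dagger s (take k w) x
          * (star_sign (length (drop k w)) * ((- 1) ^ (m * length (drop k w)) * dagger t (drop k w) (x + sum_list (take k w))))"
        using deg[of "take k w" x] k
        by (auto simp: star_sign_split[OF k] min.absorb2)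
    qed simp
  qed
qed

lemma tensor_star_mult_deg:
  assumes s: "s \<in> tensor_deg C m" and t: "t \<in> tensor_deg C n"
  shows "tensor_star (s \<star> t) =
    (if even (m * n) then tensor_star t \<star> tensor_star s else - (tensor_star t \<star> tensor_star s))"
  using tensor_star_mult(1)[OF s, of t] grading_involution_deg[OF t]
  by (auto simp: tensor_star_simps tensor_mult_distrib)

lemma word_bidegree_star_word:
  fixes w :: "'g::group_add list"
  assumes "\<And>a. - a \<in> C10 \<longleftrightarrow> a \<in> C01" "\<And>a. - a \<in> C01 \<longleftrightarrow> a \<in> C10"
  shows "word_bidegree C10 C01 (star_word w) =
    (snd (word_bidegree C10 C01 w), fst (word_bidegree C10 C01 w))"
  by (simp add: word_bidegree_def assms filter_map o_def flip: rev_filter)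

text \<open>On a homogeneous relation \<^const>\<open>dagger\<close> and \<^const>\<open>tensor_star\<close> agree up to sign, so this is
  stability of the ideal under the star.\<close>

locale dolbeault_relations = bihomogeneous_relations +
  assumes dagger_relations: "t \<in> S \<Longrightarrow> dagger t \<in> rel_ideal C S"
begin

lemma inverse_iff: "- a \<in> C10 \<longleftrightarrow> a \<in> C01" "- a \<in> C01 \<longleftrightarrow> a \<in> C10"
  using inverse(1)[of "- a"] inverse(2)[of "- a"] inverse(1)[of a] inverse(2)[of a] by auto

lemma dagger_closed [simp, intro]:
  assumes t: "t \<in> tensors C"
  shows "dagger t \<in> tensors C"
proof -
  have invol: "w = star_word (star_word w)" for w :: "'a list" by (simp add: rev_map)
  have nz: "t (star_word w) \<noteq> (\<lambda>_. 0)" if "dagger t w \<noteq> (\<lambda>_. 0)" for w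
    using that by (auto simp: dagger_def fun_eq_iff)
  have "w \<in> star_word ` {w. t w \<noteq> (\<lambda>_. 0)}" if "dagger t w \<noteq> (\<lambda>_. 0)" for w
    by (rule image_eqI[of _ _ "star_word w"]) (rule invol, rule CollectI, rule nz[OF that])
  then have "{w. dagger t w \<noteq> (\<lambda>_. 0)} \<subseteq> star_word ` {w. t w \<noteq> (\<lambda>_. 0)}" by blast
  then have "finite {w. dagger t w \<noteq> (\<lambda>_. 0)}"
    using t finite_surj unfolding tensors_iff by blast
  moreover have "set w \<subseteq> C" if "dagger t w x \<noteq> 0" for w x
  proof -
    have "t (star_word w) (x + sum_list w) \<noteq> 0" using that by (simp add: dagger_def)
    then have "set (star_word w) \<subseteq> C" using t unfolding tensors_iff by blast
    then have "- a \<in> C10 \<union> C01" if "a \<in> set w" for a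
      using that unfolding splitting(1) by auto
    then show ?thesis unfolding splitting(1) by (metis Un_iff inverse_iff subsetI)
  qed
  ultimately show ?thesis unfolding tensors_iff by blast
qed

lemma tensor_star_closed [simp, intro]: "t \<in> tensors C \<Longrightarrow> tensor_star t \<in> tensors C"
  by (rule tensors_support_mono[OF dagger_closed]) (auto simp: tensor_star_dagger)

lemma tensor_star_ideal:
  assumes "t \<in> I"
  shows "tensor_star t \<in> I"
proof -
  have "dagger t \<in> I"
    using assms
    by (rule ideal_induct[where P = "\<lambda>t. dagger t \<in> I"])
      (auto simp: dagger_relations dagger_simps dagger_mult)
  \<comment> \<open>The signs are constant on the homogeneous components, which lie in the ideal.\<close>
  let ?c = "\<lambda>n. deg_component n (dagger t)"
  let ?N = "{n. ?c n \<noteq> 0}"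
  have dt: "dagger t \<in> tensors C" using \<open>dagger t \<in> I\<close> ideal_subset by blast
  have N: "finite ?N" by (rule sum_deg_components[OF dt])
  have sgn: "star_sign n = (if even (n * (n + 1) div 2) then 1 else - 1)" for n
    by (simp add: star_sign_def uminus_power_if)
  have "tensor_star t w x = (\<Sum>n\<in>?N. if even (n * (n + 1) div 2) then ?c n else - ?c n) w x" for w x
  proof -
    have "(\<Sum>n\<in>?N. if even (n * (n + 1) div 2) then ?c n else - ?c n) w x
        = (\<Sum>n\<in>?N. star_sign n * ?c n w x)"
      unfolding sum_tensor_apply sgn by (intro sum.cong) auto
    also have "\<dots> = (\<Sum>n\<in>?N. star_sign (length w) * ?c n w x)"
      by (intro sum.cong) (auto simp: deg_component_apply[OF dt])
    also have "\<dots> = star_sign (length w) * (\<Sum>n\<in>?N. ?c n) w x"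
      by (simp add: sum_distrib_left sum_tensor_apply)
    also have "\<dots> = tensor_star t w x"
      by (simp only: sum_deg_components(2)[OF dt, symmetric] tensor_star_dagger)
    finally show ?thesis by simp
  qed
  then have "tensor_star t = (\<Sum>n\<in>?N. if even (n * (n + 1) div 2) then ?c n else - ?c n)"
    by (intro ext)
  also have "\<dots> \<in> I" using deg_component_ideal[OF \<open>dagger t \<in> I\<close>] by auto
  finally show ?thesis .
qed

lemma ext_star_cls: "t \<in> tensors C \<Longrightarrow> ext_star C S (cls t) = cls (tensor_star t)"
  unfolding ext_star_def by (rule ext_induced_cls) (auto simp: tensor_star_simps tensor_star_ideal)

lemma tensor_star_theta:
  assumes "B \<subseteq> C"
  shows "tensor_star (theta_tensor C B) = - theta_tensor C (uminus ` B)"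
proof -
  have B: "uminus ` B \<subseteq> C" using assms inverse splitting(1) by auto
  have "(\<exists>b\<in>B. star_word w = [b]) \<longleftrightarrow> (\<exists>b\<in>uminus ` B. w = [b])" for w :: "'a list"
    by (cases w rule: rev_cases) (auto intro: image_eqI[of _ uminus "- _"])
  then show ?thesis
    unfolding fun_eq_iff
    by (auto simp: tensor_star_def theta_tensor_apply[OF finite_C assms] theta_tensor_apply[OF finite_C B])
qed

lemma tensor_star_commutator:
  assumes B: "B \<subseteq> C"
  shows "tensor_star (commutator B t) = commutator (uminus ` B) (tensor_star t)"
  using tensor_star_mult[OF theta_tensor_deg[OF finite_C B]] tensor_star_theta[OF B]
  by (simp add: tensor_star_simps tensor_star_grading_involution tensor_mult_distrib)

lemma tensor_star_deg: "t \<in> tensor_deg C n \<Longrightarrow> tensor_star t \<in> tensor_deg C n"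
proof -
  assume t: "t \<in> tensor_deg C n"
  then have "tensor_star t \<in> tensors C" by (auto simp: tensor_deg_iff)
  moreover have "length w = n" if "tensor_star t w x \<noteq> 0" for w x
  proof -
    have "t (star_word w) (x + sum_list w) \<noteq> 0" using that by (auto simp: tensor_star_def)
    then have "length (star_word w) = n" using t unfolding tensor_deg_iff by blast
    then show ?thesis by simp
  qed
  ultimately show ?thesis unfolding tensor_deg_iff by blast
qed

lemma tensor_star_bideg:
  "t \<in> tensor_bideg C C10 C01 p q \<Longrightarrow> tensor_star t \<in> tensor_bideg C C10 C01 q p"
proof -
  assume t: "t \<in> tensor_bideg C C10 C01 p q"
  then have "tensor_star t \<in> tensors C" by (auto simp: tensor_bideg_iff)
  moreover have "word_bidegree C10 C01 w = (q, p)" if "tensor_star t w x \<noteq> 0" for w x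
  proof -
    have "t (star_word w) (x + sum_list w) \<noteq> 0" using that by (auto simp: tensor_star_def)
    then have "word_bidegree C10 C01 (star_word w) = (p, q)"
      using t unfolding tensor_bideg_iff by blast
    then show ?thesis
      using word_bidegree_star_word[OF inverse_iff, of w] by (simp add: prod_eq_iff)
  qed
  ultimately show ?thesis unfolding tensor_bideg_iff by blast
qed

theorem dolbeault_complex: "is_dolbeault_complex C C10 C01 S"
proof -
  have rep: "\<exists>t \<in> tensors C. \<xi> = cls t" if "\<xi> \<in> carrier Q" for \<xi>
    using that unfolding carrier_Q by blast
  have deg_sub: "tensor_deg C n \<subseteq> tensors C" "tensor_bideg C C10 C01 p q \<subseteq> tensors C" for n p q
    by (auto simp: tensor_deg_iff tensor_bideg_iff)
  have "uminus ` C10 = C01" using inverse by (auto intro: image_eqI[of _ uminus "- _"])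
  moreover have "uminus ` C = C" using inverse splitting(1) by (auto intro: image_eqI[of _ uminus "- _"])
  ultimately have st: "tensor_star (commutator C t) = commutator C (tensor_star t)"
    "tensor_star (commutator C10 t) = commutator C01 (tensor_star t)" for t
    using tensor_star_commutator[OF subsets(3), of t] tensor_star_commutator[OF subsets(1), of t]
    by simp_all
  have d: "ext_star C S (D C \<xi>) = D C (ext_star C S \<xi>)"
      "ext_star C S (D C10 \<xi>) = D C01 (ext_star C S \<xi>)"
    if \<xi>: "\<xi> \<in> carrier Q" for \<xi>
  proof -
    obtain t where t: "t \<in> tensors C" "\<xi> = cls t" using rep[OF \<xi>] by blast
    show "ext_star C S (D C \<xi>) = D C (ext_star C S \<xi>)"
      "ext_star C S (D C10 \<xi>) = D C01 (ext_star C S \<xi>)"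
      unfolding t(2) using t(1)
      by (simp_all only: ext_commutator_cls ext_star_cls subsets commutator_closed tensor_star_closed st)
  qed
  have bideg: "ext_star C S ` ext_bideg C C10 C01 S p q \<subseteq> ext_bideg C C10 C01 S q p" for p q
    unfolding ext_bideg_def using tensor_star_bideg[of _ p q] deg_sub(2)[of p q]
    by (auto simp: ext_star_cls subset_iff)
  have star_star: "ext_star C S (ext_star C S \<xi>) = \<xi>" if "\<xi> \<in> carrier Q" for \<xi>
    using rep[OF that] by (auto simp: ext_star_cls tensor_star_star)
  show ?thesis
  proof (intro dolbeault_complex_over_functions.intro double_complex)
    show "dolbeault_complex_over_functions_axioms Q (ext_fun C S) (ext_deg C S) (D C)
       (ext_bideg C C10 C01 S) (D C10) (D C01) (ext_star C S)"
    proof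
      show "ext_star C S \<xi> \<in> carrier Q" if "\<xi> \<in> carrier Q" for \<xi>
        using rep[OF that] by (auto simp: ext_star_cls)
      show "ext_star C S (\<xi> \<oplus>\<^bsub>Q\<^esub> \<eta>) = ext_star C S \<xi> \<oplus>\<^bsub>Q\<^esub> ext_star C S \<eta>"
        if "\<xi> \<in> carrier Q" "\<eta> \<in> carrier Q" for \<xi> \<eta>
        using rep[OF that(1)] rep[OF that(2)] by (auto simp: ext_star_cls cls_hom tensor_star_simps)
      show "ext_star C S (ext_fun C S f) = ext_fun C S (\<lambda>x. cnj (f x))" for f
        by (simp add: ext_fun_def ext_star_cls tensor_star_fun)
      show "ext_star C S \<xi> \<in> ext_deg C S n" if "\<xi> \<in> ext_deg C S n" for \<xi> n
        using that deg_sub(1)[of n] tensor_star_deg unfolding ext_deg_def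
        by (auto simp: ext_star_cls subset_iff)
      show "ext_star C S (\<xi> \<otimes>\<^bsub>Q\<^esub> \<eta>) = koszul Q (m * n) (ext_star C S \<eta> \<otimes>\<^bsub>Q\<^esub> ext_star C S \<xi>)"
        if xy: "\<xi> \<in> ext_deg C S m" "\<eta> \<in> ext_deg C S n" for \<xi> \<eta> m n
      proof -
        obtain s t where st: "s \<in> tensor_deg C m" "\<xi> = cls s" "t \<in> tensor_deg C n" "\<eta> = cls t"
          using xy unfolding ext_deg_def by blast
        then have "s \<in> tensors C" "t \<in> tensors C" using deg_sub by blast+
        then show ?thesis
          using st(2,4) tensor_star_mult_deg[OF st(1,3)]
          by (simp add: ext_star_cls cls_hom koszul_cls)
      qed
      show "ext_star C S ` ext_bideg C C10 C01 S p q = ext_bideg C C10 C01 S q p" for p q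
      proof
        show "ext_bideg C C10 C01 S q p \<subseteq> ext_star C S ` ext_bideg C C10 C01 S p q"
        proof
          fix \<xi> assume \<xi>: "\<xi> \<in> ext_bideg C C10 C01 S q p"
          then have "\<xi> \<in> carrier Q" unfolding ext_bideg_def carrier_Q using deg_sub by blast
          moreover have "ext_star C S \<xi> \<in> ext_bideg C C10 C01 S p q" using bideg \<xi> by blast
          ultimately show "\<xi> \<in> ext_star C S ` ext_bideg C C10 C01 S p q"
            using star_star by (metis imageI)
        qed
      qed (rule bideg)
    qed (simp_all add: d star_star)
  qed
qed

end


section \<open>Tensor products with a free factor\<close>

text \<open>If \<open>N\<close> has a finite basis \<open>n\<close> over \<open>A\<close>, then modulo the tensor relations every element of
  \<open>M \<otimes>\<^sub>A N\<close> is \<open>\<Sum>\<^sub>b x\<^sub>b \<otimes> n\<^sub>b\<close> with \<open>x\<^sub>b \<in> M\<close>.  The product is therefore injective as soon as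
  \<open>\<Sum>\<^sub>b x\<^sub>b n\<^sub>b = 0\<close> forces \<open>x = 0\<close>.\<close>

lemma product_bimodule_iso_of_basis:
  fixes R (structure)
  assumes R: "ring R"
    and M: "additive_subgroup M R" and N: "additive_subgroup N R" and A: "A \<subseteq> carrier R"
    and bimodules: "\<And>f x. f \<in> A \<Longrightarrow> x \<in> M \<Longrightarrow> f \<otimes> x \<in> M" "\<And>f x. f \<in> A \<Longrightarrow> x \<in> M \<Longrightarrow> x \<otimes> f \<in> M"
      "\<And>f y. f \<in> A \<Longrightarrow> y \<in> N \<Longrightarrow> f \<otimes> y \<in> N" "\<And>f y. f \<in> A \<Longrightarrow> y \<in> N \<Longrightarrow> y \<otimes> f \<in> N"
    and B: "finite B" "\<And>b. b \<in> B \<Longrightarrow> n b \<in> N"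
    and generate_N: "\<And>y. y \<in> N \<Longrightarrow> \<exists>g \<in> B \<rightarrow> A. y = (\<Oplus>b\<in>B. g b \<otimes> n b)"
    and independent: "\<And>x. x \<in> B \<rightarrow> M \<Longrightarrow> (\<Oplus>b\<in>B. x b \<otimes> n b) = \<zero> \<Longrightarrow> \<forall>b\<in>B. x b = \<zero>"
    and P: "P = {(\<Oplus>b\<in>B. x b \<otimes> n b) | x. x \<in> B \<rightarrow> M}"
  shows "product_bimodule_iso R A M N P"
proof -
  interpret R: ring R by (rule R)
  interpret M: additive_subgroup M R by (rule M)
  interpret N: additive_subgroup N R by (rule N)
  let ?F = "free_Abelian_group (M \<times> N)" and ?rel = "tensor_relations R A M N"
  let ?K = "tensor_kernel R A M N"
  interpret F: comm_group ?F by (rule abelian_free_Abelian_group)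
  have MR: "x \<in> carrier R" if "x \<in> M" for x using that M.a_Hcarr by blast
  have NR: "x \<in> carrier R" if "x \<in> N" for x using that N.a_Hcarr by blast
  have AR: "x \<in> carrier R" if "x \<in> A" for x using that A by blast
  have frag: "frag_of (x, y) \<in> carrier ?F" if "x \<in> M" "y \<in> N" for x y
    using that by (simp del: carrier_free_Abelian_group_iff)
  have F_add: "a + b \<in> carrier ?F" "a - b \<in> carrier ?F" if "a \<in> carrier ?F" "b \<in> carrier ?F" for a b
    using F.m_closed[OF that] F.m_closed[OF that(1) F.inv_closed[OF that(2)]] that by auto
  have rel: "?rel \<subseteq> carrier ?F"
  proof
    fix z assume "z \<in> ?rel"
    then show "z \<in> carrier ?F"
      unfolding tensor_relations_def by (auto intro!: F_add frag bimodules(2,3) simp del: carrier_free_Abelian_group_iff)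
  qed
  have K: "subgroup ?K ?F" unfolding tensor_kernel_def by (rule F.generate_is_subgroup[OF rel])
  have KF: "z \<in> carrier ?F" if "z \<in> ?K" for z using subgroup.mem_carrier[OF K that] .
  have K_zero: "0 \<in> ?K" using subgroup.one_closed[OF K] by simp
  have K_add: "a + b \<in> ?K" if "a \<in> ?K" "b \<in> ?K" for a b
    using subgroup.m_closed[OF K that] by simp
  have K_uminus: "- a \<in> ?K" if "a \<in> ?K" for a
    using subgroup.m_inv_closed[OF K that] KF[OF that] by simp
  have K_diff: "a - b \<in> ?K" if "a \<in> ?K" "b \<in> ?K" for a b
    using K_add[OF that(1) K_uminus[OF that(2)]] by simp
  have K_rel: "z \<in> ?K" if "z \<in> ?rel" for z
    unfolding tensor_kernel_def using that by (rule generate.incl)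
  have K_left: "frag_of (x \<oplus> x', y) - frag_of (x, y) - frag_of (x', y) \<in> ?K"
    if "x \<in> M" "x' \<in> M" "y \<in> N" for x x' y
    using that by (intro K_rel) (auto simp: tensor_relations_def)
  have K_right: "frag_of (x, y \<oplus> y') - frag_of (x, y) - frag_of (x, y') \<in> ?K"
    if "x \<in> M" "y \<in> N" "y' \<in> N" for x y y'
    using that by (intro K_rel) (auto simp: tensor_relations_def)
  have K_balanced: "frag_of (x \<otimes> f, y) - frag_of (x, f \<otimes> y) \<in> ?K"
    if "x \<in> M" "f \<in> A" "y \<in> N" for x f y
    using that by (intro K_rel) (auto simp: tensor_relations_def)
  have K_left_zero: "frag_of (\<zero>, y) \<in> ?K" if "y \<in> N" for y
    using K_uminus[OF K_left[OF M.zero_closed M.zero_closed that]] by simp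
  have K_right_zero: "frag_of (x, \<zero>) \<in> ?K" if "x \<in> M" for x
    using K_uminus[OF K_right[OF that N.zero_closed N.zero_closed]] by simp
  have "(\<lambda>(x, y). x \<otimes> y) ` (M \<times> N) \<subseteq> carrier (add_monoid R)"
    using MR NR by auto
  then obtain \<Phi> where \<Phi>: "\<Phi> \<in> hom ?F (add_monoid R)"
      and \<Phi>_frag: "\<And>x y. x \<in> M \<Longrightarrow> y \<in> N \<Longrightarrow> \<Phi> (frag_of (x, y)) = x \<otimes> y"
    using comm_group.free_Abelian_group_universal[OF R.a_comm_group, of "\<lambda>(x, y). x \<otimes> y" "M \<times> N"]
    by (metis SigmaI case_prod_conv)
  interpret \<Phi>: group_hom ?F "add_monoid R" \<Phi>
    by (intro group_hom.intro group_hom_axioms.intro \<Phi> R.a_group F.group_axioms)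
  have \<Phi>_closed: "\<Phi> a \<in> carrier R" if "a \<in> carrier ?F" for a
    using \<Phi>.hom_closed[OF that] by simp
  have \<Phi>_add: "\<Phi> (a + b) = \<Phi> a \<oplus> \<Phi> b" if "a \<in> carrier ?F" "b \<in> carrier ?F" for a b
    using \<Phi>.hom_mult[OF that] by simp
  have \<Phi>_zero: "\<Phi> 0 = \<zero>" using \<Phi>.hom_one by simp
  have \<Phi>_diff: "\<Phi> (a - b) = \<Phi> a \<ominus> \<Phi> b" if "a \<in> carrier ?F" "b \<in> carrier ?F" for a b
    using \<Phi>.hom_mult[OF that(1) F.inv_closed[OF that(2)]] \<Phi>.hom_inv[OF that(2)] that
    by (simp add: a_minus_def a_inv_def)
  have cancel: "p \<oplus> q \<ominus> p \<ominus> q = \<zero>" if "p \<in> carrier R" "q \<in> carrier R" for p q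
    using that by (simp add: R.minus_eq R.a_comm[of p q] R.a_assoc R.r_neg)
  have minus_zero: "p \<ominus> p = \<zero>" if "p \<in> carrier R" for p
    using that by (simp add: R.minus_eq R.r_neg)
  have minus_cancel: "p = q" if "p \<in> carrier R" "q \<in> carrier R" "p \<ominus> q = \<zero>" for p q
    using that R.a_assoc[of p "\<ominus> q" q] by (simp add: R.minus_eq R.l_neg)
  have "?rel \<subseteq> kernel ?F (add_monoid R) \<Phi>"
  proof
    fix z assume z: "z \<in> ?rel"
    have "\<Phi> z = \<zero>"
      using z unfolding tensor_relations_def
      by (auto simp: \<Phi>_diff \<Phi>_frag frag F_add bimodules MR NR AR R.l_distr R.r_distr R.m_assoc
          cancel minus_zero simp del: carrier_free_Abelian_group_iff)
    then show "z \<in> kernel ?F (add_monoid R) \<Phi>"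
      using subsetD[OF rel z] unfolding kernel_def by simp
  qed
  then have K_kernel: "?K \<subseteq> kernel ?F (add_monoid R) \<Phi>"
    unfolding tensor_kernel_def by (rule F.generate_subgroup_incl[OF _ \<Phi>.subgroup_kernel])
  have sum_F: "(\<Sum>b\<in>B'. frag_of (x b, n b)) \<in> carrier ?F \<and>
      \<Phi> (\<Sum>b\<in>B'. frag_of (x b, n b)) = (\<Oplus>b\<in>B'. x b \<otimes> n b)"
    if "B' \<subseteq> B" "x \<in> B \<rightarrow> M" for B' x
    using finite_subset[OF that(1) B(1)] that(1)
  proof (induction B' rule: finite_induct)
    case (insert b B')
    then have b: "x b \<in> M" "n b \<in> N" and B': "B' \<subseteq> B" using that(2) B(2) by auto
    have "(\<Oplus>b\<in>insert b B'. x b \<otimes> n b) = x b \<otimes> n b \<oplus> (\<Oplus>b\<in>B'. x b \<otimes> n b)"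
    proof (rule R.finsum_insert[OF insert.hyps])
      show "(\<lambda>b. x b \<otimes> n b) \<in> B' \<rightarrow> carrier R"
      proof
        fix c assume "c \<in> B'"
        then have "x c \<in> M" "n c \<in> N" using B' that(2) B(2) by auto
        then show "x c \<otimes> n c \<in> carrier R" by (intro R.m_closed MR NR)
      qed
      show "x b \<otimes> n b \<in> carrier R" using b MR NR by blast
    qed
    then show ?case
      using insert.IH[OF B'] insert.hyps frag[OF b] \<Phi>_frag[OF b] \<Phi>_add F_add
      by (simp del: carrier_free_Abelian_group_iff)
  qed (simp_all add: \<Phi>_zero)
  \<comment> \<open>A pure tensor is brought to normal form by expanding its right factor in the basis and moving
    the coefficients to the left factor.\<close>
  have expand: "frag_of (x, \<Oplus>b\<in>B'. g b \<otimes> n b) - (\<Sum>b\<in>B'. frag_of (x \<otimes> g b, n b)) \<in> ?K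
      \<and> (\<Oplus>b\<in>B'. g b \<otimes> n b) \<in> N"
    if x: "x \<in> M" and "B' \<subseteq> B" and g: "g \<in> B \<rightarrow> A" for x g B'
    using finite_subset[OF that(2) B(1)] that(2)
  proof (induction B' rule: finite_induct)
    case (insert b B')
    let ?s = "\<Oplus>b\<in>B'. g b \<otimes> n b" and ?t = "\<Sum>b\<in>B'. frag_of (x \<otimes> g b, n b)"
    have b: "g b \<in> A" "n b \<in> N" "g b \<otimes> n b \<in> N" using insert.prems g B(2) bimodules(3) by auto
    have s: "?s \<in> N" "frag_of (x, ?s) - ?t \<in> ?K" using insert by auto
    have eq: "(\<Oplus>b\<in>insert b B'. g b \<otimes> n b) = g b \<otimes> n b \<oplus> ?s"
    proof (rule R.finsum_insert[OF insert.hyps])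
      show "(\<lambda>b. g b \<otimes> n b) \<in> B' \<rightarrow> carrier R"
        using insert.prems g B(2) bimodules(3) NR by (auto simp: Pi_iff subset_iff)
    qed (use b NR in auto)
    have "frag_of (x, g b \<otimes> n b \<oplus> ?s) - (frag_of (x \<otimes> g b, n b) + ?t)
        = (frag_of (x, g b \<otimes> n b \<oplus> ?s) - frag_of (x, g b \<otimes> n b) - frag_of (x, ?s))
          - (frag_of (x \<otimes> g b, n b) - frag_of (x, g b \<otimes> n b)) + (frag_of (x, ?s) - ?t)"
      by simp
    also have "\<dots> \<in> ?K"
      by (intro K_add K_diff K_right K_balanced x b s)
    finally show ?case using eq insert.hyps N.a_closed[OF b(3) s(1)] by simp
  qed (use K_right_zero[OF x] N.zero_closed in auto)
  have normal_form: "\<exists>x \<in> B \<rightarrow> M. z - (\<Sum>b\<in>B. frag_of (x b, n b)) \<in> ?K" if "z \<in> carrier ?F" for z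
    using that unfolding carrier_free_Abelian_group_iff
  proof (induction z rule: frag_induction)
    case zero
    have "(\<Sum>b\<in>B'. frag_of (\<zero>, n b)) \<in> ?K" if "B' \<subseteq> B" for B'
      using finite_subset[OF that B(1)] that
      by (induction B' rule: finite_induct) (auto intro: K_zero K_add K_left_zero B(2))
    then have "0 - (\<Sum>b\<in>B. frag_of (\<zero>, n b)) \<in> ?K" using K_diff[OF K_zero] by blast
    then show ?case using M.zero_closed by (intro bexI[of _ "\<lambda>_. \<zero>"]) auto
  next
    case (one p)
    then obtain x y where p: "p = (x, y)" "x \<in> M" "y \<in> N" by blast
    then obtain g where g: "g \<in> B \<rightarrow> A" "y = (\<Oplus>b\<in>B. g b \<otimes> n b)" using generate_N by blast
    then show ?case
      using expand[OF p(2) subset_refl g(1)] bimodules(2) p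
      by (intro bexI[of _ "\<lambda>b. x \<otimes> g b"]) auto
  next
    case (diff a c)
    then obtain x y where x: "x \<in> B \<rightarrow> M" "a - (\<Sum>b\<in>B. frag_of (x b, n b)) \<in> ?K"
      and y: "y \<in> B \<rightarrow> M" "c - (\<Sum>b\<in>B. frag_of (y b, n b)) \<in> ?K" by blast
    let ?d = "\<lambda>b. x b \<ominus> y b"
    have dM: "?d b \<in> M" if "b \<in> B" for b
      using that x(1) y(1) unfolding a_minus_def by (intro M.a_closed M.a_inv_closed) auto
    have rels: "(\<Sum>b\<in>B'. frag_of (x b, n b) - frag_of (?d b, n b) - frag_of (y b, n b)) \<in> ?K"
      if "B' \<subseteq> B" for B'
      using finite_subset[OF that B(1)] that
    proof (induction B' rule: finite_induct)
      case (insert b B')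
      then have b: "x b \<in> M" "y b \<in> M" "?d b \<in> M" "n b \<in> N" using x(1) y(1) dM B(2) by auto
      have "?d b \<oplus> y b = x b" using b MR by (simp add: a_minus_def R.a_assoc R.l_neg)
      then show ?case
        using insert K_add[OF K_left[OF b(3,2,4)]] by simp
    qed (simp add: K_zero)
    have "a - c - (\<Sum>b\<in>B. frag_of (?d b, n b))
        = (a - (\<Sum>b\<in>B. frag_of (x b, n b))) - (c - (\<Sum>b\<in>B. frag_of (y b, n b)))
          + (\<Sum>b\<in>B. frag_of (x b, n b) - frag_of (?d b, n b) - frag_of (y b, n b))"
      by (simp add: sum_subtractf)
    also have "\<dots> \<in> ?K" by (intro K_add K_diff x y rels) auto
    finally show ?case using dM by (intro bexI[of _ ?d]) auto
  qed
  have \<Phi>_normal_form: "\<Phi> z = (\<Oplus>b\<in>B. x b \<otimes> n b)"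
    if z: "z \<in> carrier ?F" "x \<in> B \<rightarrow> M" "z - (\<Sum>b\<in>B. frag_of (x b, n b)) \<in> ?K" for z x
  proof -
    have "\<Phi> (z - (\<Sum>b\<in>B. frag_of (x b, n b))) = \<zero>"
      using z(3) K_kernel unfolding kernel_def by auto
    then have "\<Phi> z \<ominus> (\<Oplus>b\<in>B. x b \<otimes> n b) = \<zero>"
      using \<Phi>_diff[OF z(1)] sum_F[OF subset_refl z(2)] by simp
    then show ?thesis
      using \<Phi>_closed z(1) sum_F[OF subset_refl z(2)] by (metis minus_cancel)
  qed
  have kernel: "kernel ?F (add_monoid R) \<Phi> = ?K"
  proof
    show "kernel ?F (add_monoid R) \<Phi> \<subseteq> ?K"
    proof
      fix z assume "z \<in> kernel ?F (add_monoid R) \<Phi>"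
      then have z: "z \<in> carrier ?F" "\<Phi> z = \<zero>" unfolding kernel_def by auto
      obtain x where x: "x \<in> B \<rightarrow> M" "z - (\<Sum>b\<in>B. frag_of (x b, n b)) \<in> ?K"
        using normal_form[OF z(1)] by blast
      then have x0: "\<forall>b\<in>B. x b = \<zero>" using \<Phi>_normal_form[OF z(1) x] z(2) independent by metis
      have "(\<Sum>b\<in>B'. frag_of (x b, n b)) \<in> ?K" if "B' \<subseteq> B" for B'
        using finite_subset[OF that B(1)] that x0
        by (induction B' rule: finite_induct) (auto intro: K_zero K_add K_left_zero B(2))
      then show "z \<in> ?K" using K_add[OF x(2)] by fastforce
    qed
  qed (rule K_kernel)
  have image: "\<Phi> ` carrier ?F = P"
  proof
    show "\<Phi> ` carrier ?F \<subseteq> P"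
    proof
      fix y assume "y \<in> \<Phi> ` carrier ?F"
      then obtain z where z: "z \<in> carrier ?F" "y = \<Phi> z" by blast
      then obtain x where "x \<in> B \<rightarrow> M" "z - (\<Sum>b\<in>B. frag_of (x b, n b)) \<in> ?K"
        using normal_form by blast
      then show "y \<in> P" using \<Phi>_normal_form z unfolding P by blast
    qed
    show "P \<subseteq> \<Phi> ` carrier ?F"
    proof
      fix y assume "y \<in> P"
      then obtain x where x: "x \<in> B \<rightarrow> M" "y = (\<Oplus>b\<in>B. x b \<otimes> n b)" unfolding P by blast
      then have "y = \<Phi> (\<Sum>b\<in>B. frag_of (x b, n b))" using sum_F[OF subset_refl x(1)] by simp
      then show "y \<in> \<Phi> ` carrier ?F" using sum_F[OF subset_refl x(1)] by blast
    qed
  qed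
  let ?H = "(add_monoid R)\<lparr>carrier := P\<rparr>"
  have "group ?H"
    using subgroup.subgroup_is_group[OF \<Phi>.img_is_subgroup R.a_group] unfolding image .
  then interpret H: group_hom ?F ?H \<Phi>
    using image \<Phi> by (intro group_hom.intro group_hom_axioms.intro F.group_axioms) (auto simp: hom_def)
  have kernel': "kernel ?F ?H \<Phi> = ?K" using kernel by (simp add: kernel_def)
  let ?\<phi> = "\<lambda>X. the_elem (\<Phi> ` X)"
  have "?\<phi> \<in> iso (tensor_product R A M N) ?H"
    using H.FactGroup_iso_set image unfolding kernel' tensor_product_def by simp
  moreover have "?\<phi> (pure_tensor R A M N x y) = x \<otimes> y" if xy: "x \<in> M" "y \<in> N" for x y
  proof -
    have "\<Phi> z = x \<otimes> y" if "z \<in> pure_tensor R A M N x y" for z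
    proof -
      obtain k where k: "k \<in> ?K" "z = k + frag_of (x, y)"
        using \<open>z \<in> _\<close> unfolding pure_tensor_def r_coset_def by auto
      have "\<Phi> k = \<zero>" using k(1) kernel unfolding kernel_def by auto
      then show ?thesis
        using k \<Phi>_add[OF KF[OF k(1)] frag[OF xy]] \<Phi>_frag[OF xy] MR NR xy by simp
    qed
    moreover have "0 + frag_of (x, y) \<in> pure_tensor R A M N x y"
      unfolding pure_tensor_def r_coset_def using K_zero by force
    ultimately have "\<Phi> ` pure_tensor R A M N x y = {x \<otimes> y}" by (auto intro!: image_eqI)
    then show ?thesis by simp
  qed
  ultimately show ?thesis
    unfolding product_bimodule_iso_def
    using bimodules MR NR AR by (intro bexI[of _ ?\<phi>]) (auto simp: R.m_assoc)
qed


section \<open>Factorisability in degree 2\<close>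

abbreviation letters :: "'g set \<Rightarrow> 'g list set" where
  "letters U \<equiv> (\<lambda>u. [u]) ` U"

abbreviation pairs :: "'g set \<Rightarrow> 'g set \<Rightarrow> 'g list set" where
  "pairs U V \<equiv> (\<lambda>(u, v). [u, v]) ` (U \<times> V)"

abbreviation swapped_pairs :: "'g set \<Rightarrow> 'g set \<Rightarrow> 'g list set" where
  "swapped_pairs U V \<equiv> (\<lambda>(u, v). [v, u]) ` (U \<times> V)"

definition supported :: "'g::group_add set \<Rightarrow> 'g list set \<Rightarrow> 'g tensor set" where
  "supported C W = {t \<in> tensors C. \<forall>w x. t w x \<noteq> 0 \<longrightarrow> w \<in> W}"

lemma supported_closed:
  "0 \<in> supported C W" "s \<in> supported C W \<Longrightarrow> t \<in> supported C W \<Longrightarrow> s + t \<in> supported C W"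
  "t \<in> supported C W \<Longrightarrow> - t \<in> supported C W"
  "s \<in> supported C W \<Longrightarrow> t \<in> supported C W \<Longrightarrow> s - t \<in> supported C W"
  "t \<in> supported C W \<Longrightarrow> fun_tensor f \<star> t \<in> supported C W"
  "t \<in> supported C W \<Longrightarrow> t \<star> fun_tensor f \<in> supported C W"
  unfolding supported_def
  by (auto simp: fun_tensor_mult_apply mult_fun_tensor_apply) (metis add_0 diff_0_right)+

context homogeneous_relations
begin

text \<open>The bimodules with left bases \<open>e\<^sup>u\<close>, \<open>u \<in> U\<close>, and \<open>e\<^sup>v\<close>, \<open>v \<in> V\<close>, and the span of the mixed
  products.  The product is onto because every \<open>e\<^sup>v e\<^sup>u\<close> can be replaced by some
  \<open>- e\<^bsup>u'\<^esup> e\<^bsup>v'\<^esup>\<close>, and injective because every coefficient at a word \<open>[u, v]\<close> of an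
  element of the ideal recurs at some \<open>[v', u']\<close>.\<close>

lemma product_bimodule_iso_words:
  assumes UV: "U \<subseteq> C" "V \<subseteq> C" "U \<inter> V = {}"
    and low: "\<And>t w x. t \<in> I \<Longrightarrow> length w < 2 \<Longrightarrow> t w x = 0"
    and exchange: "\<And>u v. u \<in> U \<Longrightarrow> v \<in> V \<Longrightarrow>
      \<exists>u'\<in>U. \<exists>v'\<in>V. basis_form v \<star> basis_form u + basis_form u' \<star> basis_form v' \<in> I"
    and coefficient: "\<And>t u v x. t \<in> I \<Longrightarrow> u \<in> U \<Longrightarrow> v \<in> V \<Longrightarrow> \<exists>u'\<in>U. \<exists>v'\<in>V. t [u, v] x = t [v', u'] x"
  shows "product_bimodule_iso Q (range (ext_fun C S)) (cls ` supported C (letters U))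
    (cls ` supported C (letters V))
    (cls ` supported C (pairs U V \<union> swapped_pairs U V))"
    (is "product_bimodule_iso _ ?A (cls ` ?M) (cls ` ?N) (cls ` ?P)")
proof (rule product_bimodule_iso_of_basis[where B = V and n = "\<lambda>v. cls (basis_form v)"])
  have fin: "finite U" "finite V"
    using finite_subset[OF UV(1) finite_C] finite_subset[OF UV(2) finite_C] by simp_all
  have tensors: "t \<in> tensors C" if "t \<in> supported C W" for t W using that by (simp add: supported_def)
  have sub: "additive_subgroup (cls ` supported C W) Q" for W
  proof (rule additive_subgroup.intro, rule quotient.add.subgroupI)
    show "cls ` supported C W \<subseteq> carrier Q" "cls ` supported C W \<noteq> {}"
      using supported_closed(1) by (auto simp: carrier_Q dest: tensors)
    show "\<ominus>\<^bsub>Q\<^esub> x \<in> cls ` supported C W" if "x \<in> cls ` supported C W" for x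
      using that by (auto simp: cls_uminus tensors supported_closed)
    show "x \<oplus>\<^bsub>Q\<^esub> y \<in> cls ` supported C W" if "x \<in> cls ` supported C W" "y \<in> cls ` supported C W" for x y
      using that by (auto simp: cls_hom tensors supported_closed)
  qed
  show "additive_subgroup (cls ` ?M) Q" "additive_subgroup (cls ` ?N) Q" by (rule sub)+
  show "?A \<subseteq> carrier Q" by (auto simp: ext_fun_def)
  have bim: "f \<otimes>\<^bsub>Q\<^esub> x \<in> cls ` supported C W" "x \<otimes>\<^bsub>Q\<^esub> f \<in> cls ` supported C W"
    if "f \<in> ?A" "x \<in> cls ` supported C W" for f x W
    using that by (auto simp: ext_fun_def cls_hom tensors supported_closed)
  show "f \<otimes>\<^bsub>Q\<^esub> x \<in> cls ` ?M" "x \<otimes>\<^bsub>Q\<^esub> f \<in> cls ` ?M" if "f \<in> ?A" "x \<in> cls ` ?M" for f x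
    using bim[OF that] by auto
  show "f \<otimes>\<^bsub>Q\<^esub> x \<in> cls ` ?N" "x \<otimes>\<^bsub>Q\<^esub> f \<in> cls ` ?N" if "f \<in> ?A" "x \<in> cls ` ?N" for f x
    using bim[OF that] by auto
  show "finite V" by fact
  have basis: "basis_form v \<in> supported C (letters V)" if "v \<in> V" for v
    using that UV by (auto simp: supported_def) (auto simp: basis_form_def split: if_splits)
  show "cls (basis_form v) \<in> cls ` ?N" if "v \<in> V" for v using basis[OF that] by blast
  have V: "basis_form v \<in> tensors C" if "v \<in> V" for v using that UV by auto
  show "\<exists>g\<in>V \<rightarrow> ?A. y = (\<Oplus>\<^bsub>Q\<^esub>v\<in>V. g v \<otimes>\<^bsub>Q\<^esub> cls (basis_form v))" if y: "y \<in> cls ` ?N" for y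
  proof -
    obtain t where t: "t \<in> ?N" "y = cls t" using y by blast
    have "t w x = (\<Sum>v\<in>V. fun_tensor (t [v]) \<star> basis_form v) w x" for w x
    proof -
      have "(\<Sum>v\<in>V. fun_tensor (t [v]) \<star> basis_form v) w x
          = (\<Sum>v\<in>V. if v = hd w then (if w = [hd w] then t w x else 0) else 0)"
        unfolding sum_tensor_apply fun_tensor_mult_apply
        by (intro sum.cong) (auto simp: basis_form_def)
      also have "\<dots> = (if hd w \<in> V \<and> w = [hd w] then t w x else 0)"
        using fin by (simp add: sum.delta)
      also have "\<dots> = t w x" using t(1) by (auto simp: supported_def)
      finally show ?thesis by simp
    qed
    then have "t = (\<Sum>v\<in>V. fun_tensor (t [v]) \<star> basis_form v)" by (intro ext)
    then have "y = (\<Oplus>\<^bsub>Q\<^esub>v\<in>V. cls (fun_tensor (t [v]) \<star> basis_form v))"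
      using t(2) V fin by (subst cls_sum) auto
    also have "\<dots> = (\<Oplus>\<^bsub>Q\<^esub>v\<in>V. ext_fun C S (t [v]) \<otimes>\<^bsub>Q\<^esub> cls (basis_form v))"
      using V by (intro quotient.finsum_cong') (auto simp: ext_fun_def cls_hom)
    finally show ?thesis by (intro bexI[of _ "\<lambda>v. ext_fun C S (t [v])"]) auto
  qed
  \<comment> \<open>Lifting the coefficients to tensors turns equations in the quotient into statements about \<open>I\<close>.\<close>
  have lift: "\<exists>s \<in> V \<rightarrow> ?M. (\<forall>v\<in>V. x v = cls (s v)) \<and>
      (\<Oplus>\<^bsub>Q\<^esub>v\<in>V. x v \<otimes>\<^bsub>Q\<^esub> cls (basis_form v)) = cls (\<Sum>v\<in>V. s v \<star> basis_form v)"
    if x: "x \<in> V \<rightarrow> cls ` ?M" for x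
  proof -
    have "\<forall>v\<in>V. \<exists>s. s \<in> ?M \<and> x v = cls s" using x by blast
    then obtain s where s: "\<And>v. v \<in> V \<Longrightarrow> s v \<in> ?M" "\<And>v. v \<in> V \<Longrightarrow> x v = cls (s v)" by metis
    have "(\<Oplus>\<^bsub>Q\<^esub>v\<in>V. x v \<otimes>\<^bsub>Q\<^esub> cls (basis_form v)) = (\<Oplus>\<^bsub>Q\<^esub>v\<in>V. cls (s v \<star> basis_form v))"
      using s(2) tensors[OF s(1)] V by (intro quotient.finsum_cong') (auto simp: cls_hom)
    also have "\<dots> = cls (\<Sum>v\<in>V. s v \<star> basis_form v)"
      using fin V s(1) by (intro cls_sum) (auto dest: tensors)
    finally show ?thesis using s by (intro bexI[of _ s]) auto
  qed
  have product_apply: "(\<Sum>v\<in>V. s v \<star> basis_form v) w x = (if w \<noteq> [] \<and> last w \<in> V then s (last w) (butlast w) x else 0)"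
    for s :: "'g \<Rightarrow> 'g tensor" and w x
  proof -
    have "(\<Sum>v\<in>V. s v \<star> basis_form v) w x = (\<Sum>v\<in>V. if v = last w then (if w \<noteq> [] then s v (butlast w) x else 0) else 0)"
      unfolding sum_tensor_apply mult_basis_form_apply by (intro sum.cong) auto
    then show ?thesis using fin by (simp add: sum.delta)
  qed
  have product_tensors: "(\<Sum>v\<in>V. s v \<star> basis_form v) \<in> tensors C" if "s \<in> V \<rightarrow> ?M" for s
    using that tensors V by (intro tensors_sum tensors_closed(1)) blast+
  show "\<forall>v\<in>V. x v = \<zero>\<^bsub>Q\<^esub>"
    if x: "x \<in> V \<rightarrow> cls ` ?M" and zero: "(\<Oplus>\<^bsub>Q\<^esub>v\<in>V. x v \<otimes>\<^bsub>Q\<^esub> cls (basis_form v)) = \<zero>\<^bsub>Q\<^esub>" for x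
  proof
    fix v assume v: "v \<in> V"
    obtain s where s: "s \<in> V \<rightarrow> ?M" "\<And>v. v \<in> V \<Longrightarrow> x v = cls (s v)"
      "cls (\<Sum>v\<in>V. s v \<star> basis_form v) = cls 0" using lift[OF x] zero cls_zero by auto
    have "(\<Sum>v\<in>V. s v \<star> basis_form v) \<in> tensors C" by (rule product_tensors[OF s(1)])
    then have sI: "(\<Sum>v\<in>V. s v \<star> basis_form v) \<in> I" using s(3) by (simp add: cls_eq_zero_iff)
    have "s v [u] y = 0" if u: "u \<in> U" for u y
    proof -
      obtain u' v' where uv: "u' \<in> U" "v' \<in> V"
        "(\<Sum>v\<in>V. s v \<star> basis_form v) [u, v] y = (\<Sum>v\<in>V. s v \<star> basis_form v) [v', u'] y"
        using coefficient[OF sI u v] by blast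
      \<comment> \<open>The right-hand side vanishes because \<open>u'\<close> is not in \<open>V\<close>.\<close>
      then show ?thesis using UV(3) v by (auto simp: product_apply)
    qed
    moreover have "s v w y = 0" if "w \<notin> letters U" for w y
      using that s(1) v by (auto simp: supported_def Pi_iff)
    ultimately have "s v w y = 0" for w y by (cases "w \<in> letters U") (simp_all add: image_iff, metis)
    then have "s v = 0" by (simp add: fun_eq_iff)
    then show "x v = \<zero>\<^bsub>Q\<^esub>" using s(2)[OF v] cls_zero by simp
  qed
  show "cls ` ?P = {(\<Oplus>\<^bsub>Q\<^esub>v\<in>V. x v \<otimes>\<^bsub>Q\<^esub> cls (basis_form v)) | x. x \<in> V \<rightarrow> cls ` ?M}" (is "_ = ?R")
  proof
    show "?R \<subseteq> cls ` ?P"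
    proof
      fix y assume "y \<in> ?R"
      then obtain x where x: "x \<in> V \<rightarrow> cls ` ?M" "y = (\<Oplus>\<^bsub>Q\<^esub>v\<in>V. x v \<otimes>\<^bsub>Q\<^esub> cls (basis_form v))" by blast
      obtain s where s: "s \<in> V \<rightarrow> ?M" "y = cls (\<Sum>v\<in>V. s v \<star> basis_form v)" using lift[OF x(1)] x(2) by auto
      have "(\<Sum>v\<in>V. s v \<star> basis_form v) \<in> tensors C" by (rule product_tensors[OF s(1)])
      moreover have "w \<in> pairs U V" if nz: "(\<Sum>v\<in>V. s v \<star> basis_form v) w z \<noteq> 0" for w z
      proof -
        have w: "w \<noteq> []" "last w \<in> V" "s (last w) (butlast w) z \<noteq> 0"
          using nz unfolding product_apply by (auto split: if_splits)
        then obtain u where u: "u \<in> U" "butlast w = [u]" using s(1) by (fastforce simp: supported_def)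
        then have "w = [u, last w]" using w(1) append_butlast_last_id[of w] by simp
        then show ?thesis using u w(2) by force
      qed
      ultimately have "(\<Sum>v\<in>V. s v \<star> basis_form v) \<in> ?P" unfolding supported_def by blast
      then show "y \<in> cls ` ?P" using s(2) by blast
    qed
    show "cls ` ?P \<subseteq> ?R"
    proof
      fix y assume "y \<in> cls ` ?P"
      then obtain t where t: "t \<in> ?P" "y = cls t" by blast
      have "\<forall>u\<in>U. \<forall>v\<in>V. \<exists>r. r \<in> (\<lambda>(u, v). basis_form u \<star> basis_form v) ` (U \<times> V)
          \<and> basis_form v \<star> basis_form u + r \<in> I"
        using exchange by force
      then obtain r where r: "\<And>u v. u \<in> U \<Longrightarrow> v \<in> V \<Longrightarrow> r u v \<in> (\<lambda>(u, v). basis_form u \<star> basis_form v) ` (U \<times> V)"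
        "\<And>u v. u \<in> U \<Longrightarrow> v \<in> V \<Longrightarrow> basis_form v \<star> basis_form u + r u v \<in> I" by metis
      have W: "basis_form u \<star> basis_form v \<in> supported C (pairs U V)"
        if "u \<in> U" "v \<in> V" for u v
      proof -
        have "basis_form u \<star> basis_form v \<in> tensors C" using that UV by auto
        moreover have "(basis_form u \<star> basis_form v) w x = (if w = [u, v] then 1 else 0)" for w x
          by (simp add: basis_form_mult_basis_form)
        ultimately show ?thesis using that unfolding supported_def by auto
      qed
      let ?Y = "\<Sum>u\<in>U. \<Sum>v\<in>V. fun_tensor (t [v, u]) \<star> (basis_form v \<star> basis_form u)"
      let ?E = "\<Sum>u\<in>U. \<Sum>v\<in>V. fun_tensor (t [v, u]) \<star> r u v"
      have sum_W: "sum F X \<in> supported C W" if "\<And>i. i \<in> X \<Longrightarrow> F i \<in> supported C W" for X :: "'g set" and F W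
        using that by (induction X rule: infinite_finite_induct) (auto simp: supported_closed)
      have EW: "?E \<in> supported C (pairs U V)"
        using r(1) W by (intro sum_W supported_closed(5)) fastforce
      have Y: "?Y w x = (if w \<in> swapped_pairs U V then t w x else 0)" for w x
      proof -
        define two where "two \<longleftrightarrow> w = [hd w, last w]"
        have shape: "w = [hd w, u] \<longleftrightarrow> u = last w \<and> two" for u
          unfolding two_def by (metis last_ConsL last_ConsR list.distinct(1))
        have "?Y w x = (\<Sum>u\<in>U. \<Sum>v\<in>V. if v = hd w then (if w = [hd w, u] then t w x else 0) else 0)"
          unfolding sum_tensor_apply fun_tensor_mult_apply basis_form_mult_basis_form
          by (intro sum.cong) auto
        also have "\<dots> = (\<Sum>u\<in>U. if u = last w then (if hd w \<in> V \<and> two then t w x else 0) else 0)"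
          unfolding shape using fin by (intro sum.cong) (auto simp: sum.delta)
        also have "\<dots> = (if last w \<in> U \<and> hd w \<in> V \<and> two then t w x else 0)"
          using fin by (simp add: sum.delta)
        also have "\<dots> = (if w \<in> swapped_pairs U V then t w x else 0)"
        proof -
          have "w \<in> swapped_pairs U V \<longleftrightarrow> (\<exists>u\<in>U. \<exists>v\<in>V. w = [v, u])" by auto
          also have "\<dots> \<longleftrightarrow> last w \<in> U \<and> hd w \<in> V \<and> two"
            unfolding two_def by (metis last_ConsL last_ConsR list.distinct(1) list.sel(1))
          finally show ?thesis by simp
        qed
        finally show ?thesis .
      qed
      have YT: "?Y \<in> tensors C" using UV(1,2) by (intro tensors_sum tensors_closed(1) fun_tensor_closed basis_form_closed) blast+
      have X: "t - ?Y \<in> supported C (pairs U V)"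
      proof -
        have "t - ?Y \<in> tensors C" using t(1) YT tensors by blast
        moreover have "w \<in> pairs U V" if "(t - ?Y) w x \<noteq> 0" for w x
        proof -
          have "(t - ?Y) w x = (if w \<in> swapped_pairs U V then 0 else t w x)"
            unfolding minus_apply Y by simp
          then have "w \<notin> swapped_pairs U V" "t w x \<noteq> 0" using that by (auto split: if_splits)
          then show ?thesis using t(1) unfolding supported_def by blast
        qed
        ultimately show ?thesis unfolding supported_def by blast
      qed
      define t' where "t' = t - ?Y - ?E"
      have t': "t' \<in> supported C (pairs U V)"
        unfolding t'_def by (rule supported_closed(4)[OF X EW])
      have "t - t' = (\<Sum>u\<in>U. \<Sum>v\<in>V. fun_tensor (t [v, u]) \<star> (basis_form v \<star> basis_form u + r u v))"
        by (simp add: t'_def tensor_mult_distrib sum.distrib)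
      also have "\<dots> \<in> I" using r(2) by (intro ideal_sum ideal_closed(5)) auto
      finally have yt': "y = cls t'"
        using t tensors t' by (simp add: cls_eq_iff)
      define s where "s v w z = (if w \<in> letters U then t' (w @ [v]) z else 0)" for v w z
      have sM: "s v \<in> ?M" for v
      proof -
        have "{w. s v w \<noteq> (\<lambda>_. 0)} \<subseteq> letters U" unfolding s_def by auto
        then have "finite {w. s v w \<noteq> (\<lambda>_. 0)}" using fin finite_subset by blast
        moreover have w: "w \<in> letters U" if "s v w z \<noteq> 0" for w z
          using that unfolding s_def by (auto split: if_splits)
        moreover have "set w \<subseteq> C" if "s v w z \<noteq> 0" for w z using w[OF that] UV by auto
        ultimately show ?thesis unfolding supported_def tensors_iff by blast
      qed
      have "(\<Sum>v\<in>V. s v \<star> basis_form v) w z = t' w z" for w z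
      proof (cases "w \<in> pairs U V")
        case True
        then show ?thesis unfolding product_apply s_def by auto
      next
        case False
        have "butlast w \<in> letters U \<Longrightarrow> w \<noteq> [] \<Longrightarrow> last w \<in> V \<Longrightarrow> w \<in> pairs U V"
          using append_butlast_last_id[of w] by force
        moreover have "t' w z = 0" using False t' unfolding supported_def by blast
        ultimately show ?thesis unfolding product_apply s_def using False by auto
      qed
      then have "t' = (\<Sum>v\<in>V. s v \<star> basis_form v)" by (simp add: fun_eq_iff)
      then have "y = cls (\<Sum>v\<in>V. s v \<star> basis_form v)" using yt' by simp
      also have "\<dots> = (\<Oplus>\<^bsub>Q\<^esub>v\<in>V. cls (s v \<star> basis_form v))"
        using fin V sM tensors by (intro cls_sum[symmetric]) blast+
      also have "\<dots> = (\<Oplus>\<^bsub>Q\<^esub>v\<in>V. cls (s v) \<otimes>\<^bsub>Q\<^esub> cls (basis_form v))"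
        using V tensors[OF sM] by (intro quotient.finsum_cong') (auto simp: cls_hom)
      finally show "y \<in> ?R"
        using sM by (intro CollectI exI[of _ "\<lambda>v. cls (s v)"] conjI) (simp, blast)
    qed
  qed
qed (rule quotient.ring_axioms)

end

text \<open>The exchange relations themselves make the two product maps onto; the symmetry of the
  coefficients says that there is no relation of bidegree \<open>(1,1)\<close> beyond them, which makes the
  product maps injective.\<close>

locale factorisable_relations = bihomogeneous_relations +
  assumes exchange: "a \<in> C01 \<Longrightarrow> b \<in> C10 \<Longrightarrow>
      basis_form a \<star> basis_form b + basis_form (a + b - a) \<star> basis_form a \<in> rel_ideal C S"
    and conjugate: "a \<in> C01 \<Longrightarrow> b \<in> C10 \<Longrightarrow> a + b - a \<in> C10"
    and exchange_symmetric: "t \<in> S \<Longrightarrow> a \<in> C01 \<Longrightarrow> b \<in> C10 \<Longrightarrow> t [a, b] x = t [a + b - a, a] x"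
begin

lemma conjugate_inverse:
  assumes "a \<in> C01" "c \<in> C10"
  shows "- a + c + a \<in> C10"
proof -
  \<comment> \<open>Conjugation by \<open>a\<close> is an injection of the finite set \<open>C10\<close> into itself.\<close>
  have "finite C10" using finite_C subsets(1) finite_subset by blast
  moreover have "inj_on (\<lambda>b. a + b - a) C10"
    by (rule inj_onI) (metis add_left_cancel diff_add_cancel)
  moreover have "(\<lambda>b. a + b - a) ` C10 \<subseteq> C10" using conjugate[OF assms(1)] by blast
  ultimately have "(\<lambda>b. a + b - a) ` C10 = C10" by (metis endo_inj_surj)
  then obtain b where b: "b \<in> C10" "c = a + b - a" using assms(2) by blast
  have "- a + (a + b - a) + a = b" by (simp add: diff_add_cancel add.assoc)
  then show ?thesis using b by simp
qed

text \<open>Elements of the ideal vanish below degree 2, so in degree 2 a product with one of them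
  involves only the function part of the other factor.  It multiplies the coefficients of both words by
  the same number, because the words have the same sum.\<close>

lemma ideal_exchange_symmetric:
  assumes "t \<in> I" "a \<in> C01" "b \<in> C10"
  shows "t [a, b] x = t [a + b - a, a] x"
proof -
  let ?P = "\<lambda>t. t \<in> I \<and> (\<forall>a\<in>C01. \<forall>b\<in>C10. \<forall>x. t [a, b] x = t [a + b - a, a] x)"
  have "?P t"
    using assms(1)
  proof (rule ideal_induct[where P = ?P])
    show "?P t" if "t \<in> S" for t using that exchange_symmetric relations_in_ideal by blast
    show "?P (s \<star> t) \<and> ?P (t \<star> s)" if s: "s \<in> tensors C" "t \<in> tensors C" and t: "?P t" for s t
    proof -
      have low: "t [] x = 0" "t [c] x = 0" for c x using t ideal_low_degree by auto
      have "a + (b + 0) = a + b - a + (a + 0)" for a b :: 'a by simp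
      then have "(s \<star> t) [a, b] x = (s \<star> t) [a + b - a, a] x \<and> (t \<star> s) [a, b] x = (t \<star> s) [a + b - a, a] x"
        if "a \<in> C01" "b \<in> C10" for a b x
        using t that by (auto simp: tensor_mult_def low numeral_2_eq_2 atMost_Suc)
      then show ?thesis using s t by blast
    qed
  qed auto
  then show ?thesis using assms by blast
qed

lemma bidegree_words:
  "tensor_bideg C C10 C01 1 0 = supported C (letters C10)"
  "tensor_bideg C C10 C01 0 1 = supported C (letters C01)"
  "tensor_bideg C C10 C01 1 1
    = supported C (pairs C10 C01 \<union> swapped_pairs C10 C01)"
proof -
  have eq: "tensor_bideg C C10 C01 p q = supported C W"
    if "\<And>w. set w \<subseteq> C \<Longrightarrow> word_bidegree C10 C01 w = (p, q) \<longleftrightarrow> w \<in> W" for p q W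
    using that unfolding set_eq_iff tensor_bideg_iff supported_def mem_Collect_eq tensors_iff by blast
  have len: "length w = p + q" if "set w \<subseteq> C" "word_bidegree C10 C01 w = (p, q)" for w p q
    using word_bidegree_length[OF splitting that(1)] that(2) by simp
  have one: "\<exists>a. w = [a]" if "length w = Suc 0" for w :: "'a list"
    using that by (cases w) auto
  have two: "\<exists>a b. w = [a, b]" if "length w = Suc (Suc 0)" for w :: "'a list"
    using that by (cases w) (auto dest: one)
  show "tensor_bideg C C10 C01 1 0 = supported C (letters C10)"
  proof (rule eq)
    fix w assume w: "set w \<subseteq> C"
    show "word_bidegree C10 C01 w = (1, 0) \<longleftrightarrow> w \<in> letters C10"
    proof
      assume bd: "word_bidegree C10 C01 w = (1, 0)"
      then obtain a where "w = [a]" using len[OF w bd] one[of w] by auto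
      then show "w \<in> letters C10"
        using bd by (auto simp: word_bidegree_def split: if_splits)
    qed (use splitting in \<open>auto simp: word_bidegree_def\<close>)
  qed
  show "tensor_bideg C C10 C01 0 1 = supported C (letters C01)"
  proof (rule eq)
    fix w assume w: "set w \<subseteq> C"
    show "word_bidegree C10 C01 w = (0, 1) \<longleftrightarrow> w \<in> letters C01"
    proof
      assume bd: "word_bidegree C10 C01 w = (0, 1)"
      then obtain a where "w = [a]" using len[OF w bd] one[of w] by auto
      then show "w \<in> letters C01"
        using bd by (auto simp: word_bidegree_def split: if_splits)
    qed (use splitting in \<open>auto simp: word_bidegree_def\<close>)
  qed
  show "tensor_bideg C C10 C01 1 1
    = supported C (pairs C10 C01 \<union> swapped_pairs C10 C01)"
  proof (rule eq)
    fix w assume w: "set w \<subseteq> C"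
    show "word_bidegree C10 C01 w = (1, 1) \<longleftrightarrow>
      w \<in> pairs C10 C01 \<union> swapped_pairs C10 C01" (is "_ \<longleftrightarrow> w \<in> ?W")
    proof
      assume bd: "word_bidegree C10 C01 w = (1, 1)"
      then obtain a b where ab: "w = [a, b]" using len[OF w bd] two[of w] by auto
      have "a \<in> C10 \<and> b \<in> C01 \<or> a \<in> C01 \<and> b \<in> C10"
        using bd w splitting unfolding ab by (auto simp: word_bidegree_def split: if_splits)
      then show "w \<in> ?W" unfolding ab by auto
    qed (use splitting in \<open>auto simp: word_bidegree_def\<close>)
  qed
qed

theorem factorisable: "factorisable_degree_2 Q (ext_deg C S) (ext_bideg C C10 C01 S)"
proof -
  have A: "ext_deg C S 0 = range (ext_fun C S)"
    by (auto simp: ext_deg_def tensor_deg_0 ext_fun_def)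
  have cancel: "a + (- a + c + a) - a = c" for a c :: 'a
    by (simp add: add.assoc flip: diff_conv_add_uminus)
  have "product_bimodule_iso Q (range (ext_fun C S)) (cls ` supported C (letters C10))
    (cls ` supported C (letters C01))
    (cls ` supported C (pairs C10 C01 \<union> swapped_pairs C10 C01))"
  proof (rule product_bimodule_iso_words)
    show "\<exists>u'\<in>C10. \<exists>v'\<in>C01. basis_form v \<star> basis_form u + basis_form u' \<star> basis_form v' \<in> I"
      if "u \<in> C10" "v \<in> C01" for u v
      using exchange[OF that(2,1)] conjugate[OF that(2,1)] that by blast
    show "\<exists>u'\<in>C10. \<exists>v'\<in>C01. t [u, v] x = t [v', u'] x" if "t \<in> I" "u \<in> C10" "v \<in> C01" for t u v x
      using ideal_exchange_symmetric[OF that(1,3) conjugate_inverse[OF that(3,2)], of x]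
        conjugate_inverse[OF that(3,2)] that(3) unfolding cancel by metis
  qed (use splitting(2) ideal_low_degree in auto)
  moreover have "product_bimodule_iso Q (range (ext_fun C S)) (cls ` supported C (letters C01))
    (cls ` supported C (letters C10))
    (cls ` supported C (pairs C01 C10 \<union> swapped_pairs C01 C10))"
  proof (rule product_bimodule_iso_words)
    show "\<exists>u'\<in>C01. \<exists>v'\<in>C10. basis_form v \<star> basis_form u + basis_form u' \<star> basis_form v' \<in> I"
      if "u \<in> C01" "v \<in> C10" for u v
    proof (intro bexI)
      show "basis_form v \<star> basis_form u + basis_form u \<star> basis_form (- u + v + u) \<in> I"
        using exchange[OF that(1) conjugate_inverse[OF that]] unfolding cancel by (simp add: add.commute)
    qed (use that conjugate_inverse in auto)
    show "\<exists>u'\<in>C01. \<exists>v'\<in>C10. t [u, v] x = t [v', u'] x" if "t \<in> I" "u \<in> C01" "v \<in> C10" for t u v x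
      using ideal_exchange_symmetric[OF that(1,2,3), of x] conjugate[OF that(2,3)] that(2) by blast
  qed (use splitting(2) ideal_low_degree in auto)
  moreover have "pairs C01 C10 \<union> swapped_pairs C01 C10
    = pairs C10 C01 \<union> swapped_pairs C10 C01" by auto
  ultimately show ?thesis
    unfolding factorisable_degree_2_def A ext_bideg_def bidegree_words by simp
qed

end


section \<open>Permutation braids on words\<close>

text \<open>The sum, in their original order, of the letters that \<open>\<sigma>\<close> moves to positions \<open>\<ge> k\<close>.\<close>

definition tail_sum :: "(nat \<Rightarrow> nat) \<Rightarrow> 'g::group_add list \<Rightarrow> nat \<Rightarrow> 'g" where
  "tail_sum \<sigma> w k = sum_list (map ((!) w) (filter (\<lambda>i. k \<le> \<sigma> i) [0..<length w]))"

text \<open>The action on words of the positive permutation braid of \<open>\<sigma>\<close>, in closed form: its tails have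
  the sums \<^const>\<open>tail_sum\<close>, and these determine the letters.\<close>

definition permutation_braid :: "(nat \<Rightarrow> nat) \<Rightarrow> 'g::group_add list \<Rightarrow> 'g list" where
  "permutation_braid \<sigma> w = map (\<lambda>k. tail_sum \<sigma> w k - tail_sum \<sigma> w (Suc k)) [0..<length w]"

definition inversions :: "nat \<Rightarrow> (nat \<Rightarrow> nat) \<Rightarrow> (nat \<times> nat) set" where
  "inversions n \<sigma> = {(i, j). i < j \<and> j < n \<and> \<sigma> j < \<sigma> i}"

lemma finite_inversions [simp]: "finite (inversions n \<sigma>)"
  by (rule finite_subset[of _ "{..<n} \<times> {..<n}"]) (auto simp: inversions_def)

abbreviation adjacent :: "nat \<Rightarrow> nat \<Rightarrow> nat" where
  "adjacent k \<equiv> Transposition.transpose k (Suc k)"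

text \<open>The strand that \<open>\<sigma>\<close> moves to a given position.\<close>

abbreviation source :: "(nat \<Rightarrow> nat) \<Rightarrow> nat \<Rightarrow> nat" where
  "source \<equiv> inv_into UNIV"

lemma adjacent_permutes: "Suc k < n \<Longrightarrow> adjacent k permutes {..<n}"
  by (rule permutes_swap_id) auto

lemma length_permutation_braid [simp]: "length (permutation_braid \<sigma> w) = length w"
  by (simp add: permutation_braid_def)

lemma nth_permutation_braid:
  "k < length w \<Longrightarrow> permutation_braid \<sigma> w ! k = tail_sum \<sigma> w k - tail_sum \<sigma> w (Suc k)"
  by (simp add: permutation_braid_def)

lemma inversions_adjacent:
  assumes \<sigma>: "\<sigma> permutes {..<n}" and k: "Suc k < n" and less: "source \<sigma> k < source \<sigma> (Suc k)"
  shows "inversions n (adjacent k \<circ> \<sigma>) = insert (source \<sigma> k, source \<sigma> (Suc k)) (inversions n \<sigma>)"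
    and "(source \<sigma> k, source \<sigma> (Suc k)) \<notin> inversions n \<sigma>"
proof -
  have in\<sigma>: "source \<sigma> (Suc k) < n"
    using permutes_in_image[OF permutes_inv[OF \<sigma>], of "Suc k"] k by simp
  have at: "\<sigma> i = m \<longleftrightarrow> i = source \<sigma> m" for i m
    using permutes_inv_eq[OF \<sigma>] by metis
  have adj: "adjacent k a < adjacent k b \<longleftrightarrow>
      (if a = k \<and> b = Suc k then False else if a = Suc k \<and> b = k then True else a < b)" for a b
    by (auto simp: Transposition.transpose_def)
  show "inversions n (adjacent k \<circ> \<sigma>) = insert (source \<sigma> k, source \<sigma> (Suc k)) (inversions n \<sigma>)"
  proof -
    have "(i, j) \<in> inversions n (adjacent k \<circ> \<sigma>) \<longleftrightarrow>
        (i, j) \<in> insert (source \<sigma> k, source \<sigma> (Suc k)) (inversions n \<sigma>)" for i j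
      using less in\<sigma> by (auto simp: inversions_def adj at)
    then show ?thesis by (intro equalityI subrelI) (simp_all only:)
  qed
  show "(source \<sigma> k, source \<sigma> (Suc k)) \<notin> inversions n \<sigma>"
    using permutes_inverses(1)[OF \<sigma>] by (auto simp: inversions_def)
qed

lemma card_inversions_adjacent:
  assumes \<sigma>: "\<sigma> permutes {..<n}" and k: "Suc k < n"
  shows "source \<sigma> k < source \<sigma> (Suc k) \<Longrightarrow> card (inversions n (adjacent k \<circ> \<sigma>)) = Suc (card (inversions n \<sigma>))"
    and "\<not> source \<sigma> k < source \<sigma> (Suc k) \<Longrightarrow> Suc (card (inversions n (adjacent k \<circ> \<sigma>))) = card (inversions n \<sigma>)"
proof -
  show "card (inversions n (adjacent k \<circ> \<sigma>)) = Suc (card (inversions n \<sigma>))"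
    if "source \<sigma> k < source \<sigma> (Suc k)"
    using inversions_adjacent[OF \<sigma> k that] by simp
  assume nl: "\<not> source \<sigma> k < source \<sigma> (Suc k)"
  let ?\<tau> = "adjacent k \<circ> \<sigma>"
  have \<tau>: "?\<tau> permutes {..<n}" using \<sigma> adjacent_permutes[OF k] by (rule permutes_compose)
  have bij: "bij \<sigma>" "bij (adjacent k)" using permutes_bij \<sigma> adjacent_permutes[OF k] by blast+
  have inv\<tau>: "source ?\<tau> m = source \<sigma> (adjacent k m)" for m
    using o_inv_distrib[OF bij(2,1)] by simp
  have "source \<sigma> k \<noteq> source \<sigma> (Suc k)"
    using permutes_inverses(1)[OF \<sigma>] by (metis n_not_Suc_n)
  then have "source ?\<tau> k < source ?\<tau> (Suc k)" using nl by (simp add: inv\<tau>)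
  moreover have "adjacent k \<circ> ?\<tau> = \<sigma>" by (simp add: fun_eq_iff)
  ultimately show "Suc (card (inversions n (adjacent k \<circ> \<sigma>))) = card (inversions n \<sigma>)"
    using inversions_adjacent[OF \<tau> k] by (metis card_insert_disjoint finite_inversions)
qed

lemma transposition_product_simps:
  "transposition_product [] = id"
  "transposition_product (k # ks) = adjacent k \<circ> transposition_product ks"
  by (simp_all add: transposition_product_def)

lemma transposition_product_permutes:
  "\<forall>k\<in>set ks. Suc k < n \<Longrightarrow> transposition_product ks permutes {..<n}"
  by (induction ks)
    (auto simp: transposition_product_simps permutes_id intro: permutes_compose adjacent_permutes)

lemma card_inversions_le:
  "\<forall>k\<in>set ks. Suc k < n \<Longrightarrow> card (inversions n (transposition_product ks)) \<le> length ks"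
proof (induction ks)
  case Nil
  have "inversions n id = {}" by (auto simp: inversions_def)
  then show ?case by (simp only: transposition_product_simps card.empty list.size order_refl)
next
  case (Cons k ks)
  let ?\<sigma> = "transposition_product ks"
  have "?\<sigma> permutes {..<n}" "Suc k < n"
    using Cons.prems by (auto intro: transposition_product_permutes)
  then have "card (inversions n (adjacent k \<circ> ?\<sigma>)) \<le> Suc (card (inversions n ?\<sigma>))"
    using card_inversions_adjacent[of ?\<sigma> n k]
    by (cases "source ?\<sigma> k < source ?\<sigma> (Suc k)") simp_all
  also have "\<dots> \<le> length (k # ks)" using Cons by simp
  finally show ?case by (simp only: transposition_product_simps)
qed

lemma increasing_permutes_id:
  assumes \<sigma>: "\<sigma> permutes {..<n}" and "inversions n \<sigma> = {}"
  shows "\<sigma> = id"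
proof -
  have mono: "\<sigma> i < \<sigma> j" if "i < j" "j < n" for i j
  proof -
    have "\<not> \<sigma> j < \<sigma> i" using assms(2) that by (auto simp: inversions_def)
    moreover have "\<sigma> i \<noteq> \<sigma> j" using permutes_inj[OF \<sigma>] that by (metis injD less_irrefl)
    ultimately show ?thesis by simp
  qed
  have ge: "i \<le> \<sigma> i" if "i < n" for i
    using that
  proof (induction i)
    case (Suc i)
    then show ?case using mono[of i "Suc i"] by simp
  qed simp
  have "\<forall>i\<in>{..<n}. i \<le> \<sigma> i" using ge by simp
  then have "\<sigma> i = i" if "i < n" for i
    using permutes_natset_ge[OF \<sigma>] by simp
  then show ?thesis using \<sigma> by (auto simp: fun_eq_iff permutes_def)
qed

text \<open>A permutation with inversions has inverted strands at some adjacent positions \<open>k\<close>, \<open>k + 1\<close>;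
  exchanging them removes exactly one inversion.\<close>

lemma exists_expression:
  "\<sigma> permutes {..<n} \<Longrightarrow> \<exists>ks. (\<forall>k\<in>set ks. Suc k < n) \<and> transposition_product ks = \<sigma>
    \<and> length ks = card (inversions n \<sigma>)"
proof (induction "card (inversions n \<sigma>)" arbitrary: \<sigma>)
  case 0
  then have "\<sigma> = id" by (intro increasing_permutes_id) auto
  then show ?case using 0 by (intro exI[of _ "[]"]) (auto simp: transposition_product_simps)
next
  case (Suc m)
  have "\<exists>k. Suc k < n \<and> \<not> source \<sigma> k < source \<sigma> (Suc k)"
  proof (rule ccontr)
    assume "\<not> ?thesis"
    then have step: "source \<sigma> k < source \<sigma> (Suc k)" if "Suc k < n" for k using that by blast
    have mono: "source \<sigma> i < source \<sigma> j" if "i < j" "j < n" for i j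
      using that by (induction j) (auto simp: less_Suc_eq intro: step less_trans[OF _ step])
    have "inversions n (source \<sigma>) = {}" using mono by (fastforce simp: inversions_def)
    then have "source \<sigma> = id" by (rule increasing_permutes_id[OF permutes_inv[OF Suc.prems]])
    then have "\<sigma> = id" using inv_inv_eq[OF permutes_bij[OF Suc.prems]] by simp
    then have "inversions n \<sigma> = {}" by (auto simp: inversions_def)
    then show False using Suc.hyps(2) by simp
  qed
  then obtain k where k: "Suc k < n" "\<not> source \<sigma> k < source \<sigma> (Suc k)" by blast
  let ?\<tau> = "adjacent k \<circ> \<sigma>"
  have \<tau>: "?\<tau> permutes {..<n}" using Suc.prems adjacent_permutes[OF k(1)] by (rule permutes_compose)
  have card: "Suc (card (inversions n ?\<tau>)) = card (inversions n \<sigma>)"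
    by (rule card_inversions_adjacent(2)[OF Suc.prems k])
  then obtain ks where ks: "\<forall>k\<in>set ks. Suc k < n" "transposition_product ks = ?\<tau>"
    "length ks = card (inversions n ?\<tau>)"
    using Suc.hyps(1)[OF _ \<tau>] Suc.hyps(2) by auto
  have "transposition_product (k # ks) = \<sigma>"
    using ks(2) by (simp add: transposition_product_simps fun_eq_iff)
  then show ?case using ks card k by (intro exI[of _ "k # ks"]) auto
qed

lemma reduced_expression_length:
  assumes "reduced_expression n \<sigma> ks" "\<sigma> permutes {..<n}"
  shows "length ks = card (inversions n \<sigma>)"
  using assms exists_expression[OF assms(2)] card_inversions_le[of ks n]
  unfolding reduced_expression_def by (metis le_antisym)

lemma exists_reduced_expression:
  assumes "\<sigma> permutes {..<n}"
  shows "\<exists>ks. reduced_expression n \<sigma> ks"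
  using exists_expression[OF assms] card_inversions_le unfolding reduced_expression_def by metis

text \<open>Crossing two strands for the first time turns the closed form for \<open>\<sigma>\<close> into the one for
  \<open>s\<^sub>k \<sigma>\<close>: only the tail sum at \<open>k + 1\<close> changes.\<close>

lemma braid_word_permutation_braid:
  fixes w :: "'g::group_add list"
  assumes \<sigma>: "\<sigma> permutes {..<length w}" and k: "Suc k < length w"
    and less: "source \<sigma> k < source \<sigma> (Suc k)"
  shows "braid_word k (permutation_braid \<sigma> w) = permutation_braid (adjacent k \<circ> \<sigma>) w"
proof -
  let ?n = "length w" and ?i = "source \<sigma> k" and ?j = "source \<sigma> (Suc k)"
  have j: "?j < ?n"
    using permutes_in_image[OF permutes_inv[OF \<sigma>], of "Suc k"] k by simp
  have at: "\<sigma> i = m \<longleftrightarrow> i = source \<sigma> m" for i m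
    using permutes_inv_eq[OF \<sigma>] by metis
  have \<sigma>ij: "\<sigma> ?i = k" "\<sigma> ?j = Suc k" by (auto simp: at)
  have other: "tail_sum (adjacent k \<circ> \<sigma>) w m = tail_sum \<sigma> w m" if "m \<noteq> Suc k" for m
  proof -
    have "m \<le> adjacent k a \<longleftrightarrow> m \<le> a" for a
      using that by (auto simp: Transposition.transpose_def)
    then show ?thesis by (simp add: tail_sum_def)
  qed
  have split: "[0..<?n] = [0..<?i] @ ?i # [Suc ?i..<?j] @ ?j # [Suc ?j..<?n]"
  proof -
    have "[0..<?n] = [0..<?j] @ [?j..<?n]" using j by (metis le_add1 less_imp_le plus_nat.add_0 le_add_diff_inverse upt_add_eq_append zero_le)
    also have "[0..<?j] = [0..<?i] @ [?i..<?j]" using less by (metis less_imp_le le_add_diff_inverse plus_nat.add_0 upt_add_eq_append zero_le)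
    finally show ?thesis using less j by (simp add: upt_conv_Cons)
  qed
  define F where "F xs = sum_list (map ((!) w) (filter (\<lambda>i. Suc (Suc k) \<le> \<sigma> i) xs))" for xs
  define p q r where "p = F [0..<?i]" and "q = F [Suc ?i..<?j]" and "r = F [Suc ?j..<?n]"
  have part: "sum_list (map ((!) w) (filter P xs)) = F xs"
    if "?i \<notin> set xs" "?j \<notin> set xs" and "\<And>i. i \<noteq> ?i \<Longrightarrow> i \<noteq> ?j \<Longrightarrow> P i \<longleftrightarrow> Suc (Suc k) \<le> \<sigma> i" for P xs
  proof -
    have "filter P xs = filter (\<lambda>i. Suc (Suc k) \<le> \<sigma> i) xs"
      using that(1,2) by (intro filter_cong[OF refl] that(3)) auto
    then show ?thesis by (simp add: F_def)
  qed
  have sum: "sum_list (map ((!) w) (filter P [0..<?n]))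
      = p + (if P ?i then w ! ?i else 0) + q + (if P ?j then w ! ?j else 0) + r"
    if "\<And>i. i \<noteq> ?i \<Longrightarrow> i \<noteq> ?j \<Longrightarrow> P i \<longleftrightarrow> Suc (Suc k) \<le> \<sigma> i" for P
    unfolding split p_def q_def r_def using less part[OF _ _ that] by (simp add: add.assoc)
  have big: "k \<le> \<sigma> i \<longleftrightarrow> Suc (Suc k) \<le> \<sigma> i" "Suc k \<le> \<sigma> i \<longleftrightarrow> Suc (Suc k) \<le> \<sigma> i"
    "Suc k \<le> adjacent k (\<sigma> i) \<longleftrightarrow> Suc (Suc k) \<le> \<sigma> i" if "i \<noteq> ?i" "i \<noteq> ?j" for i
  proof -
    have "\<sigma> i \<noteq> k" "\<sigma> i \<noteq> Suc k" using that by (auto simp: at)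
    then show "k \<le> \<sigma> i \<longleftrightarrow> Suc (Suc k) \<le> \<sigma> i" "Suc k \<le> \<sigma> i \<longleftrightarrow> Suc (Suc k) \<le> \<sigma> i"
      "Suc k \<le> adjacent k (\<sigma> i) \<longleftrightarrow> Suc (Suc k) \<le> \<sigma> i" by (auto simp: Transposition.transpose_def)
  qed
  have T: "tail_sum \<sigma> w k = p + w ! ?i + q + w ! ?j + r"
    "tail_sum \<sigma> w (Suc k) = p + q + w ! ?j + r"
    "tail_sum \<sigma> w (Suc (Suc k)) = p + q + r"
    "tail_sum (adjacent k \<circ> \<sigma>) w (Suc k) = p + w ! ?i + q + r"
    unfolding tail_sum_def using \<sigma>ij by (simp_all add: sum big)
  note group = diff_conv_add_uminus minus_add minus_minus add.assoc minus_add_cancel add_minus_cancel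
  let ?v = "permutation_braid \<sigma> w"
  have v: "?v ! k = tail_sum \<sigma> w k - tail_sum \<sigma> w (Suc k)"
    "?v ! Suc k = tail_sum \<sigma> w (Suc k) - tail_sum \<sigma> w (Suc (Suc k))"
    using k by (simp_all add: nth_permutation_braid)
  have new: "?v ! k + ?v ! Suc k - ?v ! k = tail_sum \<sigma> w k - tail_sum (adjacent k \<circ> \<sigma>) w (Suc k)"
    "?v ! k = tail_sum (adjacent k \<circ> \<sigma>) w (Suc k) - tail_sum \<sigma> w (Suc (Suc k))"
    unfolding v T by (simp_all only: group)
  show ?thesis
  proof (rule nth_equalityI)
    show "length (braid_word k ?v) = length (permutation_braid (adjacent k \<circ> \<sigma>) w)"
      by (simp add: braid_word_def)
    fix m assume "m < length (braid_word k ?v)"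
    then have m: "m < ?n" by (simp add: braid_word_def split: if_splits)
    have "braid_word k ?v ! m = (if m = Suc k then ?v ! k
        else if m = k then ?v ! k + ?v ! Suc k - ?v ! k else ?v ! m)"
      using k m by (simp add: braid_word_def nth_list_update)
    also have "\<dots> = tail_sum (adjacent k \<circ> \<sigma>) w m - tail_sum (adjacent k \<circ> \<sigma>) w (Suc m)"
    proof -
      consider "m = Suc k" | "m = k" | "m \<noteq> Suc k" "m \<noteq> k" by blast
      then show ?thesis
      proof cases
        case 1
        then show ?thesis using new(2) other[of "Suc (Suc k)"] by simp
      next
        case 2
        then show ?thesis using new(1) other[of k] by simp
      next
        case 3
        then show ?thesis using other[of m] other[of "Suc m"] nth_permutation_braid[OF m] by simp
      qed
    qed
    finally show "braid_word k ?v ! m = permutation_braid (adjacent k \<circ> \<sigma>) w ! m"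
      using m by (simp add: nth_permutation_braid)
  qed
qed

lemma tail_sum_id: "tail_sum id w k = sum_list (drop k w)"
proof -
  have "filter (\<lambda>i. k \<le> id i) [0..<n] = [k..<n]" for n
    by (induction n) auto
  then have "tail_sum id w k = sum_list (map ((!) w) [k..<length w])" by (simp add: tail_sum_def)
  also have "map ((!) w) [k..<length w] = drop k w"
    by (rule nth_equalityI) auto
  finally show ?thesis .
qed

lemma permutation_braid_id [simp]: "permutation_braid id w = w"
  by (rule nth_equalityI)
    (auto simp: nth_permutation_braid tail_sum_id Cons_nth_drop_Suc[symmetric])

definition braid_words :: "nat list \<Rightarrow> 'g::group_add list \<Rightarrow> 'g list" where
  "braid_words ks = foldr (\<lambda>k F. braid_word k \<circ> F) ks id"

lemma length_braid_words [simp]: "length (braid_words ks w) = length w"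
  by (induction ks) (simp_all add: braid_words_def braid_word_def)

text \<open>In a reduced expression every crossing is a first crossing; hence the choice of the expression
  does not matter.\<close>

lemma braid_words_reduced:
  assumes "\<forall>k\<in>set ks. Suc k < length w"
    and "length ks = card (inversions (length w) (transposition_product ks))"
  shows "braid_words ks w = permutation_braid (transposition_product ks) w"
  using assms
proof (induction ks)
  case Nil
  show ?case unfolding transposition_product_simps permutation_braid_id by (simp add: braid_words_def)
next
  case (Cons k ks)
  let ?\<sigma> = "transposition_product ks" and ?n = "length w"
  have k: "Suc k < ?n" and ks: "\<forall>k\<in>set ks. Suc k < ?n" using Cons.prems(1) by auto
  have \<sigma>: "?\<sigma> permutes {..<?n}" by (rule transposition_product_permutes[OF ks])
  have card: "Suc (length ks) = card (inversions ?n (adjacent k \<circ> ?\<sigma>))"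
    using Cons.prems(2) by (simp only: transposition_product_simps list.size add_Suc_right add_0_right)
  have le: "card (inversions ?n ?\<sigma>) \<le> length ks" by (rule card_inversions_le[OF ks])
  have less: "source ?\<sigma> k < source ?\<sigma> (Suc k)"
    using card_inversions_adjacent(2)[OF \<sigma> k] card le by linarith
  then have "length ks = card (inversions ?n ?\<sigma>)"
    using card_inversions_adjacent(1)[OF \<sigma> k] card by simp
  then have "braid_words ks w = permutation_braid ?\<sigma> w" using Cons.IH ks by blast
  then have "braid_words (k # ks) w = permutation_braid (adjacent k \<circ> ?\<sigma>) w"
    using braid_word_permutation_braid[OF \<sigma> k less] by (simp add: braid_words_def)
  then show ?case by (simp only: transposition_product_simps)
qed

lemma bij_braid_word: "bij (braid_word k :: 'g::group_add list \<Rightarrow> 'g list)"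
proof -
  define unbraid :: "'g list \<Rightarrow> 'g list" where
    "unbraid w = (if Suc k < length w
      then w[k := w ! Suc k, Suc k := - (w ! Suc k) + w ! k + w ! Suc k] else w)" for w
  note group = diff_conv_add_uminus minus_add minus_minus add.assoc minus_add_cancel add_minus_cancel
  have conj: "- a + (a + b - a) + a = b" "a + (- a + b + a) - a = b" for a b :: 'g
    by (simp_all only: group add.right_inverse add.right_neutral add.left_inverse)
  have "unbraid (braid_word k w) = w" for w
    by (rule nth_equalityI) (auto simp: unbraid_def braid_word_def nth_list_update conj)
  moreover have "braid_word k (unbraid w) = w" for w
    by (rule nth_equalityI) (auto simp: unbraid_def braid_word_def nth_list_update conj)
  ultimately show ?thesis by (intro o_bij[of unbraid]) (simp_all add: fun_eq_iff)
qed

lemma bij_braid_words: "bij (braid_words ks)"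
proof (induction ks)
  case Nil
  show ?case using bij_id by (simp add: braid_words_def id_def)
next
  case (Cons k ks)
  have "braid_words (k # ks) = braid_word k \<circ> (braid_words ks :: 'a list \<Rightarrow> _)"
    by (simp add: braid_words_def)
  then show ?case using bij_comp[OF Cons bij_braid_word] by metis
qed

lemma word_linear_bij:
  assumes "bij \<phi>"
  shows "word_linear \<phi> t (\<phi> u) = t u"
proof -
  have "{v. t v \<noteq> (\<lambda>_. 0) \<and> \<phi> v = \<phi> u} = (if t u \<noteq> (\<lambda>_. 0) then {u} else {})"
    using bij_is_inj[OF assms] by (auto dest: injD)
  then show ?thesis by (auto simp: word_linear_def fun_eq_iff)
qed

lemma foldr_braiding_apply: "foldr (\<lambda>k F. braiding k \<circ> F) ks id t (braid_words ks u) = t u"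
  by (induction ks) (simp_all add: braid_words_def braiding_def word_linear_bij[OF bij_braid_word])

text \<open>Braid words act bijectively, so \<open>\<Psi>\<^sub>\<sigma>\<close> just relabels the words that carry the coefficients.  The
  three parts evaluate \<open>\<Psi>\<^sub>\<sigma> t\<close> at words in closed form, show that all words of length \<open>n\<close> are of this
  kind, and deal with words of other lengths.\<close>

lemma braiding_perm_apply:
  assumes \<sigma>: "\<sigma> permutes {..<n}"
  shows "length u = n \<Longrightarrow> braiding_perm n \<sigma> t (permutation_braid \<sigma> u) = t u"
    and "length w = n \<Longrightarrow> \<exists>u. length u = n \<and> permutation_braid \<sigma> u = w"
    and "length w \<noteq> n \<Longrightarrow> \<exists>u. length u \<noteq> n \<and> braiding_perm n \<sigma> t w = t u"
proof -
  define ks where "ks = (SOME ks. reduced_expression n \<sigma> ks)"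
  have red: "reduced_expression n \<sigma> ks"
    unfolding ks_def using exists_reduced_expression[OF \<sigma>] by (rule someI_ex)
  then have len: "length ks = card (inversions n \<sigma>)" by (rule reduced_expression_length[OF _ \<sigma>])
  have word: "\<forall>k\<in>set ks. Suc k < n" "transposition_product ks = \<sigma>"
    using red unfolding reduced_expression_def by auto
  have eq: "braid_words ks u = permutation_braid \<sigma> u" if "length u = n" for u :: "'a list"
    using braid_words_reduced[of ks u] word len that by simp
  have at_word: "braiding_perm n \<sigma> t (braid_words ks u) = t u" for u
    unfolding braiding_perm_def ks_def[symmetric] by (rule foldr_braiding_apply)
  have surj: "\<exists>u. w = braid_words ks u" for w :: "'a list"
    by (rule surjD[OF bij_is_surj[OF bij_braid_words]])
  show "braiding_perm n \<sigma> t (permutation_braid \<sigma> u) = t u" if "length u = n"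
    using at_word[of u] eq[OF that] by simp
  show "\<exists>u. length u = n \<and> permutation_braid \<sigma> u = w" if "length w = n"
  proof -
    obtain u where u: "w = braid_words ks u" using surj by blast
    then have "length u = n" using that by simp
    then show ?thesis using eq[of u] u by metis
  qed
  show "\<exists>u. length u \<noteq> n \<and> braiding_perm n \<sigma> t w = t u" if "length w \<noteq> n"
    using surj[of w] at_word that by auto
qed


section \<open>Woronowicz relations\<close>

text \<open>The half twist \<open>w\<^sub>0\<close>; it fixes \<open>i \<ge> n\<close> in order to be a permutation of \<open>{..<n}\<close> in the sense
  of \<^const>\<open>permutes\<close>.\<close>

definition reversal :: "nat \<Rightarrow> nat \<Rightarrow> nat" where
  "reversal n i = (if i < n then n - Suc i else i)"

lemma reversal_involution [simp]: "reversal n (reversal n i) = i"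
  by (auto simp: reversal_def)

lemma reversal_permutes: "reversal n permutes {..<n}"
proof (rule bij_imp_permutes)
  show "bij_betw (reversal n) {..<n} {..<n}"
    by (rule bij_betw_byWitness[where f' = "reversal n"]) (auto simp: reversal_def)
qed (simp add: reversal_def)

text \<open>Reversing and negating the letters turns a tail sum into the sum of the same letters,
  negated and in the opposite order, which is the negative of the sum.\<close>

lemma tail_sum_star_word:
  fixes v :: "'g::group_add list"
  shows "tail_sum (\<sigma> \<circ> reversal (length v)) (star_word v) k = - tail_sum \<sigma> v k"
proof -
  let ?n = "length v" and ?P = "\<lambda>i. k \<le> \<sigma> i"
  have rev: "map (reversal ?n) [0..<?n] = rev [0..<?n]"
    by (rule nth_equalityI) (auto simp: rev_nth reversal_def)
  have "map ((!) (star_word v)) (filter (?P \<circ> reversal ?n) [0..<?n])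
      = map (\<lambda>i. - v ! reversal ?n i) (filter (?P \<circ> reversal ?n) [0..<?n])"
    by (rule map_cong) (auto simp: rev_nth reversal_def)
  also have "\<dots> = map (\<lambda>i. - v ! i) (filter ?P (map (reversal ?n) [0..<?n]))"
    by (simp add: filter_map o_def)
  also have "\<dots> = star_word (map ((!) v) (filter ?P [0..<?n]))"
    unfolding rev by (simp add: rev_map rev_filter[symmetric] o_def)
  finally have "sum_list (map ((!) (star_word v)) (filter (?P \<circ> reversal ?n) [0..<?n]))
      = - sum_list (map ((!) v) (filter ?P [0..<?n]))"
    by (simp only: sum_list_star_word)
  then show ?thesis by (simp add: tail_sum_def o_def)
qed

text \<open>The sums telescope, since no letter is moved to a position beyond the end of the word.\<close>

lemma sum_drop_permutation_braid:
  fixes v :: "'g::group_add list"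
  assumes \<sigma>: "\<sigma> permutes {..<length v}" and "k \<le> length v"
  shows "sum_list (drop k (permutation_braid \<sigma> v)) = tail_sum \<sigma> v k"
  using assms(2)
proof (induction "length v - k" arbitrary: k)
  case 0
  have "\<not> length v \<le> \<sigma> i" if "i < length v" for i
    using permutes_in_image[OF \<sigma>, of i] that by simp
  then have "filter (\<lambda>i. length v \<le> \<sigma> i) [0..<length v] = []" by (auto simp: filter_empty_conv)
  then have "tail_sum \<sigma> v (length v) = 0" by (simp add: tail_sum_def)
  then show ?case using 0 by simp
next
  case (Suc m)
  then have k: "k < length v" by simp
  have "sum_list (drop (Suc k) (permutation_braid \<sigma> v)) = tail_sum \<sigma> v (Suc k)"
    using Suc by simp
  then show ?case
    using k by (simp add: Cons_nth_drop_Suc[symmetric] nth_permutation_braid)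
qed

lemma sum_list_permutation_braid:
  fixes v :: "'g::group_add list"
  assumes "\<sigma> permutes {..<length v}"
  shows "sum_list (permutation_braid \<sigma> v) = sum_list v"
proof -
  have "sum_list (permutation_braid \<sigma> v) = tail_sum \<sigma> v 0"
    using sum_drop_permutation_braid[OF assms, of 0] by simp
  also have "\<dots> = tail_sum id v 0" by (simp add: tail_sum_def)
  finally show ?thesis by (simp add: tail_sum_id)
qed

text \<open>The star exchanges \<open>\<Psi>\<close> with its inverse, up to reversing positions; composing with the half
  twist turns positive braids into positive braids again.\<close>

lemma permutation_braid_star_word:
  fixes v :: "'g::group_add list"
  assumes \<sigma>: "\<sigma> permutes {..<length v}"
  shows "permutation_braid (\<sigma> \<circ> reversal (length v)) (star_word v)
    = permutation_braid (reversal (length v)) (star_word (permutation_braid \<sigma> v))"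
proof (rule nth_equalityI)
  let ?n = "length v" and ?u = "permutation_braid \<sigma> v"
  have T: "tail_sum (reversal ?n) (star_word ?u) k = - tail_sum \<sigma> v k" if "k \<le> ?n" for k
  proof -
    have "tail_sum (id \<circ> reversal (length ?u)) (star_word ?u) k = - tail_sum id ?u k"
      by (rule tail_sum_star_word)
    then show ?thesis
      using sum_drop_permutation_braid[OF \<sigma> that] by (simp add: tail_sum_id)
  qed
  fix k assume "k < length (permutation_braid (\<sigma> \<circ> reversal ?n) (star_word v))"
  then have k: "k < ?n" by simp
  then show "permutation_braid (\<sigma> \<circ> reversal ?n) (star_word v) ! k
      = permutation_braid (reversal ?n) (star_word ?u) ! k"
    by (simp add: nth_permutation_braid tail_sum_star_word T)
qed simp

text \<open>By the previous lemma, the coefficient of \<open>\<Psi>\<^sub>\<sigma>(t\<^sup>\<dagger>)\<close> at \<open>w\<close> is the conjugate of the coefficient of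
  \<open>\<Psi>\<^bsub>\<sigma>w\<^sub>0\<^esub> t\<close> at the half twist of the starred word.  As \<open>\<sigma> \<mapsto> \<sigma>w\<^sub>0\<close> permutes the symmetric group and
  changes all signs by the same factor, the coefficient of the antisymmetriser at \<open>w\<close> is, up to sign
  and conjugation, another coefficient of the antisymmetriser of \<open>t\<close>.\<close>

lemma antisymmetriser_dagger:
  fixes t :: "'g::group_add tensor"
  assumes t: "t \<in> tensor_deg C n" and zero: "antisymmetriser n t = 0"
  shows "antisymmetriser n (dagger t) = 0"
proof (intro ext)
  fix w :: "'g list" and x
  let ?perms = "{\<sigma>. \<sigma> permutes {..<n}}"
  have "(\<Sum>\<sigma>\<in>?perms. of_int (sign \<sigma>) * braiding_perm n \<sigma> (dagger t) w x) = 0"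
  proof (cases "length w = n")
    case False
    have "braiding_perm n \<sigma> (dagger t) w x = 0" if \<sigma>: "\<sigma> \<in> ?perms" for \<sigma>
    proof -
      obtain u where u: "length u \<noteq> n" "braiding_perm n \<sigma> (dagger t) w = dagger t u"
        using braiding_perm_apply(3)[of \<sigma> n w "dagger t"] \<sigma> False by blast
      have "t (star_word u) (x + sum_list u) = 0"
        using t u(1) unfolding tensor_deg_iff by (metis length_map length_rev)
      then have "dagger t u x = 0" by (simp add: dagger_def)
      then show ?thesis by (simp only: u(2))
    qed
    then show ?thesis by (simp add: sum.neutral)
  next
    case True
    let ?r = "reversal n"
    let ?w = "permutation_braid ?r (star_word w)" and ?x = "x + sum_list w"
    have summand: "of_int (sign \<sigma>) * braiding_perm n \<sigma> (dagger t) w x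
        = of_int (sign ?r) * cnj (of_int (sign (\<sigma> \<circ> ?r)) * braiding_perm n (\<sigma> \<circ> ?r) t ?w ?x)"
      if "\<sigma> \<in> ?perms" for \<sigma>
    proof -
      have \<sigma>: "\<sigma> permutes {..<n}" using that by simp
      have \<sigma>r: "\<sigma> \<circ> ?r permutes {..<n}" using reversal_permutes \<sigma> by (rule permutes_compose)
      obtain v where v: "length v = n" "permutation_braid \<sigma> v = w"
        using braiding_perm_apply(2)[OF \<sigma> True] by blast
      have "permutation_braid (\<sigma> \<circ> ?r) (star_word v) = ?w"
        using permutation_braid_star_word[of \<sigma> v] \<sigma> v by simp
      then have "braiding_perm n (\<sigma> \<circ> ?r) t ?w = t (star_word v)"
        using braiding_perm_apply(1)[OF \<sigma>r, of "star_word v" t] v(1) by simp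
      moreover have "braiding_perm n \<sigma> (dagger t) w = dagger t v"
        using braiding_perm_apply(1)[OF \<sigma> v(1), of "dagger t"] v(2) by simp
      moreover have "sum_list v = sum_list w"
        using sum_list_permutation_braid[of \<sigma> v] \<sigma> v by simp
      moreover have "sign \<sigma> = sign ?r * sign (\<sigma> \<circ> ?r)"
      proof -
        have "permutation \<sigma>" "permutation ?r"
          using \<sigma> reversal_permutes permutation_permutes finite_lessThan by blast+
        then show ?thesis by (simp add: sign_compose sign_idempotent mult.commute mult.left_commute)
      qed
      ultimately show ?thesis by (simp add: dagger_def)
    qed
    have "(\<Sum>\<sigma>\<in>?perms. of_int (sign \<sigma>) * braiding_perm n \<sigma> (dagger t) w x)
        = (\<Sum>\<sigma>\<in>?perms. of_int (sign ?r) * cnj (of_int (sign (\<sigma> \<circ> ?r)) * braiding_perm n (\<sigma> \<circ> ?r) t ?w ?x))"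
      using summand by (intro sum.cong) auto
    also have "\<dots> = (\<Sum>\<tau>\<in>?perms. of_int (sign ?r) * cnj (of_int (sign \<tau>) * braiding_perm n \<tau> t ?w ?x))"
    proof (rule sum.reindex_bij_witness[of _ "\<lambda>\<tau>. \<tau> \<circ> ?r" "\<lambda>\<sigma>. \<sigma> \<circ> ?r"])
      show "\<sigma> \<circ> ?r \<in> ?perms" if "\<sigma> \<in> ?perms" for \<sigma>
        using that permutes_compose[OF reversal_permutes] by simp
      then show "\<sigma> \<circ> ?r \<in> ?perms" if "\<sigma> \<in> ?perms" for \<sigma> using that .
    qed (simp_all add: fun_eq_iff o_assoc)
    also have "\<dots> = of_int (sign ?r) * cnj (antisymmetriser n t ?w ?x)"
      by (simp add: antisymmetriser_def sum_distrib_left)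
    finally show ?thesis using zero by simp
  qed
  then show "antisymmetriser n (dagger t) w x = 0 w x" by (simp add: antisymmetriser_def)
qed

lemma braiding_perm_id: "braiding_perm n id t w = t w"
proof (cases "length w = n")
  case True
  then show ?thesis using braiding_perm_apply(1)[OF permutes_id, of w n t] by simp
next
  case False
  have "ks = []" if ks: "reduced_expression n id ks" for ks
  proof -
    have "(\<forall>k\<in>set []. Suc k < n) \<and> transposition_product [] = id \<longrightarrow> length ks \<le> length ([] :: nat list)"
      using ks unfolding reduced_expression_def by blast
    then show ?thesis unfolding transposition_product_simps by simp
  qed
  moreover have "reduced_expression n id (SOME ks. reduced_expression n id ks)"
    using exists_reduced_expression[OF permutes_id] by (rule someI_ex)
  ultimately have "(SOME ks. reduced_expression n id ks) = []" by metis
  then show ?thesis by (simp add: braiding_perm_def)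
qed

text \<open>The identity is the only permutation of fewer than two strands; consequently the Woronowicz
  relations start in degree 2.\<close>

lemma antisymmetriser_low_degree:
  assumes "n < 2"
  shows "antisymmetriser n t = t"
proof -
  have "{..<n} = {} \<or> {..<n} = {0}" using assms by (auto simp: lessThan_empty_iff less_2_cases_iff)
  then have "\<sigma> permutes {..<n} \<longleftrightarrow> \<sigma> = id" for \<sigma>
    by (elim disjE) (simp_all only: permutes_empty permutes_sing)
  then have "{\<sigma>. \<sigma> permutes {..<n}} = {id}" by simp
  then show ?thesis by (simp add: antisymmetriser_def braiding_perm_id fun_eq_iff)
qed

lemma antisymmetriser_2:
  fixes t :: "'g::group_add tensor"
  shows "antisymmetriser 2 t [a + b - a, a] x = t [a + b - a, a] x - t [a, b] x"
proof -
  let ?s = "Transposition.transpose 0 (Suc 0)"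
  have two: "{..<2} = {0, Suc 0}" by auto
  have perms: "{\<sigma>. \<sigma> permutes {..<2}} = {id, ?s}"
    unfolding two permutes_doubleton_iff by auto
  have ne: "id \<noteq> ?s" by (auto simp: fun_eq_iff Transposition.transpose_def)
  have s: "?s permutes {..<2}" using perms by blast
  have "permutation_braid ?s [a, b] = [a + b - a, a]"
    by (simp add: permutation_braid_def tail_sum_def upt_rec Transposition.transpose_def)
  then have "braiding_perm 2 ?s t [a + b - a, a] = t [a, b]"
    using braiding_perm_apply(1)[OF s, of "[a, b]" t] by simp
  moreover have "sign ?s = - 1" by (simp add: sign_swap_id)
  ultimately show ?thesis
    unfolding antisymmetriser_def perms using ne by (simp add: braiding_perm_id)
qed

lemma antisymmetriser_2_zero_iff:
  fixes t :: "'g::group_add tensor"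
  assumes t: "t \<in> tensor_deg C 2"
  shows "antisymmetriser 2 t = 0 \<longleftrightarrow> (\<forall>a b x. t [a + b - a, a] x = t [a, b] x)"
proof
  assume "antisymmetriser 2 t = 0"
  then have "antisymmetriser 2 t [a + b - a, a] x = 0" for a b x by simp
  then show "\<forall>a b x. t [a + b - a, a] x = t [a, b] x" by (simp add: antisymmetriser_2)
next
  assume sym: "\<forall>a b x. t [a + b - a, a] x = t [a, b] x"
  have "antisymmetriser 2 t w x = 0" for w x
  proof (cases "length w = 2")
    case True
    then obtain c a where w: "w = [c, a]" by (auto simp: numeral_2_eq_2 length_Suc_conv)
    define b where "b = - a + c + a"
    have "a + b - a = c" unfolding b_def by (simp add: add.assoc flip: diff_conv_add_uminus)
    then show ?thesis using antisymmetriser_2[of t a b x] sym[rule_format, of a b x] w by simp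
  next
    case False
    have "braiding_perm 2 \<sigma> t w x = 0" if \<sigma>: "\<sigma> permutes {..<2}" for \<sigma>
    proof -
      obtain u where u: "length u \<noteq> 2" "braiding_perm 2 \<sigma> t w = t u"
        using braiding_perm_apply(3)[OF \<sigma> False] by blast
      then show ?thesis using t unfolding tensor_deg_iff by metis
    qed
    then show ?thesis by (simp add: antisymmetriser_def sum.neutral)
  qed
  then show "antisymmetriser 2 t = 0" by (simp add: fun_eq_iff)
qed

section \<open>The three families of relations\<close>

lemma product_relation_deg: "finite C \<Longrightarrow> product_relation C z \<in> tensor_deg C 2"
  by (auto simp: tensor_deg_iff product_relation_apply split: if_splits)

lemma product_relation_exchange:
  assumes "finite C" "a \<in> C" "b \<in> C" "a + b - a \<in> C"
  shows "product_relation C z [a, b] x = product_relation C z [a + b - a, a] x"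
  using assms by (auto simp: product_relation_apply)

lemma dagger_product_relation:
  assumes "finite C" and C: "\<And>a. a \<in> C \<Longrightarrow> - a \<in> C"
  shows "dagger (product_relation C z) = product_relation C (- z)"
proof (intro ext)
  fix w and x :: 'a
  have C': "- a \<in> C \<longleftrightarrow> a \<in> C" for a using C[of a] C[of "- a"] by auto
  have "(\<exists>a\<in>C. \<exists>b\<in>C. star_word w = [a, b] \<and> a + b = z) \<longleftrightarrow> (\<exists>a\<in>C. \<exists>b\<in>C. w = [a, b] \<and> a + b = - z)"
  proof
    assume "\<exists>a\<in>C. \<exists>b\<in>C. star_word w = [a, b] \<and> a + b = z"
    then obtain a b where ab: "a \<in> C" "b \<in> C" "star_word w = [a, b]" "a + b = z" by blast
    have "w = star_word (star_word w)" by (simp add: rev_map)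
    then have "w = [- b, - a]" unfolding ab(3) by simp
    moreover have "- b + - a = - z" using ab(4) by (metis minus_add)
    ultimately show "\<exists>a\<in>C. \<exists>b\<in>C. w = [a, b] \<and> a + b = - z" using ab C by blast
  next
    assume "\<exists>a\<in>C. \<exists>b\<in>C. w = [a, b] \<and> a + b = - z"
    then obtain a b where ab: "a \<in> C" "b \<in> C" "w = [a, b]" "a + b = - z" by blast
    have "- b + - a = z" using ab(4) by (metis minus_add minus_minus)
    then show "\<exists>a\<in>C. \<exists>b\<in>C. star_word w = [a, b] \<and> a + b = z" using ab C by auto
  qed
  then show "dagger (product_relation C z) w x = product_relation C (- z) w x"
    by (simp add: dagger_def product_relation_apply[OF assms(1)])
qed

text \<open>The three families are treated together: each contains the product relations with \<open>z \<noteq> 0\<close>,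
  is stable under \<^const>\<open>dagger\<close>, and has the exchange symmetry of coefficients in degree 2.\<close>

locale calculus_relations =
  fixes C C10 C01 :: "'g::group_add set" and S :: "'g tensor set"
  assumes finite_alphabet: "finite C"
    and splitting: "C = C10 \<union> C01" "C10 \<inter> C01 = {}"
    and inverse_bij: "bij_betw uminus C10 C01"
    and cases: "S = relations_L C \<or> S = relations_LL C \<or> (bicovariant C \<and> S = relations_Wor C)"
begin

lemma inverse: "a \<in> C10 \<Longrightarrow> - a \<in> C01" "a \<in> C01 \<Longrightarrow> - a \<in> C10"
proof -
  show "a \<in> C10 \<Longrightarrow> - a \<in> C01" using inverse_bij bij_betwE by blast
  assume "a \<in> C01"
  then obtain b where "b \<in> C10" "a = - b" using inverse_bij unfolding bij_betw_def by blast
  then show "- a \<in> C10" by simp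
qed

lemma inverse_C: "a \<in> C \<Longrightarrow> - a \<in> C"
  using inverse splitting(1) by blast

text \<open>The only Woronowicz relation of degree below 2 is \<open>0\<close>, which is also homogeneous of degree 2.\<close>

lemma relation_cases:
  assumes "t \<in> S"
  obtains z where "t = product_relation C z"
  | n where "n \<ge> 2" "t \<in> tensor_deg C n" "antisymmetriser n t = 0" "S = relations_Wor C"
proof -
  consider "S = relations_L C \<or> S = relations_LL C" | "S = relations_Wor C" using cases by blast
  then show ?thesis
  proof cases
    case 1
    then show ?thesis using assms that(1) unfolding relations_L_def relations_LL_def by blast
  next
    case 2
    then obtain n where n: "t \<in> tensor_deg C n" "antisymmetriser n t = 0"
      using assms unfolding relations_Wor_def by (auto simp: tensor_algebra_simps)
    show ?thesis
    proof (cases "n < 2")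
      case True
      then have "t = 0" using antisymmetriser_low_degree n(2) by metis
      then have "t \<in> tensor_deg C 2" "antisymmetriser 2 t = 0"
        using antisymmetriser_2_zero_iff[of t C] tensor_deg_closed(1) by auto
      then show ?thesis using that(2)[of 2] 2 by simp
    qed (use that(2)[of n] n 2 in simp)
  qed
qed

lemma relation_deg: "t \<in> S \<Longrightarrow> \<exists>n\<ge>2. t \<in> tensor_deg C n"
  using product_relation_deg[OF finite_alphabet] by (elim relation_cases) blast+

lemma relations_tensors: "t \<in> S \<Longrightarrow> t \<in> tensors C"
  using relation_deg unfolding tensor_deg_iff by blast

text \<open>In the bicovariant case \<open>b \<in> C\<close> if and only if \<open>a + b - a \<in> C\<close>; so the coefficients of a product
  relation are invariant under the braiding, which means that it is killed by \<open>id - \<Psi>\<close>.\<close>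

lemma product_relation_in:
  assumes "z \<noteq> 0"
  shows "product_relation C z \<in> S"
proof -
  have "product_relation C z \<in> relations_Wor C" if bi: "bicovariant C"
  proof -
    have "product_relation C z [a + b - a, a] x = product_relation C z [a, b] x" for a b x
    proof -
      have "a + b - a \<in> C \<longleftrightarrow> b \<in> C"
        using bi unfolding bicovariant_def
        by (metis add.assoc add_minus_cancel diff_conv_add_uminus minus_add_cancel minus_minus add.right_neutral add.left_inverse)
      then show ?thesis by (auto simp: product_relation_apply[OF finite_alphabet])
    qed
    then have "antisymmetriser 2 (product_relation C z) = 0"
      using antisymmetriser_2_zero_iff[OF product_relation_deg[OF finite_alphabet]] by blast
    then show ?thesis
      using product_relation_deg[OF finite_alphabet]
      unfolding relations_Wor_def by (auto simp: tensor_algebra_simps)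
  qed
  then show ?thesis
    using cases assms unfolding relations_L_def relations_LL_def by blast
qed

lemma dagger_relation:
  assumes "t \<in> S"
  shows "dagger t \<in> S"
  using assms
proof (cases rule: relation_cases)
  case (1 z)
  have d: "dagger t = product_relation C (- z)"
    unfolding 1 by (rule dagger_product_relation[OF finite_alphabet inverse_C])
  show ?thesis
  proof (cases "z = 0")
    case True
    then show ?thesis using d assms 1 by simp
  next
    case False
    then show ?thesis using d product_relation_in[of "- z"] by simp
  qed
next
  case (2 n)
  have "dagger t \<in> tensor_deg C n"
  proof -
    have nz: "length w = n" "set w \<subseteq> C" if "dagger t w x \<noteq> 0" for w x
    proof -
      have *: "t (star_word w) (x + sum_list w) \<noteq> 0" using that by (simp add: dagger_def)
      then show "length w = n" using 2(2) unfolding tensor_deg_iff by (metis length_map length_rev)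
      have "set (star_word w) \<subseteq> C" using * 2(2) unfolding tensor_deg_iff tensors_iff by blast
      then have "- a \<in> C" if "a \<in> set w" for a using that by auto
      then show "set w \<subseteq> C" using inverse_C by (metis minus_minus subsetI)
    qed
    have "{w. dagger t w \<noteq> (\<lambda>_. 0)} \<subseteq> {w. set w \<subseteq> C \<and> length w = n}"
      using nz by (auto simp: fun_eq_iff) blast
    then have "finite {w. dagger t w \<noteq> (\<lambda>_. 0)}"
      using finite_lists_length_eq[OF finite_alphabet] finite_subset by blast
    then show ?thesis using nz unfolding tensor_deg_iff tensors_iff by blast
  qed
  then show ?thesis
    using antisymmetriser_dagger[OF 2(2,3)] unfolding 2(4) relations_Wor_def
    by (auto simp: tensor_algebra_simps)
qed

text \<open>The braiding preserves the sum of a word, on which the coefficients of a product relation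
  depend, and the antisymmetry relations of degree 2 are the invariants of the braiding.\<close>

lemma relation_exchange_symmetric:
  assumes "t \<in> S" "a \<in> C" "b \<in> C" "a + b - a \<in> C"
  shows "t [a, b] x = t [a + b - a, a] x"
  using assms(1)
proof (cases rule: relation_cases)
  case (1 z)
  then show ?thesis using product_relation_exchange[OF finite_alphabet assms(2-4)] by simp
next
  case (2 n)
  show ?thesis
  proof (cases "n = 2")
    case True
    then show ?thesis using antisymmetriser_2_zero_iff[of t C] 2 by simp
  next
    case False
    have "t w x = 0" if "length w = 2" for w using 2(2) that False unfolding tensor_deg_iff by metis
    then show ?thesis by simp
  qed
qed

abbreviation T where "T \<equiv> bihomogenise C10 C01 S"

lemma components_closed: "T \<subseteq> tensors C"
  using relations_tensors by (auto simp: bihomogenise_def)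

lemma components_bihomogeneous:
  assumes "t \<in> T"
  shows "\<exists>p q. t \<in> tensor_bideg C C10 C01 p q \<and> p + q \<ge> 2"
proof -
  obtain p q s where s: "s \<in> S" "t = bihom_component C10 C01 p q s"
    using assms unfolding bihomogenise_def by blast
  obtain n where n: "n \<ge> 2" "s \<in> tensor_deg C n" using relation_deg[OF s(1)] by blast
  have t: "t \<in> tensor_bideg C C10 C01 p q"
    unfolding s(2) by (rule bihom_component_bideg[OF relations_tensors[OF s(1)]])
  show ?thesis
  proof (cases "t = 0")
    case True
    have "t \<in> tensor_bideg C C10 C01 2 0" unfolding True by (rule tensor_bideg_closed(1))
    then show ?thesis by (intro exI[of _ 2] exI[of _ 0]) simp
  next
    case False
    then obtain w x where w: "t w x \<noteq> 0" by (auto simp: fun_eq_iff)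
    then have "s w x \<noteq> 0" "word_bidegree C10 C01 w = (p, q)"
      unfolding s(2) bihom_component_apply by (auto split: if_splits)
    then have "length w = n" "set w \<subseteq> C" "word_bidegree C10 C01 w = (p, q)"
      using n(2) unfolding tensor_deg_iff tensors_iff by blast+
    then have "p + q = n" using word_bidegree_length[OF splitting] by fastforce
    then show ?thesis using t n by blast
  qed
qed

lemma relations_subset_ideal:
  assumes "S' \<subseteq> tensors C" "T \<subseteq> S'"
  shows "S \<subseteq> rel_ideal C S'"
proof
  fix t assume t: "t \<in> S"
  interpret ring "tensor_algebra C" by (rule tensor_algebra_ring)
  interpret I: ideal "rel_ideal C S'" "tensor_algebra C"
    unfolding rel_ideal_def by (rule genideal_ideal[OF assms(1)])
  obtain n where n: "t \<in> tensor_deg C n" using relation_deg[OF t] by blast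
  have "t w x = (\<Sum>p\<le>n. bihom_component C10 C01 p (n - p) t) w x" for w x
  proof -
    have "t w x = 0 \<or> length w = n" using n unfolding tensor_deg_iff by blast
    then show ?thesis using sum_bihom_components[OF splitting relations_tensors[OF t]] by auto
  qed
  then have eq: "t = (\<Sum>p\<le>n. bihom_component C10 C01 p (n - p) t)" by (intro ext)
  have mem: "bihom_component C10 C01 p (n - p) t \<in> rel_ideal C S'" for p
    using genideal_self[OF assms(1)] assms(2) t unfolding rel_ideal_def bihomogenise_def by blast
  have "sum F A \<in> rel_ideal C S'" if "\<And>p. F p \<in> rel_ideal C S'" for F :: "nat \<Rightarrow> _" and A
  proof (induction A rule: infinite_finite_induct)
    case (insert p A)
    have "F p + sum F A \<in> rel_ideal C S'"
      using additive_subgroup.a_closed[OF I.is_additive_subgroup that insert.IH]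
      by (simp only: tensor_algebra_simps)
    then show ?case by (simp only: sum.insert[OF insert.hyps])
  qed (use additive_subgroup.zero_closed[OF I.is_additive_subgroup]
       in \<open>simp_all only: tensor_algebra_simps sum.infinite sum.empty simp_thms\<close>)
  then show "t \<in> rel_ideal C S'" using mem eq by metis
qed

lemma dagger_component:
  assumes "t \<in> T"
  shows "dagger t \<in> T"
proof -
  obtain p q s where s: "s \<in> S" "t = bihom_component C10 C01 p q s"
    using assms unfolding bihomogenise_def by blast
  have inv: "- a \<in> C10 \<longleftrightarrow> a \<in> C01" "- a \<in> C01 \<longleftrightarrow> a \<in> C10" for a
    using inverse(1)[of "- a"] inverse(2)[of "- a"] inverse(1)[of a] inverse(2)[of a] by auto
  have "dagger t = bihom_component C10 C01 q p (dagger s)"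
    unfolding s(2) fun_eq_iff
    by (auto simp: dagger_def bihom_component_apply word_bidegree_star_word[OF inv] prod_eq_iff)
  then show ?thesis using dagger_relation[OF s(1)] unfolding bihomogenise_def by blast
qed

lemma bihomogeneous_relations_extend:
  assumes "T \<subseteq> S'" and "\<And>t. t \<in> S' \<Longrightarrow> \<exists>p q. t \<in> tensor_bideg C C10 C01 p q \<and> p + q \<ge> 2"
  shows "bihomogeneous_relations C C10 C01 S'"
proof
  have "S' \<subseteq> tensors C" using assms(2) unfolding tensor_bideg_iff by blast
  then show "product_relation C z \<in> rel_ideal C S'" if "z \<noteq> 0" for z
    using product_relation_in[OF that] relations_subset_ideal[OF _ assms(1)] by blast
qed (use finite_alphabet splitting inverse assms(2) in auto)

lemma further_quotient: "is_further_quotient C S T"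
proof (rule is_further_quotientI)
  show "homogeneous_relations C S"
    using finite_alphabet relations_tensors relation_deg by unfold_locales blast+
  interpret bihomogeneous_relations C C10 C01 T
    using components_bihomogeneous by (intro bihomogeneous_relations_extend) auto
  show "homogeneous_relations C T" by (rule homogeneous_relations_axioms)
  show "S \<subseteq> rel_ideal C T" by (rule relations_subset_ideal[OF components_closed subset_refl])
qed

lemma dolbeault: "is_dolbeault_complex C C10 C01 T"
proof -
  interpret bihomogeneous_relations C C10 C01 T
    using components_bihomogeneous by (intro bihomogeneous_relations_extend) auto
  interpret dolbeault_relations C C10 C01 T
    using dagger_component relations_in_ideal by unfold_locales blast
  show ?thesis by (rule dolbeault_complex)
qed

lemma exchange_relation_eq:
  "exchange_relations C C01 =
    {basis_form a \<star> basis_form (- b) + basis_form (a + (- b) - a) \<star> basis_form a | a b. a \<in> C01 \<and> b \<in> C01}"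
proof -
  have "braiding 0 (basis_form a \<star> basis_form b) = basis_form (a + b - a) \<star> basis_form a" for a b :: 'g
    using braiding_basis_form[where a = a and b = b and C = UNIV] unfolding tensor_algebra_simps .
  then show ?thesis unfolding exchange_relations_def tensor_algebra_simps by (simp only:)
qed

text \<open>An exchange relation has coefficient 1 at its two words, which are braided into each other,
  and 0 at all others; it is therefore symmetric as well.\<close>

lemma factorisable_relations_exchange:
  assumes conj: "\<forall>a\<in>C01. \<forall>b\<in>C01. a + (- b) - a \<in> C10"
  shows "factorisable_relations C C10 C01 (T \<union> exchange_relations C C01)"
proof -
  let ?S = "T \<union> exchange_relations C C01"
  have conj10: "a + b - a \<in> C10" if "a \<in> C01" "b \<in> C10" for a b
    using conj inverse(1)[OF that(2)] that(1) by (metis minus_minus)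
  have exchange_apply: "(basis_form a \<star> basis_form b + basis_form (a + b - a) \<star> basis_form a) w x
      = (if w = [a, b] then 1 else 0) + (if w = [a + b - a, a] then 1 else 0)" for a b :: 'g and w x
    by (simp add: basis_form_mult_basis_form)
  have bideg: "basis_form a \<star> basis_form b + basis_form (a + b - a) \<star> basis_form a \<in> tensor_bideg C C10 C01 1 1"
    if ab: "a \<in> C01" "b \<in> C10" for a b
  proof -
    have notin: "a \<notin> C10" "b \<notin> C01" "a + b - a \<notin> C01" using ab conj10[OF ab] splitting(2) by auto
    have "basis_form a \<star> basis_form b + basis_form (a + b - a) \<star> basis_form a \<in> tensors C"
      using ab conj10[OF ab] splitting(1) by (intro tensors_closed(1,2) basis_form_closed) auto
    then show ?thesis
      unfolding tensor_bideg_iff exchange_apply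
      using ab conj10[OF ab] notin by (auto simp: word_bidegree_def split: if_splits)
  qed
  interpret bihomogeneous_relations C C10 C01 ?S
  proof (rule bihomogeneous_relations_extend)
    show "\<exists>p q. t \<in> tensor_bideg C C10 C01 p q \<and> p + q \<ge> 2" if t: "t \<in> ?S" for t
    proof (cases "t \<in> T")
      case False
      then obtain a b where ab: "a \<in> C01" "b \<in> C01"
          "t = basis_form a \<star> basis_form (- b) + basis_form (a + (- b) - a) \<star> basis_form a"
        using t unfolding exchange_relation_eq by blast
      then have "t \<in> tensor_bideg C C10 C01 1 1" using bideg[OF ab(1) inverse(2)[OF ab(2)]] by simp
      then show ?thesis by (intro exI[of _ 1]) simp
    qed (rule components_bihomogeneous)
  qed simp
  show ?thesis
  proof
    show "basis_form a \<star> basis_form b + basis_form (a + b - a) \<star> basis_form a \<in> rel_ideal C ?S"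
      if "a \<in> C01" "b \<in> C10" for a b
    proof -
      have "basis_form a \<star> basis_form (- (- b)) + basis_form (a + - (- b) - a) \<star> basis_form a
          \<in> exchange_relations C C01"
        unfolding exchange_relation_eq using that inverse(1) by blast
      then show ?thesis using relations_in_ideal by auto
    qed
    show "a + b - a \<in> C10" if "a \<in> C01" "b \<in> C10" for a b by (rule conj10[OF that])
    show "t [a, b] x = t [a + b - a, a] x" if t: "t \<in> ?S" and ab: "a \<in> C01" "b \<in> C10" for t a b x
    proof (cases "t \<in> T")
      case True
      then obtain p q s where s: "s \<in> S" "t = bihom_component C10 C01 p q s"
        unfolding bihomogenise_def by blast
      have "word_bidegree C10 C01 [a, b] = word_bidegree C10 C01 [a + b - a, a]"
        using ab conj10[OF ab] splitting(2) by (auto simp: word_bidegree_def)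
      then show ?thesis
        unfolding s(2) bihom_component_apply
        using relation_exchange_symmetric[OF s(1), of a b x] ab conj10[OF ab] splitting(1) by auto
    next
      case False
      then obtain c e where ce: "c \<in> C01" "e \<in> C01"
          "t = basis_form c \<star> basis_form (- e) + basis_form (c + (- e) - c) \<star> basis_form c"
        using t unfolding exchange_relation_eq by blast
      \<comment> \<open>The words of the two terms start in \<open>C01\<close> and in \<open>C10\<close>, so they cannot be confused.\<close>
      have ne: "a \<noteq> c + - e - c" "a + b - a \<noteq> c"
        using ab ce conj10[OF ab] conj10[OF ce(1) inverse(2)[OF ce(2)]] splitting(2) by auto
      have "a + b - a = a + - e - a \<longleftrightarrow> b = - e"
        by (metis add_left_cancel diff_add_cancel)
      then show ?thesis unfolding ce(3) exchange_apply using ne by auto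
    qed
  qed
qed

end

theorem proposition4p5:
  fixes C C10 C01 :: "'g::group_add set" and S :: "'g tensor set"
  assumes "finite C" and "0 \<notin> C"
    and "C = C10 \<union> C01" and "C10 \<inter> C01 = {}"
    and "bij_betw uminus C10 C01"
    and "S = relations_L C \<or> S = relations_LL C \<or> (bicovariant C \<and> S = relations_Wor C)"
  shows "is_further_quotient C S (bihomogenise C10 C01 S)
    \<and> is_dolbeault_complex C C10 C01 (bihomogenise C10 C01 S)
    \<and> ((\<forall>a\<in>C01. \<forall>b\<in>C01. a + (- b) - a \<in> C10) \<longrightarrow>
        is_double_complex C C10 C01 (bihomogenise C10 C01 S \<union> exchange_relations C C01) \<and>
        factorisable_degree_2
          (ext_algebra C (bihomogenise C10 C01 S \<union> exchange_relations C C01))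
          (ext_deg C (bihomogenise C10 C01 S \<union> exchange_relations C C01))
          (ext_bideg C C10 C01 (bihomogenise C10 C01 S \<union> exchange_relations C C01)))"
proof -
  interpret calculus_relations C C10 C01 S
    using assms by unfold_locales
  have "is_double_complex C C10 C01 (T \<union> exchange_relations C C01) \<and>
      factorisable_degree_2 (ext_algebra C (T \<union> exchange_relations C C01))
        (ext_deg C (T \<union> exchange_relations C C01)) (ext_bideg C C10 C01 (T \<union> exchange_relations C C01))"
    if "\<forall>a\<in>C01. \<forall>b\<in>C01. a + (- b) - a \<in> C10"
  proof -
    interpret F: factorisable_relations C C10 C01 "T \<union> exchange_relations C C01"
      by (rule factorisable_relations_exchange[OF that])
    show ?thesis using F.double_complex F.factorisable by blast
  qed
  then show ?thesis using further_quotient dolbeault by blast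
qed

end
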